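(* Let $V$ be a $4$-dimensional compact (oriented) manifold with boundary, and let $(\lambda_t,\xi_t)_{t\in[0,1]}$ be a path of pre-Liouville structures on $V$. Assume that for $i\in\{0,1\}$, $(\lambda_i,\xi_i)$ is a Liouville structure, i.e. $\lambda_i$ is a Liouville form and $\ker\lambda_i|_{\partial V}=\xi_i$. Then $\lambda_0$ and $\lambda_1$ are Liouville homotopic.
   Context: A pre-Liouville structure on $V$ is a pair $(\lambda,\xi)$ where $\lambda\in\Omega^1(V)$ and $\xi$ is a cooriented contact structure on $\partial V$ (positive for the boundary orientation) such that $d\lambda$ is symplectic (inducing the orientation of $V$) and dominates $\xi$ along $\partial V$: $d\lambda|_\xi>0$, i.e. $d\lambda|_{\xi}$ is nondegenerate and induces the given orientation of $\xi$. A Liouville form on $V$ is a $1$-form $\lambda$ with $d\lambda$ symplectic and $\lambda|_{\partial V}$ a contact form (positive for the boundary orientation). Two Liouville forms are Liouville homotopic if they are joined by a path of Liouville forms on $V$. *)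

theory Defs
  imports "HOL-Analysis.Analysis"
begin

section \<open>Smooth maps\<close>

primrec Ck_on :: "nat \<Rightarrow> ('a::euclidean_space \<Rightarrow> 'b::real_normed_vector) \<Rightarrow> 'a set \<Rightarrow> bool" where
  "Ck_on 0 f U \<longleftrightarrow> continuous_on U f"
| "Ck_on (Suc k) f U \<longleftrightarrow>
     (\<exists>f'. (\<forall>x\<in>U. (f has_derivative f' x) (at x)) \<and> (\<forall>v. Ck_on k (\<lambda>x. f' x v) U))"

text \<open>On a set that need not be open (half-spaces, \<open>{0..1} \<times> S\<close>), smooth means: near each
  point, the restriction of a smooth map defined on an open set of the ambient space.\<close>

definition smooth_on :: "'a::euclidean_space set \<Rightarrow> ('a \<Rightarrow> 'b::real_normed_vector) \<Rightarrow> bool" where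
  "smooth_on S f \<longleftrightarrow>
     (\<forall>x\<in>S. \<exists>U g. open U \<and> x \<in> U \<and> (\<forall>k. Ck_on k g U) \<and> (\<forall>y\<in>S \<inter> U. g y = f y))"


section \<open>Oriented manifolds with boundary\<close>

text \<open>A manifold is given by a topology together with an indexed atlas; only the values of
  \<open>chart M i\<close> on \<open>chart_dom M i\<close> matter.\<close>

record ('a, 'i, 'n) manifold =
  top_of :: "'a topology"
  index :: "'i set"
  chart_dom :: "'i \<Rightarrow> 'a set"
  chart :: "'i \<Rightarrow> 'a \<Rightarrow> real ^ 'n"

definition chart_img :: "('a, 'i, 'n) manifold \<Rightarrow> 'i \<Rightarrow> (real ^ 'n) set" where
  "chart_img M i = chart M i ` chart_dom M i"

definition overlap :: "('a, 'i, 'n) manifold \<Rightarrow> 'i \<Rightarrow> 'i \<Rightarrow> (real ^ 'n) set" where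
  "overlap M i j = chart M i ` (chart_dom M i \<inter> chart_dom M j)"

definition transition :: "('a, 'i, 'n) manifold \<Rightarrow> 'i \<Rightarrow> 'i \<Rightarrow> real ^ 'n \<Rightarrow> real ^ 'n" where
  "transition M i j x = chart M j (inv_into (chart_dom M i) (chart M i) x)"

text \<open>Chart images are relatively open in a half-space (or in the whole space), so
  derivatives within them are unique.\<close>

definition D_transition ::
  "('a, 'i, 'n::finite) manifold \<Rightarrow> 'i \<Rightarrow> 'i \<Rightarrow> real ^ 'n \<Rightarrow> real ^ 'n \<Rightarrow> real ^ 'n" where
  "D_transition M i j x = frechet_derivative (transition M i j) (at x within overlap M i j)"

text \<open>Smooth oriented manifold modelled on \<open>H\<close>: a half-space for manifolds with boundary,
  \<open>UNIV\<close> for manifolds without boundary. Second countability is not listed because it is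
  automatic for compact manifolds.\<close>

definition oriented_manifold ::
  "(real ^ 'n::finite) set \<Rightarrow> ('a, 'i, 'n) manifold \<Rightarrow> bool" where
  "oriented_manifold H M \<longleftrightarrow>
     Hausdorff_space (top_of M) \<and>
     (\<Union>i\<in>index M. chart_dom M i) = topspace (top_of M) \<and>
     (\<forall>i\<in>index M.
        openin (top_of M) (chart_dom M i) \<and>
        openin (top_of_set H) (chart_img M i) \<and>
        homeomorphic_map (subtopology (top_of M) (chart_dom M i))
          (top_of_set (chart_img M i)) (chart M i)) \<and>
     (\<forall>i\<in>index M. \<forall>j\<in>index M.
        smooth_on (overlap M i j) (transition M i j) \<and>
        (\<forall>x\<in>overlap M i j. 0 < det (matrix (D_transition M i j x))))"

text \<open>With this model the outward normal is the first coordinate vector. Hence, by the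
  outward-normal-first convention, the last three coordinates of the charts of a manifold
  form charts of its boundary which are positive for the boundary orientation.\<close>

definition half_space4 :: "(real ^ 4) set" where
  "half_space4 = {x. x $ 1 \<le> 0}"

definition bd_incl :: "real ^ 3 \<Rightarrow> real ^ 4" where
  "bd_incl y = vector [0, y $ 1, y $ 2, y $ 3]"

definition bd_proj :: "real ^ 4 \<Rightarrow> real ^ 3" where
  "bd_proj x = vector [x $ 2, x $ 3, x $ 4]"

definition boundary_points :: "('a, 'i, 4) manifold \<Rightarrow> 'a set" where
  "boundary_points V =
     {p. \<exists>i\<in>index V. p \<in> chart_dom V i \<and> chart V i p $ 1 = 0}"

definition boundary :: "('a, 'i, 4) manifold \<Rightarrow> ('a, 'i, 3) manifold" where
  "boundary V = \<lparr>
     top_of = subtopology (top_of V) (boundary_points V),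
     index = index V,
     chart_dom = (\<lambda>i. chart_dom V i \<inter> boundary_points V),
     chart = (\<lambda>i p. bd_proj (chart V i p)) \<rparr>"


section \<open>Differential 1-forms and their derivatives\<close>

text \<open>A 1-form is given by its local coefficient vectors: in the chart \<open>i\<close> it is
  \<open>v \<mapsto> a i x \<bullet> v\<close>, i.e. the sum of the \<open>(a i x $ k) dx\<^sub>k\<close>.\<close>

type_synonym ('i, 'n) coeffs = "'i \<Rightarrow> real ^ 'n \<Rightarrow> real ^ 'n"

definition one_form :: "('a, 'i, 'n::finite) manifold \<Rightarrow> ('i, 'n) coeffs \<Rightarrow> bool" where
  "one_form M a \<longleftrightarrow>
     (\<forall>i\<in>index M. smooth_on (chart_img M i) (a i)) \<and>
     (\<forall>i\<in>index M. \<forall>j\<in>index M. \<forall>x\<in>overlap M i j. \<forall>v.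
        a i x \<bullet> v = a j (transition M i j x) \<bullet> D_transition M i j x v)"

definition form_eq :: "('a, 'i, 'n::finite) manifold \<Rightarrow> ('i, 'n) coeffs \<Rightarrow> ('i, 'n) coeffs \<Rightarrow> bool" where
  "form_eq M a b \<longleftrightarrow> (\<forall>i\<in>index M. \<forall>x\<in>chart_img M i. a i x = b i x)"

definition smooth_form_path ::
  "('a, 'i, 'n::finite) manifold \<Rightarrow> (real \<Rightarrow> ('i, 'n) coeffs) \<Rightarrow> bool" where
  "smooth_form_path M a \<longleftrightarrow>
     (\<forall>t\<in>{0..1}. one_form M (a t)) \<and>
     (\<forall>i\<in>index M. smooth_on ({0..1} \<times> chart_img M i) (\<lambda>(t, x). a t i x))"

text \<open>Exterior derivative of the coefficient field \<open>a\<close> on \<open>S\<close>, as a bilinear form: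
  the sum over \<open>k, l\<close> of \<open>(\<partial>\<^sub>k a\<^sub>l - \<partial>\<^sub>l a\<^sub>k) u\<^sub>k v\<^sub>l\<close>.\<close>

definition ext_deriv ::
  "(real ^ 'n::finite) set \<Rightarrow> (real ^ 'n \<Rightarrow> real ^ 'n) \<Rightarrow> real ^ 'n \<Rightarrow> real ^ 'n \<Rightarrow> real ^ 'n \<Rightarrow> real" where
  "ext_deriv S a x u v =
     frechet_derivative a (at x within S) u \<bullet> v - frechet_derivative a (at x within S) v \<bullet> u"

definition dform ::
  "('a, 'i, 'n::finite) manifold \<Rightarrow> ('i, 'n) coeffs \<Rightarrow> 'i \<Rightarrow> real ^ 'n \<Rightarrow> real ^ 'n \<Rightarrow> real ^ 'n \<Rightarrow> real" where
  "dform M a i x = ext_deriv (chart_img M i) (a i) x"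

definition wedge12 :: "('v \<Rightarrow> real) \<Rightarrow> ('v \<Rightarrow> 'v \<Rightarrow> real) \<Rightarrow> 'v \<Rightarrow> 'v \<Rightarrow> 'v \<Rightarrow> real" where
  "wedge12 \<alpha> \<omega> u v w = \<alpha> u * \<omega> v w - \<alpha> v * \<omega> u w + \<alpha> w * \<omega> u v"

definition wedge22 ::
  "('v \<Rightarrow> 'v \<Rightarrow> real) \<Rightarrow> ('v \<Rightarrow> 'v \<Rightarrow> real) \<Rightarrow> 'v \<Rightarrow> 'v \<Rightarrow> 'v \<Rightarrow> 'v \<Rightarrow> real" where
  "wedge22 \<omega> \<eta> u v w z =
     \<omega> u v * \<eta> w z - \<omega> u w * \<eta> v z + \<omega> u z * \<eta> v w +
     \<omega> v w * \<eta> u z - \<omega> v z * \<eta> u w + \<omega> w z * \<eta> u v"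

definition boundary_restrict :: "('i, 4) coeffs \<Rightarrow> ('i, 3) coeffs" where
  "boundary_restrict a i y = bd_proj (a i (bd_incl y))"


section \<open>Exact symplectic forms and contact structures\<close>

text \<open>\<open>da\<close> is automatically closed, so it is symplectic iff it is nondegenerate.\<close>

definition d_symplectic :: "('a, 'i, 4) manifold \<Rightarrow> ('i, 4) coeffs \<Rightarrow> bool" where
  "d_symplectic V a \<longleftrightarrow>
     (\<forall>i\<in>index V. \<forall>x\<in>chart_img V i. \<forall>u. (\<forall>v. dform V a i x u v = 0) \<longrightarrow> u = 0)"

text \<open>The orientation induced by a symplectic form \<open>\<omega>\<close> is that of \<open>\<omega> \<and> \<omega>\<close>.\<close>

definition d_induces_orientation :: "('a, 'i, 4) manifold \<Rightarrow> ('i, 4) coeffs \<Rightarrow> bool" where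
  "d_induces_orientation V a \<longleftrightarrow>
     (\<forall>i\<in>index V. \<forall>x\<in>chart_img V i.
        0 < wedge22 (dform V a i x) (dform V a i x) (axis 1 1) (axis 2 1) (axis 3 1) (axis 4 1))"

definition positive_contact_at ::
  "(real ^ 3) set \<Rightarrow> (real ^ 3 \<Rightarrow> real ^ 3) \<Rightarrow> real ^ 3 \<Rightarrow> bool" where
  "positive_contact_at S a x \<longleftrightarrow>
     0 < wedge12 ((\<bullet>) (a x)) (ext_deriv S a x) (axis 1 1) (axis 2 1) (axis 3 1)"

definition positive_contact_form :: "('a, 'i, 3) manifold \<Rightarrow> ('i, 3) coeffs \<Rightarrow> bool" where
  "positive_contact_form N a \<longleftrightarrow>
     one_form N a \<and> (\<forall>i\<in>index N. \<forall>x\<in>chart_img N i. positive_contact_at (chart_img N i) (a i) x)"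

text \<open>A cooriented plane field assigns to each point, in each chart, a plane of tangent vectors
  and the set of vectors positively transverse to that plane.\<close>

record coor_plane =
  plane :: "(real ^ 3) set"
  pos_side :: "(real ^ 3) set"

type_synonym 'i plane_field = "'i \<Rightarrow> real ^ 3 \<Rightarrow> coor_plane"

definition coor_ker :: "real ^ 3 \<Rightarrow> coor_plane" where
  "coor_ker a = \<lparr> plane = {v. a \<bullet> v = 0}, pos_side = {v. a \<bullet> v > 0} \<rparr>"

definition plane_field_compat :: "('a, 'i, 3) manifold \<Rightarrow> 'i plane_field \<Rightarrow> bool" where
  "plane_field_compat N \<xi> \<longleftrightarrow>
     (\<forall>i\<in>index N. \<forall>j\<in>index N. \<forall>x\<in>overlap N i j. \<forall>v.
        (v \<in> plane (\<xi> i x) \<longleftrightarrow> D_transition N i j x v \<in> plane (\<xi> j (transition N i j x))) \<and>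
        (v \<in> pos_side (\<xi> i x) \<longleftrightarrow> D_transition N i j x v \<in> pos_side (\<xi> j (transition N i j x))))"

text \<open>A contact structure is locally the kernel of contact forms. Asking for one defining form
  per chart is no restriction: smooth local defining forms of a cooriented plane field can be
  normalised to Euclidean unit length in the chart, and then they agree. The same applies to
  smooth paths of plane fields below.\<close>

definition coor_contact_structure :: "('a, 'i, 3) manifold \<Rightarrow> 'i plane_field \<Rightarrow> bool" where
  "coor_contact_structure N \<xi> \<longleftrightarrow>
     plane_field_compat N \<xi> \<and>
     (\<forall>i\<in>index N. \<exists>a. smooth_on (chart_img N i) a \<and>
        (\<forall>x\<in>chart_img N i. \<xi> i x = coor_ker (a x) \<and> positive_contact_at (chart_img N i) a x))"

definition smooth_contact_path ::
  "('a, 'i, 3) manifold \<Rightarrow> (real \<Rightarrow> 'i plane_field) \<Rightarrow> bool" where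
  "smooth_contact_path N \<xi> \<longleftrightarrow>
     (\<forall>t\<in>{0..1}. coor_contact_structure N (\<xi> t)) \<and>
     (\<forall>i\<in>index N. \<exists>a. smooth_on ({0..1} \<times> chart_img N i) a \<and>
        (\<forall>t\<in>{0..1}. \<forall>x\<in>chart_img N i. a (t, x) \<noteq> 0 \<and> \<xi> t i x = coor_ker (a (t, x))))"

text \<open>The plane \<open>\<xi>\<close> is oriented by its coorientation and the boundary orientation: \<open>(v, w)\<close> is a
  positive basis iff \<open>(n, v, w)\<close> is one for positively transverse \<open>n\<close>. For a positive contact
  structure this is the orientation given by \<open>d\<alpha>\<close>, for \<open>\<alpha>\<close> a cooriented contact form.
  Positivity of \<open>d\<lambda>\<close> on positive bases includes its nondegeneracy on the plane.\<close>

definition dominates :: "('a, 'i, 4) manifold \<Rightarrow> ('i, 4) coeffs \<Rightarrow> 'i plane_field \<Rightarrow> bool" where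
  "dominates V l \<xi> \<longleftrightarrow>
     (\<forall>i\<in>index V. \<forall>y\<in>chart_img (boundary V) i.
        \<forall>n\<in>pos_side (\<xi> i y). \<forall>v\<in>plane (\<xi> i y). \<forall>w\<in>plane (\<xi> i y).
          0 < det (vector [n, v, w] :: real ^ 3 ^ 3) \<longrightarrow>
          0 < dform V l i (bd_incl y) (bd_incl v) (bd_incl w))"


section \<open>Liouville and pre-Liouville structures\<close>

definition pre_Liouville :: "('a, 'i, 4) manifold \<Rightarrow> ('i, 4) coeffs \<Rightarrow> 'i plane_field \<Rightarrow> bool" where
  "pre_Liouville V l \<xi> \<longleftrightarrow>
     one_form V l \<and> coor_contact_structure (boundary V) \<xi> \<and>
     d_symplectic V l \<and> d_induces_orientation V l \<and> dominates V l \<xi>"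

definition pre_Liouville_path ::
  "('a, 'i, 4) manifold \<Rightarrow> (real \<Rightarrow> ('i, 4) coeffs) \<Rightarrow> (real \<Rightarrow> 'i plane_field) \<Rightarrow> bool" where
  "pre_Liouville_path V l \<xi> \<longleftrightarrow>
     smooth_form_path V l \<and> smooth_contact_path (boundary V) \<xi> \<and>
     (\<forall>t\<in>{0..1}. pre_Liouville V (l t) (\<xi> t))"

definition Liouville_form :: "('a, 'i, 4) manifold \<Rightarrow> ('i, 4) coeffs \<Rightarrow> bool" where
  "Liouville_form V l \<longleftrightarrow>
     one_form V l \<and> d_symplectic V l \<and>
     positive_contact_form (boundary V) (boundary_restrict l)"

definition Liouville_structure ::
  "('a, 'i, 4) manifold \<Rightarrow> ('i, 4) coeffs \<Rightarrow> 'i plane_field \<Rightarrow> bool" where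
  "Liouville_structure V l \<xi> \<longleftrightarrow>
     Liouville_form V l \<and>
     (\<forall>i\<in>index V. \<forall>y\<in>chart_img (boundary V) i.
        {v. boundary_restrict l i y \<bullet> v = 0} = plane (\<xi> i y))"

definition Liouville_homotopic ::
  "('a, 'i, 4) manifold \<Rightarrow> ('i, 4) coeffs \<Rightarrow> ('i, 4) coeffs \<Rightarrow> bool" where
  "Liouville_homotopic V l0 l1 \<longleftrightarrow>
     (\<exists>m. smooth_form_path V m \<and> (\<forall>t\<in>{0..1}. Liouville_form V (m t)) \<and>
          form_eq V (m 0) l0 \<and> form_eq V (m 1) l1)"

end

theory Submission
  imports Defs
begin

text \<open>Interpolate by \<open>m\<^sub>t = \<lambda>\<^sub>t + K t (1 - t) e\<^bsup>N r\<^esup> \<alpha>\<^sub>t\<close>. Here \<open>r \<le> 0\<close> is a boundary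
  defining function of \<open>V\<close> and \<open>\<alpha>\<^sub>t\<close> a path of 1-forms on \<open>V\<close> whose restriction to the boundary
  is a contact form for \<open>\<xi>\<^sub>t\<close>; both are sums of bump functions times local data. On the boundary,
  with \<open>s = K t (1 - t)\<close>, the contact condition for \<open>m\<^sub>t\<close> is the positivity of
  \<open>\<lambda> \<and> d\<lambda> + s (\<alpha> \<and> d\<lambda> + \<lambda> \<and> d\<alpha>) + s\<^sup>2 \<alpha> \<and> d\<alpha>\<close>. The last coefficient is always positive, and the
  other two are positive for \<open>t\<close> near 0 and 1, where \<open>\<lambda>\<close> restricts to a positive multiple of \<open>\<alpha>\<close>.
  Hence it holds for \<open>K\<close> large. Then, with \<open>c = s e\<^bsup>N r\<^esup>\<close>,
  \<open>dm\<^sup>2 = d\<lambda>\<^sup>2 + 2 c (N dr \<and> \<alpha> + d\<alpha>) \<and> d\<lambda> + c\<^sup>2 (2 N dr \<and> \<alpha> + d\<alpha>) \<and> d\<alpha>\<close>.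
  For \<open>N\<close> large this is positive: near the boundary because \<open>d\<lambda>\<close> dominates \<open>\<xi>\<close> and \<open>\<alpha>\<close> is contact,
  and away from it because \<open>N c\<close> is exponentially small.\<close>

section \<open>Calculus of smooth maps\<close>

text \<open>For \<open>0 < t < 1\<close> the form \<open>\<lambda>\<^sub>t\<close> can fail to be
  Liouville only along the boundary: domination makes its differential positive on
  \<open>\<xi>\<^sub>t\<close>, but nothing forces its restriction to be contact. A multiple of
  \<open>\<alpha>\<^sub>t\<close> repairs this, and the factor \<open>t (1 - t)\<close> keeps the
  endpoints fixed. The order of the constants matters. On the boundary r vanishes, so the
  exponential is 1, and dr vanishes on vectors tangent to the boundary; hence the contact condition
  does not see N. So K can be chosen first, whatever it does to dm in the interior, and N is then
  chosen depending on K. Dimension 4 enters by counting factors: next to dr and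
  \<open>\<alpha>\<close> there is room for just one more two-form, \<open>d\<lambda>\<close> or
  \<open>d\<alpha>\<close>, and domination and contactness are the positivity of these two products
  along the boundary. Both conditions are phrased through top forms on V, the square of dm and,
  along the boundary, the product of dr, m and dm. Their coefficients change by the positive
  Jacobian determinant of a transition map, so estimates on finitely many compact pieces of charts
  suffice.\<close>

lemma Ck_on_subset: "Ck_on k f U \<Longrightarrow> V \<subseteq> U \<Longrightarrow> Ck_on k f V"
proof (induction k arbitrary: f)
  case 0
  then show ?case by (auto intro: continuous_on_subset)
next
  case (Suc k)
  then show ?case by (simp, meson subsetD)
qed

lemma Ck_on_SucD: "Ck_on (Suc k) f U \<Longrightarrow> Ck_on k f U"
proof (induction k arbitrary: f)
  case 0
  then show ?case
    by (auto intro!: continuous_at_imp_continuous_on dest: has_derivative_continuous)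
next
  case (Suc k)
  then obtain f' where "\<forall>x\<in>U. (f has_derivative f' x) (at x)" "\<forall>v. Ck_on (Suc k) (\<lambda>x. f' x v) U"
    unfolding Ck_on.simps(2)[of "Suc k"] by blast
  with Suc.IH show ?case unfolding Ck_on.simps(2)[of k] by blast
qed

lemma Ck_on_cong:
  assumes "open U" "\<And>x. x \<in> U \<Longrightarrow> f x = g x" "Ck_on k f U"
  shows "Ck_on k g U"
proof (cases k)
  case 0
  then show ?thesis using assms by (simp cong: continuous_on_cong)
next
  case (Suc n)
  with assms(3) obtain f' where
    f': "\<forall>x\<in>U. (f has_derivative f' x) (at x)" "\<forall>v. Ck_on n (\<lambda>x. f' x v) U"
    by auto
  then have "\<forall>x\<in>U. (g has_derivative f' x) (at x)"
    using has_derivative_transform_within_open[of f _ _ UNIV U g] assms(1,2) by blast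
  with f'(2) Suc show ?thesis by auto
qed

lemma Ck_on_const: "Ck_on k (\<lambda>x. c) U"
proof (induction k arbitrary: c)
  case (Suc k)
  show ?case by (simp, rule exI[of _ "\<lambda>x v. 0"]) (auto simp: Suc)
qed simp

lemma Ck_on_bounded_linear:
  assumes "bounded_linear L"
  shows "Ck_on k L U"
  by (cases k) (auto simp: assms Ck_on_const bounded_linear_imp_has_derivative
      linear_continuous_on intro!: exI[of _ "\<lambda>x. L"])

lemma Ck_on_compose_linear:
  assumes "bounded_linear L" "Ck_on k f U"
  shows "Ck_on k (\<lambda>x. L (f x)) U"
  using assms(2)
proof (induction k arbitrary: f)
  case 0
  then show ?case using bounded_linear.continuous_on[OF assms(1)] by simp
next
  case (Suc k)
  then obtain f' where f': "\<forall>x\<in>U. (f has_derivative f' x) (at x)" "\<forall>v. Ck_on k (\<lambda>x. f' x v) U"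
    by auto
  show ?case
    unfolding Ck_on.simps
    using f' Suc.IH
    by (intro exI[of _ "\<lambda>x v. L (f' x v)"]) (auto intro: bounded_linear.has_derivative[OF assms(1)])
qed

lemma Ck_on_add:
  assumes "Ck_on k f U" "Ck_on k g U"
  shows "Ck_on k (\<lambda>x. f x + g x) U"
  using assms
proof (induction k arbitrary: f g)
  case 0
  then show ?case by (auto intro: continuous_on_add)
next
  case (Suc k)
  then obtain f' g' where
    "\<forall>x\<in>U. (f has_derivative f' x) (at x)" "\<forall>v. Ck_on k (\<lambda>x. f' x v) U"
    "\<forall>x\<in>U. (g has_derivative g' x) (at x)" "\<forall>v. Ck_on k (\<lambda>x. g' x v) U"
    by auto
  then show ?case
    unfolding Ck_on.simps using Suc.IH
    by (intro exI[of _ "\<lambda>x v. f' x v + g' x v"]) (auto intro: has_derivative_add)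
qed

lemma Ck_on_sum:
  "(\<And>i. i \<in> I \<Longrightarrow> Ck_on k (f i) U) \<Longrightarrow> Ck_on k (\<lambda>x. \<Sum>i\<in>I. f i x) U"
  by (induction I rule: infinite_finite_induct) (auto intro: Ck_on_const Ck_on_add)

text \<open>One product rule for all bounded bilinear maps covers scaling, multiplication and inner
  products.\<close>

lemma (in bounded_bilinear) Ck_on_prod:
  fixes f :: "'d::euclidean_space \<Rightarrow> 'a"
  assumes "Ck_on k f U" "Ck_on k g U"
  shows "Ck_on k (\<lambda>x. prod (f x) (g x)) U"
  using assms
proof (induction k arbitrary: f g)
  case 0
  then show ?case by (auto intro: continuous_on)
next
  case (Suc k)
  then obtain f' g' where
    f': "\<forall>x\<in>U. (f has_derivative f' x) (at x)" "\<forall>v. Ck_on k (\<lambda>x. f' x v) U" and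
    g': "\<forall>x\<in>U. (g has_derivative g' x) (at x)" "\<forall>v. Ck_on k (\<lambda>x. g' x v) U"
    by auto
  show ?case
    unfolding Ck_on.simps
    using f' g' Suc.IH Ck_on_SucD[OF Suc.prems(1)] Ck_on_SucD[OF Suc.prems(2)]
    by (intro exI[of _ "\<lambda>x v. prod (f x) (g' x v) + prod (f' x v) (g x)"])
      (auto intro: FDERIV Ck_on_add)
qed

text \<open>The chain rule yields \<open>f' (g x) (g' x v)\<close>, whose direction moves with
  \<open>x\<close>, whereas \<open>Ck_on\<close> controls \<open>f'\<close> only in fixed
  directions. Expanding the direction in the basis gives a sum of products to which the induction
  hypothesis applies.\<close>

lemma Ck_on_compose:
  fixes g :: "'a::euclidean_space \<Rightarrow> 'b::euclidean_space"
  assumes "Ck_on k g U" "Ck_on k f W" "g ` U \<subseteq> W"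
  shows "Ck_on k (\<lambda>x. f (g x)) U"
  using assms
proof (induction k arbitrary: f)
  case 0
  then show ?case by (auto intro: continuous_on_compose2)
next
  case (Suc k)
  then obtain f' g' where
    f': "\<forall>y\<in>W. (f has_derivative f' y) (at y)" "\<forall>v. Ck_on k (\<lambda>y. f' y v) W" and
    g': "\<forall>x\<in>U. (g has_derivative g' x) (at x)" "\<forall>v. Ck_on k (\<lambda>x. g' x v) U"
    by auto
  let ?D = "\<lambda>x v. \<Sum>b\<in>Basis. (g' x v \<bullet> b) *\<^sub>R f' (g x) b"
  have "((\<lambda>x. f (g x)) has_derivative ?D x) (at x)" if "x \<in> U" for x
  proof -
    have gx: "g x \<in> W" using that Suc.prems(3) by auto
    have "((\<lambda>x. f (g x)) has_derivative (\<lambda>v. f' (g x) (g' x v))) (at x)"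
      using has_derivative_compose[of g "g' x" x UNIV f] f' g' gx that by auto
    moreover have "f' (g x) (g' x v) = ?D x v" for v
    proof -
      have "linear (f' (g x))"
        using f' gx by (meson has_derivative_linear)
      then have "f' (g x) (\<Sum>b\<in>Basis. (g' x v \<bullet> b) *\<^sub>R b) = ?D x v"
        by (simp add: linear_sum linear_scale)
      then show ?thesis by (simp add: euclidean_representation)
    qed
    ultimately show ?thesis by (simp only:)
  qed
  moreover have "Ck_on k (\<lambda>x. ?D x v) U" for v
    by (intro Ck_on_sum bounded_bilinear.Ck_on_prod[OF bounded_bilinear_scaleR]
        Ck_on_compose_linear[OF bounded_linear_inner_left] g'(2)[rule_format]
        Suc.IH[OF Ck_on_SucD[OF Suc.prems(1)] f'(2)[rule_format] Suc.prems(3)])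
  ultimately show ?case
    unfolding Ck_on.simps by (intro exI[of _ ?D]) auto
qed

lemma Ck_on_Suc_frechet:
  assumes "Ck_on (Suc k) f U" "x \<in> U"
  shows "(f has_derivative frechet_derivative f (at x)) (at x)"
proof -
  obtain f' where "(f has_derivative f') (at x)" using assms by auto
  then show ?thesis using frechet_derivative_at by fastforce
qed

text \<open>Derivatives at a point of the whole space are unique, so the unnamed derivative in
  \<open>Ck_on\<close> is \<open>frechet_derivative\<close> on \<open>U\<close>; openness lets this
  equality be differentiated again.\<close>

lemma Ck_on_frechet:
  assumes "open U" "Ck_on (Suc k) f U"
  shows "Ck_on k (\<lambda>x. frechet_derivative f (at x) v) U"
proof -
  obtain f' where f': "\<forall>x\<in>U. (f has_derivative f' x) (at x)" "\<forall>v. Ck_on k (\<lambda>x. f' x v) U"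
    using assms by auto
  have "f' x v = frechet_derivative f (at x) v" if "x \<in> U" for x
    using frechet_derivative_at[OF f'(1)[rule_format, OF that]] by simp
  from Ck_on_cong[OF assms(1) this f'(2)[rule_format]] show ?thesis .
qed

lemma smooth_onI:
  assumes "\<And>x. x \<in> S \<Longrightarrow> \<exists>U g. open U \<and> x \<in> U \<and> (\<forall>k. Ck_on k g U) \<and> (\<forall>y\<in>S \<inter> U. g y = f y)"
  shows "smooth_on S f"
  using assms unfolding smooth_on_def by blast

lemma smooth_onE:
  assumes "smooth_on S f" "x \<in> S"
  obtains U g where "open U" "x \<in> U" "\<And>k. Ck_on k g U" "\<And>y. y \<in> S \<inter> U \<Longrightarrow> g y = f y"
  using assms unfolding smooth_on_def by meson

lemma smooth_on_global: "(\<And>k. Ck_on k f UNIV) \<Longrightarrow> smooth_on S f"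
  by (rule smooth_onI, rule exI[of _ UNIV], rule exI[of _ f]) auto

lemmas smooth_on_const = smooth_on_global[OF Ck_on_const]
lemmas smooth_on_linear = smooth_on_global[OF Ck_on_bounded_linear]

lemma smooth_on_cong: "smooth_on S f \<Longrightarrow> (\<And>x. x \<in> S \<Longrightarrow> f x = g x) \<Longrightarrow> smooth_on S g"
  by (rule smooth_onI, erule smooth_onE, assumption) (metis IntD1)

lemma smooth_on_compose:
  fixes g :: "'a::euclidean_space \<Rightarrow> 'b::euclidean_space"
  assumes "smooth_on S g" "smooth_on T f" "g ` S \<subseteq> T"
  shows "smooth_on S (\<lambda>x. f (g x))"
proof (rule smooth_onI)
  fix x assume x: "x \<in> S"
  obtain U g' where U: "open U" "x \<in> U" "\<And>k. Ck_on k g' U" "\<And>y. y \<in> S \<inter> U \<Longrightarrow> g' y = g y"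
    using smooth_onE[OF assms(1) x] by blast
  have "g x \<in> T" using x assms(3) by auto
  then obtain W f' where W: "open W" "g x \<in> W" "\<And>k. Ck_on k f' W" "\<And>y. y \<in> T \<inter> W \<Longrightarrow> f' y = f y"
    using smooth_onE[OF assms(2)] by blast
  let ?U = "U \<inter> g' -` W"
  have "continuous_on U g'" using U(3)[of 0] by simp
  then have "open ?U" using U(1) W(1) by (simp add: continuous_open_preimage)
  moreover have "x \<in> ?U" using U x W by auto
  moreover have "Ck_on k (\<lambda>x. f' (g' x)) ?U" for k
    by (rule Ck_on_compose[OF Ck_on_subset[OF U(3)] W(3)]) auto
  moreover have "\<forall>y\<in>S \<inter> ?U. f' (g' y) = f (g y)" using U(4) W(4) assms(3) by auto
  ultimately show "\<exists>U h. open U \<and> x \<in> U \<and> (\<forall>k. Ck_on k h U) \<and> (\<forall>y\<in>S \<inter> U. h y = f (g y))"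
    by blast
qed

lemma (in bounded_bilinear) smooth_on_prod:
  fixes f :: "'d::euclidean_space \<Rightarrow> 'a"
  assumes "smooth_on S f" "smooth_on S g"
  shows "smooth_on S (\<lambda>x. prod (f x) (g x))"
proof (rule smooth_onI)
  fix x assume x: "x \<in> S"
  obtain U f' where U: "open U" "x \<in> U" "\<And>k. Ck_on k f' U" "\<And>y. y \<in> S \<inter> U \<Longrightarrow> f' y = f y"
    using smooth_onE[OF assms(1) x] by blast
  obtain W g' where W: "open W" "x \<in> W" "\<And>k. Ck_on k g' W" "\<And>y. y \<in> S \<inter> W \<Longrightarrow> g' y = g y"
    using smooth_onE[OF assms(2) x] by blast
  have "Ck_on k (\<lambda>y. prod (f' y) (g' y)) (U \<inter> W)" for k
    by (rule Ck_on_prod[OF Ck_on_subset[OF U(3)] Ck_on_subset[OF W(3)]]) auto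
  with U W show "\<exists>U h. open U \<and> x \<in> U \<and> (\<forall>k. Ck_on k h U) \<and> (\<forall>y\<in>S \<inter> U. h y = prod (f y) (g y))"
    by (intro exI[of _ "U \<inter> W"] exI[of _ "\<lambda>y. prod (f' y) (g' y)"]) auto
qed

lemma smooth_on_add:
  assumes "smooth_on S f" "smooth_on S g"
  shows "smooth_on S (\<lambda>x. f x + g x)"
proof (rule smooth_onI)
  fix x assume x: "x \<in> S"
  obtain U f' where U: "open U" "x \<in> U" "\<And>k. Ck_on k f' U" "\<And>y. y \<in> S \<inter> U \<Longrightarrow> f' y = f y"
    using smooth_onE[OF assms(1) x] by blast
  obtain W g' where W: "open W" "x \<in> W" "\<And>k. Ck_on k g' W" "\<And>y. y \<in> S \<inter> W \<Longrightarrow> g' y = g y"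
    using smooth_onE[OF assms(2) x] by blast
  have "Ck_on k (\<lambda>y. f' y + g' y) (U \<inter> W)" for k
    by (rule Ck_on_add[OF Ck_on_subset[OF U(3)] Ck_on_subset[OF W(3)]]) auto
  with U W show "\<exists>U h. open U \<and> x \<in> U \<and> (\<forall>k. Ck_on k h U) \<and> (\<forall>y\<in>S \<inter> U. h y = f y + g y)"
    by (intro exI[of _ "U \<inter> W"] exI[of _ "\<lambda>y. f' y + g' y"]) auto
qed

lemma smooth_on_sum:
  "(\<And>i. i \<in> I \<Longrightarrow> smooth_on S (f i)) \<Longrightarrow> smooth_on S (\<lambda>x. \<Sum>i\<in>I. f i x)"
  by (induction I rule: infinite_finite_induct) (auto intro: smooth_on_const smooth_on_add)

lemmas smooth_on_scaleR = bounded_bilinear.smooth_on_prod[OF bounded_bilinear_scaleR]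
lemmas smooth_on_mult = bounded_bilinear.smooth_on_prod[OF bounded_bilinear_mult]
lemmas smooth_on_inner = bounded_bilinear.smooth_on_prod[OF bounded_bilinear_inner]

lemma smooth_on_compose_linear:
  fixes f :: "'a::euclidean_space \<Rightarrow> 'b::euclidean_space"
  assumes "bounded_linear L" "smooth_on S f"
  shows "smooth_on S (\<lambda>x. L (f x))"
  by (rule smooth_on_compose[OF assms(2) smooth_on_linear[OF assms(1), of UNIV]]) simp

lemma smooth_on_Pair:
  fixes f :: "'a::euclidean_space \<Rightarrow> 'b::euclidean_space" and g :: "'a \<Rightarrow> 'c::euclidean_space"
  assumes "smooth_on S f" "smooth_on S g"
  shows "smooth_on S (\<lambda>x. (f x, g x))"
proof -
  have "bounded_linear (\<lambda>x::'b. (x, 0::'c))" "bounded_linear (\<lambda>x::'c. (0::'b, x))"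
    by (auto intro!: bounded_linear_Pair bounded_linear_ident bounded_linear_zero)
  from smooth_on_add[OF smooth_on_compose_linear[OF this(1) assms(1)]
      smooth_on_compose_linear[OF this(2) assms(2)]]
  show ?thesis by simp
qed

text \<open>Serves to glue a local expression to the zero function. Relative openness allows the
  local extension to be shrunk until it meets only one of the two pieces.\<close>

lemma smooth_on_openin_Un:
  assumes "smooth_on A f" "smooth_on B f"
    and "openin (top_of_set (A \<union> B)) A" "openin (top_of_set (A \<union> B)) B"
  shows "smooth_on (A \<union> B) f"
proof -
  have "\<exists>U g. open U \<and> x \<in> U \<and> (\<forall>k. Ck_on k g U) \<and> (\<forall>y\<in>(A \<union> B) \<inter> U. g y = f y)"
    if C: "smooth_on C f" "openin (top_of_set (A \<union> B)) C" "x \<in> C" for C x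
  proof -
    obtain U g where U: "open U" "x \<in> U" "\<And>k. Ck_on k g U" "\<And>y. y \<in> C \<inter> U \<Longrightarrow> g y = f y"
      using smooth_onE[OF C(1,3)] by blast
    obtain W where W: "open W" "C = (A \<union> B) \<inter> W" using C(2) by (auto simp: openin_open)
    then show ?thesis
      using U Ck_on_subset[OF U(3)] C(3)
      by (intro exI[of _ "U \<inter> W"] exI[of _ g]) auto
  qed
  then show ?thesis using assms by (intro smooth_onI) blast
qed

lemma smooth_on_continuous_on:
  assumes "smooth_on S f"
  shows "continuous_on S f"
  unfolding continuous_on_eq_continuous_within
proof
  fix x assume x: "x \<in> S"
  obtain U g where U: "open U" "x \<in> U" "\<And>k. Ck_on k g U" "\<And>y. y \<in> S \<inter> U \<Longrightarrow> g y = f y"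
    using smooth_onE[OF assms x] by blast
  have "continuous (at x within S) g"
    using U(3)[of 0] U(1,2) by (auto simp: continuous_on_eq_continuous_at intro: continuous_at_imp_continuous_at_within)
  moreover have "eventually (\<lambda>y. g y = f y) (at x within S)"
    unfolding eventually_at_topological using U by blast
  ultimately show "continuous (at x within S) f"
    unfolding continuous_within using U(4)[of x] U(2) x by (auto intro: Lim_transform_eventually)
qed

lemma smooth_on_differentiable:
  assumes "smooth_on S f" "x \<in> S"
  shows "f differentiable (at x within S)"
proof -
  obtain U g where U: "open U" "x \<in> U" "\<And>k. Ck_on k g U" "\<And>y. y \<in> S \<inter> U \<Longrightarrow> g y = f y"
    using smooth_onE[OF assms] by blast
  obtain d where d: "d > 0" "ball x d \<subseteq> U" using U(1,2) openE by blast
  have "(g has_derivative frechet_derivative g (at x)) (at x within S)"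
    using Ck_on_Suc_frechet[OF U(3) U(2)] by (rule has_derivative_at_withinI)
  then have "(f has_derivative frechet_derivative g (at x)) (at x within S)"
    by (rule has_derivative_transform_within[OF _ d(1) assms(2)])
      (use U(4) d(2) in \<open>auto simp: subset_eq dist_commute\<close>)
  then show ?thesis by (rule differentiableI)
qed

section \<open>Smooth functions that are flat at the origin\<close>

definition flat :: "nat \<Rightarrow> real \<Rightarrow> real" where
  "flat n x = (if x > 0 then inverse x ^ n * exp (- inverse x) else 0)"

text \<open>This is the difference quotient at 0. From the right, the substitution u = 1/h turns it
  into a power of u divided by exp u, at infinity.\<close>

lemma flat_quotient_tendsto_0: "((\<lambda>h. flat n h / h) \<longlongrightarrow> 0) (at 0)"
proof (rule filterlim_split_at)
  have "eventually (\<lambda>h. flat n h / h = 0) (at_left 0)"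
    by (rule eventually_at_leftI[of "-1"]) (auto simp: flat_def)
  then show "((\<lambda>h. flat n h / h) \<longlongrightarrow> 0) (at_left 0)"
    by (rule tendsto_eventually)
next
  have "((\<lambda>h. inverse h ^ Suc n / exp (inverse h)) \<longlongrightarrow> 0) (at_right (0::real))"
    by (rule filterlim_compose[OF tendsto_power_div_exp_0 filterlim_inverse_at_top_right])
  moreover have "eventually (\<lambda>h. inverse h ^ Suc n / exp (inverse h) = flat n h / h) (at_right (0::real))"
    by (rule eventually_at_rightI[of _ 1]) (auto simp: flat_def exp_minus divide_simps)
  ultimately show "((\<lambda>h. flat n h / h) \<longlongrightarrow> 0) (at_right 0)"
    by (rule Lim_transform_eventually)
qed

text \<open>The powers of \<open>inverse x\<close> are carried along because they make the family
  closed under differentiation up to linear combinations; smoothness of all members then follows by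
  a single induction.\<close>

lemma flat_has_derivative:
  "(flat n has_real_derivative flat (n + 2) x - real n * flat (n + 1) x) (at x)"
proof -
  consider "x > 0" | "x < 0" | "x = 0" by linarith
  then show ?thesis
  proof cases
    case 1
    have "((\<lambda>x. inverse x ^ n * exp (- inverse x)) has_real_derivative
        flat (n + 2) x - real n * flat (n + 1) x) (at x)"
      using 1
      by (auto intro!: derivative_eq_intros simp: flat_def)
        (cases n; auto simp: power2_eq_square field_simps)
    then show ?thesis
      by (rule has_field_derivative_transform_within_open[where S="{0<..}"])
        (use 1 in \<open>auto simp: flat_def\<close>)
  next
    case 2
    have "((\<lambda>x. 0) has_real_derivative 0) (at x)" by simp
    then have "(flat n has_real_derivative 0) (at x)"
      by (rule has_field_derivative_transform_within_open[where S="{..<0}"])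
        (use 2 in \<open>auto simp: flat_def\<close>)
    then show ?thesis using 2 by (simp add: flat_def)
  next
    case 3
    have "(\<lambda>h. (flat n (0 + h) - flat n 0) / h) = (\<lambda>h. flat n h / h)"
      by (auto simp: flat_def)
    then have "(flat n has_real_derivative 0) (at 0)"
      unfolding DERIV_def using flat_quotient_tendsto_0[of n] by simp
    then show ?thesis using 3 by (simp add: flat_def)
  qed
qed

lemma Ck_on_real_derivative:
  fixes f :: "real \<Rightarrow> real"
  assumes "\<And>x. (f has_real_derivative f' x) (at x)" "Ck_on k f' U"
  shows "Ck_on (Suc k) f U"
  unfolding Ck_on.simps
  using assms(1) Ck_on_compose_linear[OF bounded_linear_mult_left assms(2)]
  by (intro exI[of _ "\<lambda>x v. f' x * v"]) (auto simp: has_field_derivative_def)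

lemma Ck_on_flat: "Ck_on k (flat n) U"
proof (induction k arbitrary: n)
  case 0
  then show ?case
    using flat_has_derivative by (auto intro!: continuous_at_imp_continuous_on DERIV_isCont)
next
  case (Suc k)
  have "Ck_on k (\<lambda>x. flat (n + 2) x + (- real n) * flat (n + 1) x) U"
    by (intro Ck_on_add Suc Ck_on_compose_linear[OF bounded_linear_mult_right])
  then show ?case
    by (intro Ck_on_real_derivative[OF flat_has_derivative]) simp
qed

lemma Ck_on_exp: "Ck_on k (exp :: real \<Rightarrow> real) U"
proof (induction k)
  case (Suc k)
  then show ?case by (intro Ck_on_real_derivative[OF DERIV_exp])
qed (auto intro: continuous_intros)

lemmas smooth_on_flat = smooth_on_global[OF Ck_on_flat]
lemmas smooth_on_exp = smooth_on_global[OF Ck_on_exp]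

lemma flat_pos: "x > 0 \<Longrightarrow> flat n x > 0" and flat_eq_0: "x \<le> 0 \<Longrightarrow> flat n x = 0"
  by (auto simp: flat_def)

lemma flat_nonneg: "flat n x \<ge> 0"
  by (auto simp: flat_def)

section \<open>Symmetry of second derivatives\<close>

lemma second_difference_mvt:
  fixes g :: "'a::euclidean_space \<Rightarrow> real"
  assumes U: "ball x e \<subseteq> U" "open U" and g: "Ck_on 2 g U"
    and h: "h > 0" "h * (norm u + norm v) < e"
  obtains p where "dist x p \<le> h * (norm u + norm v)"
    "g (x + h *\<^sub>R u + h *\<^sub>R v) - g (x + h *\<^sub>R u) - g (x + h *\<^sub>R v) + g x
      = h\<^sup>2 * frechet_derivative (\<lambda>y. frechet_derivative g (at y) u) (at p) v"
proof -
  define G where "G y = frechet_derivative g (at y)" for y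
  have g2: "Ck_on (Suc (Suc 0)) g U" using g by (simp add: numeral_2_eq_2)
  have near: "dist x (x + s *\<^sub>R u + t *\<^sub>R v) \<le> h * (norm u + norm v)"
    if "0 \<le> s" "s \<le> h" "0 \<le> t" "t \<le> h" for s t
  proof -
    have "dist x (x + s *\<^sub>R u + t *\<^sub>R v) = norm (s *\<^sub>R u + t *\<^sub>R v)"
      using norm_minus_cancel[of "s *\<^sub>R u + t *\<^sub>R v"] by (simp add: dist_norm)
    also have "\<dots> \<le> s * norm u + t * norm v"
      using norm_triangle_ineq[of "s *\<^sub>R u" "t *\<^sub>R v"] that by simp
    also have "\<dots> \<le> h * norm u + h * norm v"
      using that by (intro add_mono mult_right_mono) auto
    finally show ?thesis by (simp add: distrib_left)
  qed
  have inU: "x + s *\<^sub>R u + t *\<^sub>R v \<in> U" if "0 \<le> s" "s \<le> h" "0 \<le> t" "t \<le> h" for s t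
  proof -
    have "x + s *\<^sub>R u + t *\<^sub>R v \<in> ball x e" using near[OF that] h by simp
    then show ?thesis using U by blast
  qed
  have dg: "(g has_derivative G y) (at y)" if "y \<in> U" for y
    unfolding G_def by (rule Ck_on_Suc_frechet[OF g2 that])
  have dG: "((\<lambda>y. G y u) has_derivative frechet_derivative (\<lambda>y. G y u) (at y)) (at y)" if "y \<in> U" for y
    unfolding G_def using Ck_on_Suc_frechet[OF Ck_on_frechet[OF U(2) g2] that] .
  have line: "((\<lambda>s. f (c + s *\<^sub>R w)) has_real_derivative f' w) (at s)"
    if "(f has_derivative f') (at (c + s *\<^sub>R w))" for f :: "'a \<Rightarrow> real" and f' c w s
  proof -
    have "((\<lambda>s. c + s *\<^sub>R w) has_derivative (\<lambda>r. r *\<^sub>R w)) (at s)"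
      by (auto intro!: derivative_eq_intros)
    from has_derivative_compose[OF this that]
    have "((\<lambda>s. f (c + s *\<^sub>R w)) has_derivative (\<lambda>r. f' (r *\<^sub>R w))) (at s)" .
    moreover have "f' (r *\<^sub>R w) = r * f' w" for r
      using has_derivative_linear[OF that] by (simp add: linear_scale)
    moreover have "(\<lambda>r. r * f' w) = (*) (f' w)" by (auto simp: mult.commute)
    ultimately show ?thesis by (simp add: has_field_derivative_def)
  qed
  \<comment> \<open>The increment of \<open>g\<close> between two parallel segments in direction
    \<open>u\<close>. The mean value theorem in \<open>s\<close> leaves an increment of the first
    derivative in direction \<open>v\<close>, to which the theorem is applied again.\<close>
  define \<phi> where "\<phi> s = g (x + h *\<^sub>R v + s *\<^sub>R u) - g (x + s *\<^sub>R u)" for s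
  have "\<exists>z>0. z < h \<and> \<phi> h - \<phi> 0 = (h - 0) * (G (x + h *\<^sub>R v + z *\<^sub>R u) u - G (x + z *\<^sub>R u) u)"
  proof (rule MVT2[OF h(1)])
    fix s assume s: "0 \<le> s" "s \<le> h"
    show "(\<phi> has_real_derivative G (x + h *\<^sub>R v + s *\<^sub>R u) u - G (x + s *\<^sub>R u) u) (at s)"
      unfolding \<phi>_def
      using inU[OF s, of h] inU[OF s, of 0] h(1)
      by (intro DERIV_diff line dg) (auto simp: algebra_simps)
  qed
  then obtain z where z: "0 < z" "z < h"
    "\<phi> h - \<phi> 0 = h * (G (x + h *\<^sub>R v + z *\<^sub>R u) u - G (x + z *\<^sub>R u) u)" by auto
  define \<psi> where "\<psi> t = G (x + z *\<^sub>R u + t *\<^sub>R v) u" for t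
  have "\<exists>y>0. y < h \<and> \<psi> h - \<psi> 0 =
      (h - 0) * frechet_derivative (\<lambda>y. G y u) (at (x + z *\<^sub>R u + y *\<^sub>R v)) v"
  proof (rule MVT2[OF h(1)])
    fix t assume t: "0 \<le> t" "t \<le> h"
    show "(\<psi> has_real_derivative frechet_derivative (\<lambda>y. G y u) (at (x + z *\<^sub>R u + t *\<^sub>R v)) v) (at t)"
      unfolding \<psi>_def using inU[of z t] t z by (intro line dG) auto
  qed
  then obtain y where y: "0 < y" "y < h"
    "\<psi> h - \<psi> 0 = h * frechet_derivative (\<lambda>y. G y u) (at (x + z *\<^sub>R u + y *\<^sub>R v)) v" by auto
  have "\<phi> h - \<phi> 0 = h * (\<psi> h - \<psi> 0)"
    using z(3) by (simp add: \<psi>_def algebra_simps)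
  then have "\<phi> h - \<phi> 0 = h\<^sup>2 * frechet_derivative (\<lambda>y. G y u) (at (x + z *\<^sub>R u + y *\<^sub>R v)) v"
    using y(3) by (simp add: power2_eq_square)
  then show ?thesis
    using that[OF near[of z y]] y z unfolding \<phi>_def G_def by (simp add: algebra_simps)
qed

text \<open>The second difference is unchanged when \<open>u\<close> and \<open>v\<close> are
  exchanged, so the two mixed derivatives agree at points \<open>p\<close> and \<open>q\<close> that
  tend to \<open>x\<close> with \<open>h\<close>; continuity finishes the proof.\<close>

lemma symmetric_second_derivative_real:
  fixes g :: "'a::euclidean_space \<Rightarrow> real"
  assumes "open U" "x \<in> U" and g: "Ck_on 2 g U"
  shows "frechet_derivative (\<lambda>y. frechet_derivative g (at y) u) (at x) v =
         frechet_derivative (\<lambda>y. frechet_derivative g (at y) v) (at x) u" (is "?H u v x = ?H v u x")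
proof -
  obtain e where e: "e > 0" "ball x e \<subseteq> U" using assms openE by blast
  have cont: "isCont (?H a b) x" for a b
  proof -
    have "Ck_on (Suc (Suc 0)) g U" using g by (simp add: numeral_2_eq_2)
    then have "Ck_on 0 (?H a b) U"
      by (intro Ck_on_frechet assms(1))
    then show ?thesis using assms by (simp add: continuous_on_eq_continuous_at)
  qed
  \<comment> \<open>The summand 1 keeps \<open>c\<close> positive even if \<open>u\<close> and
    \<open>v\<close> both vanish.\<close>
  define c where "c = norm u + norm v + 1"
  have c: "c > 0" by (simp add: c_def add_nonneg_pos)
  have "\<bar>?H u v x - ?H v u x\<bar> < \<epsilon>" if \<epsilon>: "\<epsilon> > 0" for \<epsilon>
  proof -
    obtain d1 where d1: "d1 > 0" "\<And>p. dist x p < d1 \<Longrightarrow> \<bar>?H u v p - ?H u v x\<bar> < \<epsilon> / 2"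
      using cont[of u v] \<epsilon> unfolding continuous_at_eps_delta dist_real_def
      by (metis dist_commute half_gt_zero)
    obtain d2 where d2: "d2 > 0" "\<And>p. dist x p < d2 \<Longrightarrow> \<bar>?H v u p - ?H v u x\<bar> < \<epsilon> / 2"
      using cont[of v u] \<epsilon> unfolding continuous_at_eps_delta dist_real_def
      by (metis dist_commute half_gt_zero)
    define h where "h = Min {e, d1, d2} / (2 * c)"
    have h: "h > 0" using e(1) d1(1) d2(1) c by (simp add: h_def)
    have "h * (norm u + norm v) < h * c * 2" using h
      by (simp add: c_def algebra_simps) (meson add_nonneg_pos mult_nonneg_nonneg norm_ge_zero less_imp_le mult_pos_pos zero_less_numeral)
    also have "\<dots> = Min {e, d1, d2}" using c by (simp add: h_def)
    finally have hs: "h * (norm u + norm v) < e" "h * (norm u + norm v) < d1" "h * (norm u + norm v) < d2"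
      by auto
    obtain p where p: "dist x p \<le> h * (norm u + norm v)"
      "g (x + h *\<^sub>R u + h *\<^sub>R v) - g (x + h *\<^sub>R u) - g (x + h *\<^sub>R v) + g x = h\<^sup>2 * ?H u v p"
      using second_difference_mvt[OF e(2) assms(1) g h hs(1)] by blast
    have hs': "h * (norm v + norm u) < e" using hs(1) by (simp add: add.commute)
    obtain q where q: "dist x q \<le> h * (norm v + norm u)"
      "g (x + h *\<^sub>R v + h *\<^sub>R u) - g (x + h *\<^sub>R v) - g (x + h *\<^sub>R u) + g x = h\<^sup>2 * ?H v u q"
      using second_difference_mvt[OF e(2) assms(1) g h hs'] by blast
    have "h\<^sup>2 * ?H u v p = h\<^sup>2 * ?H v u q" using p(2) q(2) by (simp add: algebra_simps)
    then have "?H u v p = ?H v u q" using h by simp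
    moreover have "\<bar>?H u v p - ?H u v x\<bar> < \<epsilon> / 2" using p(1) hs by (intro d1) auto
    moreover have "\<bar>?H v u q - ?H v u x\<bar> < \<epsilon> / 2" using q(1) hs by (intro d2) (auto simp: add.commute)
    ultimately show ?thesis by linarith
  qed
  from this[of "\<bar>?H u v x - ?H v u x\<bar>"] show ?thesis by fastforce
qed

lemma symmetric_second_derivative:
  fixes g :: "'a::euclidean_space \<Rightarrow> 'b::euclidean_space"
  assumes "open U" "x \<in> U" and g: "Ck_on 2 g U"
  shows "frechet_derivative (\<lambda>y. frechet_derivative g (at y) u) (at x) v =
         frechet_derivative (\<lambda>y. frechet_derivative g (at y) v) (at x) u" (is "?H u v = ?H v u")
proof (rule euclidean_eqI)
  fix b :: 'b
  have g2: "Ck_on (Suc (Suc 0)) g U" using g by (simp add: numeral_2_eq_2)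
  have first: "frechet_derivative (\<lambda>z. g z \<bullet> b) (at y) a = frechet_derivative g (at y) a \<bullet> b" if "y \<in> U" for y a
    using frechet_derivative_at[OF bounded_linear.has_derivative[OF bounded_linear_inner_left
        Ck_on_Suc_frechet[OF g2 that]], of b] by metis
  have "?H a c \<bullet> b = frechet_derivative (\<lambda>y. frechet_derivative (\<lambda>z. g z \<bullet> b) (at y) a) (at x) c" for a c
  proof -
    have "((\<lambda>y. frechet_derivative g (at y) a \<bullet> b) has_derivative (\<lambda>c. ?H a c \<bullet> b)) (at x)"
      by (rule bounded_linear.has_derivative[OF bounded_linear_inner_left
        Ck_on_Suc_frechet[OF Ck_on_frechet[OF assms(1) g2] assms(2)]])
    then have "((\<lambda>y. frechet_derivative (\<lambda>z. g z \<bullet> b) (at y) a) has_derivative (\<lambda>c. ?H a c \<bullet> b)) (at x)"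
      by (rule has_derivative_transform_within_open[OF _ assms(1,2)]) (simp add: first)
    from frechet_derivative_at[OF this] show ?thesis by metis
  qed
  moreover have "Ck_on 2 (\<lambda>z. g z \<bullet> b) U"
    by (rule Ck_on_compose_linear[OF bounded_linear_inner_left g])
  ultimately show "?H u v \<bullet> b = ?H v u \<bullet> b"
    using symmetric_second_derivative_real[OF assms(1,2)] by metis
qed

text \<open>Makes derivatives within \<open>S\<close> unique; it holds for open subsets of the space and of a
  half-space.\<close>

definition thick :: "'a::euclidean_space set \<Rightarrow> bool" where
  "thick S \<longleftrightarrow> (\<forall>x\<in>S. \<forall>b\<in>Basis. \<forall>e>0. \<exists>d. 0 < \<bar>d\<bar> \<and> \<bar>d\<bar> < e \<and> x + d *\<^sub>R b \<in> S)"

lemma thick_frechet_derivative: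
  assumes "thick S" "x \<in> S" "(f has_derivative f') (at x within S)"
  shows "frechet_derivative f (at x within S) = f'"
proof -
  have "(f has_derivative frechet_derivative f (at x within S)) (at x within S)"
    using assms(3) differentiableI frechet_derivative_works by blast
  then show ?thesis
    using assms by (intro frechet_derivative_unique_within[of f _ x S]) (auto simp: thick_def)
qed

lemma thick_unique:
  assumes "thick S" "x \<in> S" "(f has_derivative f') (at x within S)" "(f has_derivative f'') (at x within S)"
  shows "f' = f''"
  using thick_frechet_derivative[OF assms(1-3)] thick_frechet_derivative[OF assms(1,2,4)] by simp

lemma has_derivative_local_extension:
  assumes "open U" "x \<in> S \<inter> U" "\<And>y. y \<in> S \<inter> U \<Longrightarrow> g y = f y" "(g has_derivative g') (at x)"
  shows "(f has_derivative g') (at x within S)"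
proof -
  obtain d where d: "d > 0" "ball x d \<subseteq> U" using assms openE by blast
  show ?thesis
    by (rule has_derivative_transform_within[OF has_derivative_at_withinI[OF assms(4)] d(1)])
      (use assms d in \<open>auto simp: subset_eq dist_commute\<close>)
qed

lemma smooth_on_has_derivative:
  "smooth_on S f \<Longrightarrow> x \<in> S \<Longrightarrow> (f has_derivative frechet_derivative f (at x within S)) (at x within S)"
  using smooth_on_differentiable frechet_derivative_works by blast

lemma smooth_on_slice:
  fixes F :: "real \<Rightarrow> 'a::euclidean_space \<Rightarrow> 'b::real_normed_vector"
  assumes "smooth_on (I \<times> S) (\<lambda>(t, x). F t x)" "t \<in> I"
  shows "smooth_on S (F t)"
proof -
  have "smooth_on S (\<lambda>x. (t, x))"
    by (intro smooth_on_Pair smooth_on_const smooth_on_linear[OF bounded_linear_ident])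
  from smooth_on_compose[OF this assms(1)] show ?thesis using assms(2) by auto
qed

lemma smooth_on_snd:
  fixes F :: "'a::euclidean_space \<Rightarrow> 'b::real_normed_vector"
  assumes "smooth_on S F"
  shows "smooth_on (I \<times> S) (\<lambda>(t::real, x). F x)"
proof -
  have "smooth_on (I \<times> S) (snd :: real \<times> 'a \<Rightarrow> 'a)"
    by (rule smooth_on_linear[OF bounded_linear_snd])
  from smooth_on_compose[OF this assms] show ?thesis by (auto simp: case_prod_unfold)
qed

text \<open>Near each point the derivative within \<open>S\<close> is that of a smooth extension
  \<open>g\<close> in the direction \<open>(0, v)\<close>, because thickness makes it unique. The
  derivative of \<open>g\<close> is smooth jointly in \<open>t\<close> and \<open>x\<close>.\<close>

lemma smooth_on_partial_derivative:
  fixes F :: "real \<Rightarrow> 'a::euclidean_space \<Rightarrow> 'b::real_normed_vector"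
  assumes "smooth_on (I \<times> S) (\<lambda>(t, x). F t x)" "thick S"
  shows "smooth_on (I \<times> S) (\<lambda>(t, x). frechet_derivative (F t) (at x within S) v)"
proof (rule smooth_onI)
  fix p :: "real \<times> 'a" assume p: "p \<in> I \<times> S"
  obtain U g where U: "open U" "p \<in> U" "\<And>k. Ck_on k g U"
    "\<And>y. y \<in> (I \<times> S) \<inter> U \<Longrightarrow> g y = (case y of (t, x) \<Rightarrow> F t x)"
    using smooth_onE[OF assms(1) p] by blast
  have "frechet_derivative (F t) (at x within S) v = frechet_derivative g (at (t, x)) (0, v)"
    if tx: "(t, x) \<in> (I \<times> S) \<inter> U" for t x
  proof -
    have "(g has_derivative frechet_derivative g (at (t, x))) (at (t, x))"
      using Ck_on_Suc_frechet[OF U(3)] tx by blast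
    then have "((\<lambda>y. g (t, y)) has_derivative (\<lambda>v. frechet_derivative g (at (t, x)) (0, v))) (at x)"
      by (intro has_derivative_compose[of "\<lambda>y. (t, y)", where g = g]) (auto intro!: derivative_eq_intros)
    moreover have "open (Pair t -` U)"
      by (intro open_vimage U(1)) (auto intro: continuous_intros)
    ultimately have "(F t has_derivative (\<lambda>v. frechet_derivative g (at (t, x)) (0, v))) (at x within S)"
      using tx U(4)
      by - (rule has_derivative_local_extension[where U = "Pair t -` U" and g = "\<lambda>y. g (t, y)"], auto)
    from thick_frechet_derivative[OF assms(2) _ this] tx show ?thesis by auto
  qed
  with U Ck_on_frechet[OF U(1,3)]
  show "\<exists>U h. open U \<and> p \<in> U \<and> (\<forall>k. Ck_on k h U) \<and>
      (\<forall>y\<in>(I \<times> S) \<inter> U. h y = (case y of (t, x) \<Rightarrow> frechet_derivative (F t) (at x within S) v))"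
    by (intro exI[of _ U] exI[of _ "\<lambda>y. frechet_derivative g (at y) (0, v)"]) auto
qed

lemma smooth_on_frechet_derivative:
  fixes f :: "'a::euclidean_space \<Rightarrow> 'b::real_normed_vector"
  assumes "smooth_on S f" "thick S"
  shows "smooth_on S (\<lambda>x. frechet_derivative f (at x within S) v)"
  using smooth_on_slice[OF smooth_on_partial_derivative[OF smooth_on_snd[OF assms(1), of UNIV] assms(2)]]
  by simp

text \<open>Thickness identifies the derivatives within \<open>S\<close>, of first and second order,
  with those of a smooth extension near \<open>x\<close>.\<close>

lemma symmetric_second_derivative_within:
  fixes f :: "'a::euclidean_space \<Rightarrow> 'b::euclidean_space"
  assumes "smooth_on S f" "thick S" "x \<in> S"
  shows "frechet_derivative (\<lambda>y. frechet_derivative f (at y within S) u) (at x within S) v =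
         frechet_derivative (\<lambda>y. frechet_derivative f (at y within S) v) (at x within S) u"
proof -
  obtain U g where U: "open U" "x \<in> U" "\<And>k. Ck_on k g U" "\<And>y. y \<in> S \<inter> U \<Longrightarrow> g y = f y"
    using smooth_onE[OF assms(1,3)] by blast
  have first: "frechet_derivative f (at y within S) = frechet_derivative g (at y)" if "y \<in> S \<inter> U" for y
    using that
    by (intro thick_frechet_derivative[OF assms(2) _ has_derivative_local_extension[OF U(1) that U(4)
        Ck_on_Suc_frechet[OF U(3)]]]) auto
  have "frechet_derivative (\<lambda>y. frechet_derivative f (at y within S) a) (at x within S) =
      frechet_derivative (\<lambda>y. frechet_derivative g (at y) a) (at x)" for a
    using assms(3) U(2) first
    by (intro thick_frechet_derivative[OF assms(2,3) has_derivative_local_extension[OF U(1) _ _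
        Ck_on_Suc_frechet[OF Ck_on_frechet[OF U(1,3)] U(2)]]]) auto
  then show ?thesis using symmetric_second_derivative[OF U(1,2,3)] by simp
qed

section \<open>Two compactness arguments\<close>

lemma compact_pos_lower_bound:
  fixes f :: "'x::topological_space \<Rightarrow> real"
  assumes "compact X" "continuous_on X f" "\<And>x. x \<in> X \<Longrightarrow> f x > 0"
  obtains d where "d > 0" "\<And>x. x \<in> X \<Longrightarrow> d \<le> f x"
proof (cases "X = {}")
  case True
  then show ?thesis using that[of 1] by auto
next
  case False
  then obtain x where "x \<in> X" "\<And>y. y \<in> X \<Longrightarrow> f x \<le> f y"
    using continuous_attains_inf[OF assms(1) False assms(2)] by auto
  then show ?thesis using that[of "f x"] assms(3) by auto
qed

lemma compact_abs_bound:
  fixes f :: "'x::topological_space \<Rightarrow> real"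
  assumes "compact X" "continuous_on X f"
  obtains b where "b > 0" "\<And>x. x \<in> X \<Longrightarrow> \<bar>f x\<bar> \<le> b"
proof -
  have "bounded (f ` X)" using assms by (intro compact_imp_bounded compact_continuous_image)
  then show ?thesis using that unfolding bounded_pos by auto
qed

lemma compact_sublevel:
  fixes f :: "'x::t2_space \<Rightarrow> real"
  assumes "compact X" "continuous_on X f"
  shows "compact {x \<in> X. f x \<le> a}"
proof -
  have "closedin (top_of_set X) {x \<in> X. f x \<in> {..a}}"
    using assms(2) by (intro continuous_closedin_preimage[OF assms(2), unfolded vimage_def Int_def mem_Collect_eq] closed_atMost)
  then have "closedin (top_of_set X) {x \<in> X. f x \<le> a}" by simp
  then show ?thesis using assms(1) closedin_compact by blast
qed

lemma linear_exp_decay: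
  fixes \<delta> \<eta> :: real
  assumes "\<delta> > 0" "\<eta> > 0"
  obtains N0 where "\<And>N. N \<ge> N0 \<Longrightarrow> N \<ge> 1 \<and> (N + 1) * exp (- (N * \<delta>)) < \<eta>"
proof
  \<comment> \<open>From exp y at least y^2 / 2 and this bound, \<eta> exp(N \<delta>) is at least 5
    N / 2, which exceeds N + 1 as soon as N is at least 1.\<close>
  fix N :: real assume N: "N \<ge> max 1 (5 / (\<delta>\<^sup>2 * \<eta>))"
  then have N1: "N \<ge> 1" and N2: "5 \<le> N * (\<delta>\<^sup>2 * \<eta>)"
    using assms by (auto simp: divide_simps)
  have "N * \<delta> \<ge> 0" using N1 assms by simp
  from exp_lower_Taylor_quadratic[OF this] have ex: "exp (N * \<delta>) \<ge> (N * \<delta>)\<^sup>2 / 2"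
    using \<open>N * \<delta> \<ge> 0\<close> by linarith
  have "5 * N \<le> N * (N * (\<delta>\<^sup>2 * \<eta>))" using N1 N2 by (simp add: mult_left_mono mult.commute)
  moreover have "\<eta> * ((N * \<delta>)\<^sup>2 / 2) = N * (N * (\<delta>\<^sup>2 * \<eta>)) / 2"
    by (simp add: power2_eq_square)
  ultimately have "N + 1 < \<eta> * ((N * \<delta>)\<^sup>2 / 2)" using N1 by linarith
  also have "\<dots> \<le> \<eta> * exp (N * \<delta>)" using ex assms by (intro mult_left_mono) auto
  finally show "N \<ge> 1 \<and> (N + 1) * exp (- (N * \<delta>)) < \<eta>"
    using N1 by (simp add: exp_minus divide_simps)
qed

text \<open>In a neighbourhood of the zero set of \<open>r\<close> both \<open>A\<close> and
  \<open>D\<close> are bounded below, so large \<open>N\<close> makes both brackets nonnegative. Off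
  this neighbourhood \<open>- r\<close> has a positive lower bound by compactness, and both
  corrections are too small to cancel \<open>L\<close>, since \<open>N\<close> times an
  exponentially small factor tends to 0 uniformly in \<open>s\<close>.\<close>

lemma exp_collar_positive:
  fixes L A B D E r :: "'x::t2_space \<Rightarrow> real"
  assumes X: "compact X"
    and cont: "continuous_on X L" "continuous_on X A" "continuous_on X B"
      "continuous_on X D" "continuous_on X E" "continuous_on X r"
    and L: "\<And>x. x \<in> X \<Longrightarrow> L x > 0" and r: "\<And>x. x \<in> X \<Longrightarrow> r x \<le> 0"
    and AD: "\<And>x. x \<in> X \<Longrightarrow> r x = 0 \<Longrightarrow> A x > 0 \<and> D x > 0"
    and K: "K > 0"
  obtains N0 where "\<And>N x s c. N \<ge> N0 \<Longrightarrow> x \<in> X \<Longrightarrow> 0 \<le> s \<Longrightarrow> s \<le> K \<Longrightarrow> c = s * exp (N * r x) \<Longrightarrow>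
    L x + c * (N * A x + B x) + c\<^sup>2 * (N * D x + E x) > 0"
proof -
  obtain l where l: "l > 0" "\<And>x. x \<in> X \<Longrightarrow> l \<le> L x"
    using compact_pos_lower_bound[OF X cont(1) L] by blast
  \<comment> \<open>The summand 1 forces \<open>b \<ge> 1\<close>, which is needed below to deduce
    \<open>c \<le> y\<close>.\<close>
  have "continuous_on X (\<lambda>x. \<bar>A x\<bar> + \<bar>B x\<bar> + \<bar>D x\<bar> + \<bar>E x\<bar> + 1)"
    by (intro continuous_intros cont)
  then obtain b where b: "b > 0" "\<And>x. x \<in> X \<Longrightarrow> \<bar>\<bar>A x\<bar> + \<bar>B x\<bar> + \<bar>D x\<bar> + \<bar>E x\<bar> + 1\<bar> \<le> b"
    using compact_abs_bound[OF X] by blast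
  \<comment> \<open>A single function measures \<open>A\<close> and \<open>D\<close> at once: its
    sublevel set at \<open>a / 2\<close> separates the collar, where
    \<open>N \<ge> 2 * b / a\<close> lets the leading terms beat \<open>B\<close> and
    \<open>E\<close>, from the rest.\<close>
  define f where "f x = min (A x) (D x)" for x
  have contf: "continuous_on X f" unfolding f_def by (intro continuous_intros cont)
  have contr: "continuous_on X (\<lambda>x. - r x)" by (intro continuous_intros cont)
  have "compact {x \<in> X. - r x \<le> 0}" by (rule compact_sublevel[OF X contr])
  then obtain a where a: "a > 0" "\<And>x. x \<in> {x \<in> X. - r x \<le> 0} \<Longrightarrow> a \<le> f x"
  proof (rule compact_pos_lower_bound[where f=f])
    fix x assume "x \<in> {x \<in> X. - r x \<le> 0}"
    then have "x \<in> X" "r x = 0" using r[of x] by auto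
    then show "f x > 0" using AD[of x] by (simp add: f_def)
  qed (auto intro: continuous_on_subset[OF contf])
  have "compact {x \<in> X. f x \<le> a / 2}" by (rule compact_sublevel[OF X contf])
  then obtain \<delta> where \<delta>: "\<delta> > 0" "\<And>x. x \<in> {x \<in> X. f x \<le> a / 2} \<Longrightarrow> \<delta> \<le> - r x"
  proof (rule compact_pos_lower_bound[where f="\<lambda>x. - r x"])
    fix x assume x: "x \<in> {x \<in> X. f x \<le> a / 2}"
    show "- r x > 0"
    proof (rule ccontr)
      assume "\<not> - r x > 0"
      then have "a \<le> f x" using x a(2) by auto
      then show False using x a(1) by auto
    qed
  qed (auto intro: continuous_on_subset[OF contr])
  \<comment> \<open>Chosen so that the bound \<open>y\<close> on the corrections stays below
    \<open>min 1 (l / 2)\<close>. The value 1 gives \<open>c \<le> 1\<close>, hence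
    \<open>c\<^sup>2 \<le> c\<close>; the value \<open>l / 2\<close> leaves room for two corrections
    of size \<open>y\<close>.\<close>
  define \<eta> where "\<eta> = min 1 (l / 2) / (K * b)"
  have "\<eta> > 0" using l K b by (simp add: \<eta>_def)
  then obtain N1 where N1: "\<And>N. N \<ge> N1 \<Longrightarrow> N \<ge> 1 \<and> (N + 1) * exp (- (N * \<delta>)) < \<eta>"
    using linear_exp_decay[OF \<delta>(1)] by blast
  show ?thesis
  proof (rule that[of "max N1 (2 * b / a)"])
    fix N x s c
    assume N: "max N1 (2 * b / a) \<le> N" and x: "x \<in> X" and s: "0 \<le> s" "s \<le> K"
      and c: "c = s * exp (N * r x)"
    have Nge: "N \<ge> 1" and Nexp: "(N + 1) * exp (- (N * \<delta>)) < \<eta>" using N1 N by auto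
    have c0: "c \<ge> 0" using s c by simp
    have bx: "\<bar>A x\<bar> \<le> b" "\<bar>B x\<bar> \<le> b" "\<bar>D x\<bar> \<le> b" "\<bar>E x\<bar> \<le> b" "b \<ge> 1"
      using b(2)[OF x] by linarith+
    show "L x + c * (N * A x + B x) + c\<^sup>2 * (N * D x + E x) > 0"
    proof (cases "f x \<le> a / 2")
      case False
      then have "A x \<ge> a / 2" "D x \<ge> a / 2" by (auto simp: f_def)
      moreover have "N * (a / 2) \<ge> b" using N a(1) by (simp add: divide_simps)
      ultimately have "N * A x \<ge> b" "N * D x \<ge> b"
        using Nge by (meson mult_left_mono order_trans zero_le_one)+
      then have "N * A x + B x \<ge> 0" "N * D x + E x \<ge> 0" using bx by linarith+
      then show ?thesis using L[OF x] c0 by (simp add: add_pos_nonneg)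
    next
      case True
      then have "N * \<delta> \<le> N * (- r x)" using \<delta>(2)[of x] x Nge by (intro mult_left_mono) auto
      then have rx: "N * r x \<le> - (N * \<delta>)" by simp
      define y where "y = c * ((N + 1) * b)"
      have "c \<le> K * exp (- (N * \<delta>))"
        unfolding c using s rx by (intro mult_mono) auto
      then have "y \<le> (K * exp (- (N * \<delta>))) * ((N + 1) * b)"
        unfolding y_def using Nge b(1) by (intro mult_right_mono) auto
      also have "\<dots> = (K * b) * ((N + 1) * exp (- (N * \<delta>)))" by simp
      also have "\<dots> < (K * b) * \<eta>" using Nexp K b(1) by (intro mult_strict_left_mono) auto
      also have "\<dots> = min 1 (l / 2)" using K b(1) by (simp add: \<eta>_def)
      finally have y: "y < 1" "y < l / 2" by auto
      have y0: "y \<ge> 0" using c0 Nge b(1) by (simp add: y_def)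
      have lin: "\<bar>N * p + q\<bar> \<le> (N + 1) * b" if "\<bar>p\<bar> \<le> b" "\<bar>q\<bar> \<le> b" for p q
      proof -
        have "\<bar>N * p\<bar> \<le> N * b" using that Nge by (simp add: abs_mult mult_left_mono)
        then show ?thesis using that unfolding distrib_right by linarith
      qed
      have "\<bar>c * (N * A x + B x)\<bar> \<le> y"
        unfolding y_def abs_mult using c0 lin[OF bx(1,2)] by (simp add: mult_left_mono)
      moreover have "\<bar>c\<^sup>2 * (N * D x + E x)\<bar> \<le> y"
      proof -
        have "1 * 1 \<le> (N + 1) * b" using Nge bx(5) by (intro mult_mono) auto
        then have "c * 1 \<le> y" unfolding y_def using c0 by (intro mult_left_mono) auto
        then have "c \<le> 1" using y by simp
        then have "c\<^sup>2 \<le> c" using c0 by (simp add: power2_eq_square mult_left_le)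
        then have "\<bar>c\<^sup>2 * (N * D x + E x)\<bar> \<le> c * ((N + 1) * b)"
          unfolding abs_mult using lin[OF bx(3,4)] c0 by (intro mult_mono) auto
        then show ?thesis by (simp add: y_def)
      qed
      moreover have "L x \<ge> l" using l x by auto
      ultimately show ?thesis using y by linarith
    qed
  qed
qed

text \<open>Where \<open>G\<close> and \<open>E\<close> are positive, every nonnegative
  \<open>s\<close> works. Elsewhere \<open>\<tau>\<close> cannot vanish, so by compactness it is
  bounded below, and large \<open>K\<close> makes \<open>s\<close> so large that the quadratic term
  dominates.\<close>

lemma quadratic_positive_large:
  fixes G E D \<tau> :: "'x::t2_space \<Rightarrow> real"
  assumes X: "compact X"
    and cont: "continuous_on X G" "continuous_on X E" "continuous_on X D" "continuous_on X \<tau>"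
    and D: "\<And>x. x \<in> X \<Longrightarrow> D x > 0" and \<tau>: "\<And>x. x \<in> X \<Longrightarrow> \<tau> x \<ge> 0"
    and GE: "\<And>x. x \<in> X \<Longrightarrow> \<tau> x = 0 \<Longrightarrow> G x > 0 \<and> E x > 0"
  obtains K0 where "\<And>K x s. K \<ge> K0 \<Longrightarrow> x \<in> X \<Longrightarrow> s = K * \<tau> x \<Longrightarrow> G x + s * E x + s\<^sup>2 * D x > 0"
proof -
  obtain d where d: "d > 0" "\<And>x. x \<in> X \<Longrightarrow> d \<le> D x"
    using compact_pos_lower_bound[OF X cont(3) D] by blast
  have "continuous_on X (\<lambda>x. \<bar>G x\<bar> + \<bar>E x\<bar>)" by (intro continuous_intros cont)
  then obtain b where b: "b > 0" "\<And>x. x \<in> X \<Longrightarrow> \<bar>\<bar>G x\<bar> + \<bar>E x\<bar>\<bar> \<le> b"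
    using compact_abs_bound[OF X] by blast
  define f where "f x = min (G x) (E x)" for x
  have contf: "continuous_on X f" unfolding f_def by (intro continuous_intros cont)
  have "compact {x \<in> X. f x \<le> 0}" by (rule compact_sublevel[OF X contf])
  then obtain \<epsilon> where \<epsilon>: "\<epsilon> > 0" "\<And>x. x \<in> {x \<in> X. f x \<le> 0} \<Longrightarrow> \<epsilon> \<le> \<tau> x"
  proof (rule compact_pos_lower_bound[where f=\<tau>])
    fix x assume x: "x \<in> {x \<in> X. f x \<le> 0}"
    then have "\<tau> x \<noteq> 0" using GE[of x] by (auto simp: f_def)
    then show "\<tau> x > 0" using \<tau>[of x] x by auto
  qed (auto intro: continuous_on_subset[OF cont(4)])
  \<comment> \<open>For \<open>s \<ge> c\<close> the second entry gives
    \<open>s * d \<ge> 2 * b + 1\<close>, so \<open>E + s * D\<close> is at least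
    \<open>b + 1\<close>; the entry 1 lets this survive multiplication by \<open>s\<close>, and
    \<open>G \<ge> - b\<close> cannot cancel it.\<close>
  define c where "c = max 1 ((2 * b + 1) / d)"
  show ?thesis
  proof (rule that[of "c / \<epsilon>"])
    fix K x s assume K: "K \<ge> c / \<epsilon>" and x: "x \<in> X" and s: "s = K * \<tau> x"
    have c1: "c \<ge> 1" by (simp add: c_def)
    have "c / \<epsilon> > 0" using c1 \<epsilon>(1) by simp
    then have K0: "K > 0" using K by linarith
    have bx: "\<bar>G x\<bar> \<le> b" "\<bar>E x\<bar> \<le> b" using b(2)[OF x] by linarith+
    show "G x + s * E x + s\<^sup>2 * D x > 0"
    proof (cases "f x \<le> 0")
      case False
      then have "G x > 0" "E x > 0" by (auto simp: f_def)
      moreover have "s \<ge> 0" using s K0 \<tau>[OF x] by simp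
      ultimately show ?thesis using D[OF x]
        by (intro add_pos_nonneg) auto
    next
      case True
      then have "\<epsilon> \<le> \<tau> x" using \<epsilon>(2) x by auto
      then have "(c / \<epsilon>) * \<epsilon> \<le> s" unfolding s using K c1 \<epsilon>(1) K0 by (intro mult_mono) auto
      then have sc: "s \<ge> c" using \<epsilon>(1) by simp
      then have s1: "s \<ge> 1" using c1 by simp
      have "(2 * b + 1) / d \<le> s" using sc by (simp add: c_def)
      then have "2 * b + 1 \<le> s * d" using d(1) by (simp add: divide_simps)
      also have "\<dots> \<le> s * D x" using d(2)[OF x] s1 by (intro mult_left_mono) auto
      finally have "b + 1 \<le> E x + s * D x" using bx by linarith
      then have "1 * (b + 1) \<le> s * (E x + s * D x)" using s1 b(1) by (intro mult_mono) auto
      moreover define y where "y = s * (E x + s * D x)"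
      ultimately have "b + 1 \<le> y" by simp
      moreover have "- b \<le> G x" using bx(1) by linarith
      ultimately have "G x + y > 0" by linarith
      then have "G x + s * (E x + s * D x) > 0" by (simp add: y_def)
      then show ?thesis by (simp add: power2_eq_square algebra_simps)
    qed
  qed
qed

section \<open>Linear algebra of forms\<close>

definition wedge11 :: "('v \<Rightarrow> real) \<Rightarrow> ('v \<Rightarrow> real) \<Rightarrow> 'v \<Rightarrow> 'v \<Rightarrow> real" where
  "wedge11 \<alpha> \<beta> u v = \<alpha> u * \<beta> v - \<alpha> v * \<beta> u"

definition vol4 :: "(real ^ 4 \<Rightarrow> real ^ 4 \<Rightarrow> real) \<Rightarrow> (real ^ 4 \<Rightarrow> real ^ 4 \<Rightarrow> real) \<Rightarrow> real" where
  "vol4 \<omega> \<eta> = wedge22 \<omega> \<eta> (axis 1 1) (axis 2 1) (axis 3 1) (axis 4 1)"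

definition skew :: "('v::real_vector \<Rightarrow> 'v \<Rightarrow> real) \<Rightarrow> bool" where
  "skew \<omega> \<longleftrightarrow> (\<forall>u. linear (\<omega> u)) \<and> (\<forall>u v. \<omega> u v = - \<omega> v u)"

lemma skewD: "skew \<omega> \<Longrightarrow> \<omega> u v = - \<omega> v u" "skew \<omega> \<Longrightarrow> linear (\<omega> u)" "skew \<omega> \<Longrightarrow> linear (\<lambda>u. \<omega> u v)"
proof -
  assume "skew \<omega>"
  then have *: "\<omega> u v = - \<omega> v u" "linear (\<omega> u)" for u v unfolding skew_def by blast+
  show "\<omega> u v = - \<omega> v u" by (rule *)
  show "linear (\<omega> u)" by (rule *)
  have "linear (\<lambda>u. - \<omega> v u)" by (rule linear_compose_neg[OF *(2)])
  moreover have "(\<lambda>u. \<omega> u v) = (\<lambda>u. - \<omega> v u)" by (rule ext) (rule *)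
  ultimately show "linear (\<lambda>u. \<omega> u v)" by simp
qed

lemma skew_wedge11: "linear \<alpha> \<Longrightarrow> linear \<beta> \<Longrightarrow> skew (wedge11 \<alpha> \<beta>)"
  unfolding skew_def wedge11_def
  by (auto intro!: linearI simp: linear_add linear_scale algebra_simps)

lemma vec4_expand: "(x :: real ^ 4) = x $ 1 *\<^sub>R axis 1 1 + x $ 2 *\<^sub>R axis 2 1 + x $ 3 *\<^sub>R axis 3 1 + x $ 4 *\<^sub>R axis 4 1"
  by (auto simp: vec_eq_iff axis_def forall_4)

lemma linear_expand4:
  assumes "linear (f :: real ^ 4 \<Rightarrow> real)"
  shows "f x = x $ 1 * f (axis 1 1) + x $ 2 * f (axis 2 1) + x $ 3 * f (axis 3 1) + x $ 4 * f (axis 4 1)"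
  using arg_cong[OF vec4_expand[of x], of f] by (simp only: linear_add[OF assms] linear_scale[OF assms] real_scaleR_def)

text \<open>Reduces statements about two-forms to polynomial identities in six coefficients.\<close>

lemma skew_expand4:
  assumes "skew (\<omega> :: real ^ 4 \<Rightarrow> real ^ 4 \<Rightarrow> real)"
  shows "\<omega> u v =
      (u $ 1 * v $ 2 - u $ 2 * v $ 1) * \<omega> (axis 1 1) (axis 2 1) +
      (u $ 1 * v $ 3 - u $ 3 * v $ 1) * \<omega> (axis 1 1) (axis 3 1) +
      (u $ 1 * v $ 4 - u $ 4 * v $ 1) * \<omega> (axis 1 1) (axis 4 1) +
      (u $ 2 * v $ 3 - u $ 3 * v $ 2) * \<omega> (axis 2 1) (axis 3 1) +
      (u $ 2 * v $ 4 - u $ 4 * v $ 2) * \<omega> (axis 2 1) (axis 4 1) +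
      (u $ 3 * v $ 4 - u $ 4 * v $ 3) * \<omega> (axis 3 1) (axis 4 1)"
proof -
  have diag: "\<omega> a a = 0" for a using skewD(1)[OF assms, of a a] by simp
  have flip: "\<omega> (axis 2 1) (axis 1 1) = - \<omega> (axis 1 1) (axis 2 1)"
    "\<omega> (axis 3 1) (axis 1 1) = - \<omega> (axis 1 1) (axis 3 1)"
    "\<omega> (axis 4 1) (axis 1 1) = - \<omega> (axis 1 1) (axis 4 1)"
    "\<omega> (axis 3 1) (axis 2 1) = - \<omega> (axis 2 1) (axis 3 1)"
    "\<omega> (axis 4 1) (axis 2 1) = - \<omega> (axis 2 1) (axis 4 1)"
    "\<omega> (axis 4 1) (axis 3 1) = - \<omega> (axis 3 1) (axis 4 1)"
    using skewD(1)[OF assms] by blast+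
  have "\<omega> u v = u $ 1 * \<omega> (axis 1 1) v + u $ 2 * \<omega> (axis 2 1) v + u $ 3 * \<omega> (axis 3 1) v + u $ 4 * \<omega> (axis 4 1) v"
    using linear_expand4[OF skewD(3)[OF assms]] .
  also have "\<dots> = u $ 1 * (v $ 2 * \<omega> (axis 1 1) (axis 2 1) + v $ 3 * \<omega> (axis 1 1) (axis 3 1) + v $ 4 * \<omega> (axis 1 1) (axis 4 1)) +
     u $ 2 * (- v $ 1 * \<omega> (axis 1 1) (axis 2 1) + v $ 3 * \<omega> (axis 2 1) (axis 3 1) + v $ 4 * \<omega> (axis 2 1) (axis 4 1)) +
     u $ 3 * (- v $ 1 * \<omega> (axis 1 1) (axis 3 1) - v $ 2 * \<omega> (axis 2 1) (axis 3 1) + v $ 4 * \<omega> (axis 3 1) (axis 4 1)) +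
     u $ 4 * (- v $ 1 * \<omega> (axis 1 1) (axis 4 1) - v $ 2 * \<omega> (axis 2 1) (axis 4 1) - v $ 3 * \<omega> (axis 3 1) (axis 4 1))"
    unfolding linear_expand4[OF skewD(2)[OF assms], of _ v] by (simp add: diag flip)
  finally show ?thesis by (simp only: algebra_simps)
qed

text \<open>Half of \<open>vol4 \<omega> \<omega>\<close> is the Pfaffian \<open>P\<close> of
  \<omega>. Each coordinate of \<open>u\<close> times \<open>P\<close> is a linear combination of
  the four equations that \<omega> u vanishes on the basis vectors.\<close>

lemma skew_nondegenerate:
  assumes "skew (\<omega> :: real ^ 4 \<Rightarrow> real ^ 4 \<Rightarrow> real)" "vol4 \<omega> \<omega> \<noteq> 0" "\<And>v. \<omega> u v = 0"
  shows "u = 0"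
proof -
  define p q r s t w where d: "p = \<omega> (axis 1 1) (axis 2 1)" "q = \<omega> (axis 1 1) (axis 3 1)"
    "r = \<omega> (axis 1 1) (axis 4 1)" "s = \<omega> (axis 2 1) (axis 3 1)"
    "t = \<omega> (axis 2 1) (axis 4 1)" "w = \<omega> (axis 3 1) (axis 4 1)"
  have eq: "- u $ 2 * p - u $ 3 * q - u $ 4 * r = 0" "u $ 1 * p - u $ 3 * s - u $ 4 * t = 0"
    "u $ 1 * q + u $ 2 * s - u $ 4 * w = 0" "u $ 1 * r + u $ 2 * t + u $ 3 * w = 0"
    using assms(3)[of "axis 1 1"] assms(3)[of "axis 2 1"] assms(3)[of "axis 3 1"] assms(3)[of "axis 4 1"]
    unfolding skew_expand4[OF assms(1), of u] d[symmetric] by (simp_all add: axis_def)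
  define P where "P = p * w - q * t + r * s"
  have "vol4 \<omega> \<omega> = 2 * P" unfolding vol4_def wedge22_def P_def d by (simp add: algebra_simps)
  then have P: "P \<noteq> 0" using assms(2) by simp
  have "u $ 1 * P = 0" "u $ 2 * P = 0" "u $ 3 * P = 0" "u $ 4 * P = 0"
    unfolding P_def using eq by algebra+
  then show ?thesis using P by (simp add: vec_eq_iff forall_4)
qed

lemma det_4:
  "det (A::'a::comm_ring_1^4^4) =
     A$1$1 * (A$2$2 * A$3$3 * A$4$4 + A$2$3 * A$3$4 * A$4$2 + A$2$4 * A$3$2 * A$4$3
       - A$2$2 * A$3$4 * A$4$3 - A$2$3 * A$3$2 * A$4$4 - A$2$4 * A$3$3 * A$4$2)
   - A$1$2 * (A$2$1 * A$3$3 * A$4$4 + A$2$3 * A$3$4 * A$4$1 + A$2$4 * A$3$1 * A$4$3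
       - A$2$1 * A$3$4 * A$4$3 - A$2$3 * A$3$1 * A$4$4 - A$2$4 * A$3$3 * A$4$1)
   + A$1$3 * (A$2$1 * A$3$2 * A$4$4 + A$2$2 * A$3$4 * A$4$1 + A$2$4 * A$3$1 * A$4$2
       - A$2$1 * A$3$4 * A$4$2 - A$2$2 * A$3$1 * A$4$4 - A$2$4 * A$3$2 * A$4$1)
   - A$1$4 * (A$2$1 * A$3$2 * A$4$3 + A$2$2 * A$3$3 * A$4$1 + A$2$3 * A$3$1 * A$4$2
       - A$2$1 * A$3$3 * A$4$2 - A$2$2 * A$3$1 * A$4$3 - A$2$3 * A$3$2 * A$4$1)"
proof -
  have f1234: "finite {2::4, 3, 4}" "1 \<notin> {2::4, 3, 4}" by auto
  have f234: "finite {3::4, 4}" "2 \<notin> {3::4, 4}" by auto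
  have f34: "finite {4::4}" "3 \<notin> {4::4}" by auto
  show ?thesis
    unfolding det_def UNIV_4
    unfolding sum_over_permutations_insert[OF f1234]
    unfolding sum_over_permutations_insert[OF f234]
    unfolding sum_over_permutations_insert[OF f34]
    unfolding permutes_sing
    by (simp add: sign_swap_id permutation_swap_id sign_compose sign_id swap_id_eq permutation_compose
        algebra_simps)
qed

lemma vol4_pullback:
  assumes "skew \<omega>" "skew \<eta>"
  shows "vol4 (\<lambda>u v. \<omega> (A u) (A v)) (\<lambda>u v. \<eta> (A u) (A v)) = det (matrix A) * vol4 \<omega> \<eta>"
proof -
  let ?e = "\<lambda>k. axis k (1::real) :: real ^ 4"
  have m: "matrix A $ i $ j = A (axis j 1) $ i" for i j by (simp add: matrix_def)
  \<comment> \<open>With variables for the sixteen matrix entries and the twelve form coefficients,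
    the claim becomes a plain polynomial identity.\<close>
  obtain a11 a21 a31 a41 a12 a22 a32 a42 a13 a23 a33 a43 a14 a24 a34 a44 where
    a: "A (?e 1) $ 1 = a11" "A (?e 1) $ 2 = a21" "A (?e 1) $ 3 = a31" "A (?e 1) $ 4 = a41"
      "A (?e 2) $ 1 = a12" "A (?e 2) $ 2 = a22" "A (?e 2) $ 3 = a32" "A (?e 2) $ 4 = a42"
      "A (?e 3) $ 1 = a13" "A (?e 3) $ 2 = a23" "A (?e 3) $ 3 = a33" "A (?e 3) $ 4 = a43"
      "A (?e 4) $ 1 = a14" "A (?e 4) $ 2 = a24" "A (?e 4) $ 3 = a34" "A (?e 4) $ 4 = a44" by blast
  obtain p q r s t w p' q' r' s' t' w' where
    d: "\<omega> (?e 1) (?e 2) = p" "\<omega> (?e 1) (?e 3) = q" "\<omega> (?e 1) (?e 4) = r"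
      "\<omega> (?e 2) (?e 3) = s" "\<omega> (?e 2) (?e 4) = t" "\<omega> (?e 3) (?e 4) = w"
      "\<eta> (?e 1) (?e 2) = p'" "\<eta> (?e 1) (?e 3) = q'" "\<eta> (?e 1) (?e 4) = r'"
      "\<eta> (?e 2) (?e 3) = s'" "\<eta> (?e 2) (?e 4) = t'" "\<eta> (?e 3) (?e 4) = w'" by blast
  show ?thesis
    unfolding vol4_def wedge22_def skew_expand4[OF assms(1), of "A _"] skew_expand4[OF assms(2), of "A _"]
      det_4 m a d
    by algebra
qed

text \<open>The square of \<open>wedge11 \<rho> \<alpha>\<close> vanishes, so \<open>N\<close>
  occurs only to the first power. This is the shape treated by
  \<open>exp_collar_positive\<close>.\<close>

lemma vol4_square_expand:
  "vol4 (\<lambda>u v. l u v + c * (N * wedge11 \<rho> \<alpha> u v + b u v)) (\<lambda>u v. l u v + c * (N * wedge11 \<rho> \<alpha> u v + b u v)) =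
     vol4 l l + c * (N * (2 * vol4 (wedge11 \<rho> \<alpha>) l) + 2 * vol4 b l)
       + c\<^sup>2 * (N * (2 * vol4 (wedge11 \<rho> \<alpha>) b) + vol4 b b)"
  unfolding vol4_def wedge22_def wedge11_def by algebra

text \<open>The outer factor \<rho> annihilates \<open>wedge11 \<rho> \<alpha>\<close>. The one term
  with \<open>N\<close> left on the right is zero by \<open>vol4_wedge_wedge\<close>, which leaves a
  polynomial in \<open>c\<close> without \<open>N\<close>, as in
  \<open>quadratic_positive_large\<close>.\<close>

lemma vol4_contact_expand:
  "vol4 (wedge11 \<rho> (\<lambda>v. \<beta> v + c * \<alpha> v)) (\<lambda>u v. l u v + c * (N * wedge11 \<rho> \<alpha> u v + b u v)) =
     vol4 (wedge11 \<rho> \<beta>) l + c * (vol4 (wedge11 \<rho> \<alpha>) l + vol4 (wedge11 \<rho> \<beta>) b + N * vol4 (wedge11 \<rho> \<beta>) (wedge11 \<rho> \<alpha>))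
       + c\<^sup>2 * vol4 (wedge11 \<rho> \<alpha>) b"
  unfolding vol4_def wedge22_def wedge11_def by algebra

lemma vol4_wedge_wedge: "vol4 (wedge11 \<rho> \<beta>) (wedge11 \<rho> \<alpha>) = 0"
  unfolding vol4_def wedge22_def wedge11_def by algebra

section \<open>The boundary hyperplane in coordinates\<close>

lemma vector_4:
  "(vector [x,y,z,w] :: ('a::zero)^4) $ 1 = x"
  "(vector [x,y,z,w] :: ('a::zero)^4) $ 2 = y"
  "(vector [x,y,z,w] :: ('a::zero)^4) $ 3 = z"
  "(vector [x,y,z,w] :: ('a::zero)^4) $ 4 = w"
  unfolding vector_def by simp_all

lemma bd_incl_nth [simp]:
  "bd_incl y $ 1 = 0" "bd_incl y $ 2 = y $ 1" "bd_incl y $ 3 = y $ 2" "bd_incl y $ 4 = y $ 3"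
  by (simp_all add: bd_incl_def vector_4)

lemma bd_proj_nth [simp]:
  "bd_proj x $ 1 = x $ 2" "bd_proj x $ 2 = x $ 3" "bd_proj x $ 3 = x $ 4"
  by (simp_all add: bd_proj_def)

lemma bd_proj_incl [simp]: "bd_proj (bd_incl y) = y"
  by (simp add: vec_eq_iff forall_3)

lemma bd_incl_proj: "x $ 1 = 0 \<Longrightarrow> bd_incl (bd_proj x) = x"
  by (simp add: vec_eq_iff forall_4)

lemma linear_bd_incl: "linear bd_incl"
  by (rule linearI) (simp_all add: vec_eq_iff forall_4)

lemma linear_bd_proj: "linear bd_proj"
  by (rule linearI) (simp_all add: vec_eq_iff forall_3)

lemmas bounded_linear_bd_incl = linear_bd_incl[THEN linear_linear[THEN iffD2]]
lemmas bounded_linear_bd_proj = linear_bd_proj[THEN linear_linear[THEN iffD2]]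

lemma bd_proj_inner: "bd_proj x \<bullet> v = x \<bullet> bd_incl v"
  by (simp add: inner_vec_def sum_3 sum_4)

lemma bd_incl_inner: "bd_incl y \<bullet> v = y \<bullet> bd_proj v"
  by (simp add: inner_vec_def sum_3 sum_4)

lemma bd_incl_axis [simp]:
  "bd_incl (axis 1 1) = axis 2 1" "bd_incl (axis 2 1) = axis 3 1" "bd_incl (axis 3 1) = axis 4 1"
  by (simp_all add: vec_eq_iff forall_4 axis_def)

text \<open>A product with a multiple of the first coordinate form sees only the restrictions of the
  other factors to the boundary hyperplane. This is how a three-form on the boundary is replaced by
  a top form on V.\<close>

lemma vol4_boundary:
  assumes "\<And>v. \<rho> v = \<kappa> * v $ 1"
  shows "vol4 (wedge11 \<rho> \<alpha>) \<omega> =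
    \<kappa> * wedge12 (\<lambda>v. \<alpha> (bd_incl v)) (\<lambda>u v. \<omega> (bd_incl u) (bd_incl v)) (axis 1 1) (axis 2 1) (axis 3 1)"
proof -
  have "(axis 1 1 :: real ^ 4) $ 1 = 1" "(axis 2 1 :: real ^ 4) $ 1 = 0"
    "(axis 3 1 :: real ^ 4) $ 1 = 0" "(axis 4 1 :: real ^ 4) $ 1 = 0"
    by (simp_all add: axis_def)
  then show ?thesis
    unfolding vol4_def wedge22_def wedge11_def wedge12_def assms by (simp add: algebra_simps)
qed

section \<open>Covectors on the boundary and their kernels\<close>

lemma vec3_expand: "(x :: real ^ 3) = x $ 1 *\<^sub>R axis 1 1 + x $ 2 *\<^sub>R axis 2 1 + x $ 3 *\<^sub>R axis 3 1"
  by (auto simp: vec_eq_iff axis_def forall_3)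

lemma linear_expand3:
  assumes "linear (f :: real ^ 3 \<Rightarrow> real)"
  shows "f x = x $ 1 * f (axis 1 1) + x $ 2 * f (axis 2 1) + x $ 3 * f (axis 3 1)"
  using arg_cong[OF vec3_expand[of x], of f] by (simp only: linear_add[OF assms] linear_scale[OF assms] real_scaleR_def)

lemma skew_expand3:
  assumes "skew (\<omega> :: real ^ 3 \<Rightarrow> real ^ 3 \<Rightarrow> real)"
  shows "\<omega> u v =
      (u $ 1 * v $ 2 - u $ 2 * v $ 1) * \<omega> (axis 1 1) (axis 2 1) +
      (u $ 1 * v $ 3 - u $ 3 * v $ 1) * \<omega> (axis 1 1) (axis 3 1) +
      (u $ 2 * v $ 3 - u $ 3 * v $ 2) * \<omega> (axis 2 1) (axis 3 1)"
proof -
  have diag: "\<omega> a a = 0" for a using skewD(1)[OF assms, of a a] by simp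
  have flip: "\<omega> (axis 2 1) (axis 1 1) = - \<omega> (axis 1 1) (axis 2 1)"
    "\<omega> (axis 3 1) (axis 1 1) = - \<omega> (axis 1 1) (axis 3 1)"
    "\<omega> (axis 3 1) (axis 2 1) = - \<omega> (axis 2 1) (axis 3 1)"
    using skewD(1)[OF assms] by blast+
  have "\<omega> u v = u $ 1 * \<omega> (axis 1 1) v + u $ 2 * \<omega> (axis 2 1) v + u $ 3 * \<omega> (axis 3 1) v"
    using linear_expand3[OF skewD(3)[OF assms]] .
  also have "\<dots> = u $ 1 * (v $ 2 * \<omega> (axis 1 1) (axis 2 1) + v $ 3 * \<omega> (axis 1 1) (axis 3 1)) +
     u $ 2 * (- v $ 1 * \<omega> (axis 1 1) (axis 2 1) + v $ 3 * \<omega> (axis 2 1) (axis 3 1)) +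
     u $ 3 * (- v $ 1 * \<omega> (axis 1 1) (axis 3 1) - v $ 2 * \<omega> (axis 2 1) (axis 3 1))"
    unfolding linear_expand3[OF skewD(2)[OF assms], of _ v] by (simp add: diag flip)
  finally show ?thesis by (simp only: algebra_simps)
qed

text \<open>Translates domination into positivity of a three-form. For nonzero \<open>v\<close> in
  the plane and \<open>w = cross3 a v\<close> the triple \<open>(a, v, w)\<close> is a positive
  basis, and \<open>\<omega> v w\<close> is the wanted coefficient times
  \<open>v \<bullet> v\<close>.\<close>

lemma wedge12_pos_of_plane_pos:
  fixes a :: "real ^ 3"
  assumes "skew \<omega>" "a \<noteq> 0"
    and pos: "\<And>n v w. a \<bullet> n > 0 \<Longrightarrow> a \<bullet> v = 0 \<Longrightarrow> a \<bullet> w = 0 \<Longrightarrow>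
      det (vector [n, v, w] :: real ^ 3 ^ 3) > 0 \<Longrightarrow> \<omega> v w > 0"
  shows "wedge12 ((\<bullet>) a) \<omega> (axis 1 1) (axis 2 1) (axis 3 1) > 0"
proof -
  obtain v where v: "v \<noteq> 0" "a \<bullet> v = 0"
  proof (cases "a $ 1 = 0 \<and> a $ 2 = 0")
    case True
    then show ?thesis by (intro that[of "axis 1 1"]) (auto simp: inner_vec_def sum_3 axis_def vec_eq_iff)
  next
    case False
    then show ?thesis
      by (intro that[of "vector [- a $ 2, a $ 1, 0]"]) (auto simp: inner_vec_def sum_3 vec_eq_iff forall_3)
  qed
  define w where "w = cross3 a v"
  have "cross3 v w = (v \<bullet> v) *\<^sub>R a"
    unfolding w_def Lagrange using v(2) by (simp add: inner_commute)
  then have "det (vector [a, v, w] :: real ^ 3 ^ 3) = (v \<bullet> v) * (a \<bullet> a)"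
    by (simp flip: dot_cross_det)
  then have "\<omega> v w > 0"
    using assms(2) v by (intro pos[of a]) (auto simp: w_def dot_cross_self)
  moreover have "\<omega> v w = (v \<bullet> v) * wedge12 ((\<bullet>) a) \<omega> (axis 1 1) (axis 2 1) (axis 3 1) - (a \<bullet> v) *
      (v $ 1 * \<omega> (axis 2 1) (axis 3 1) - v $ 2 * \<omega> (axis 1 1) (axis 3 1) + v $ 3 * \<omega> (axis 1 1) (axis 2 1))"
    unfolding skew_expand3[OF assms(1), of v w]
    by (simp add: w_def wedge12_def cross3_def inner_vec_def sum_3 axis_def algebra_simps)
  ultimately have "(v \<bullet> v) * wedge12 ((\<bullet>) a) \<omega> (axis 1 1) (axis 2 1) (axis 3 1) > 0" using v(2) by simp
  from zero_less_mult_pos[OF this] show ?thesis using v(1) by simp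
qed

text \<open>Subtracting from \<open>b\<close> its projection to \<open>a\<close> leaves a vector in
  the kernel of \<open>a\<close>, hence in that of \<open>b\<close>; it is therefore orthogonal to
  itself.\<close>

lemma same_kernel_multiple:
  fixes a b :: "'a::real_inner"
  assumes "{v. a \<bullet> v = 0} = {v. b \<bullet> v = 0}" "a \<noteq> 0"
  shows "b = (a \<bullet> b / (a \<bullet> a)) *\<^sub>R a"
proof -
  define g where "g = a \<bullet> b / (a \<bullet> a)"
  have "a \<bullet> (b - g *\<^sub>R a) = 0" using assms(2) by (simp add: g_def inner_diff_right)
  moreover from this have "b \<bullet> (b - g *\<^sub>R a) = 0" using assms(1) by auto
  ultimately have "(b - g *\<^sub>R a) \<bullet> (b - g *\<^sub>R a) = 0" by (simp add: inner_diff_left)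
  then show ?thesis by (simp add: g_def)
qed

lemma coor_ker_eqD:
  assumes "coor_ker a = coor_ker b"
  shows "{v. a \<bullet> v = 0} = {v. b \<bullet> v = 0}" "{v. a \<bullet> v > 0} = {v. b \<bullet> v > 0}"
  using assms by (auto simp: coor_ker_def)

text \<open>Equal cooriented kernels give \<open>b = g a\<close> with \<open>g\<close> positive. The
  contact coefficient is multiplied by \<open>g\<^sup>2\<close>, since the term with the derivative
  of \<open>g\<close> contains \<open>a\<close> twice. The explicit quotient for \<open>g\<close>
  shows that it is differentiable.\<close>

lemma positive_contact_cong_kernel:
  assumes S: "thick S" "x \<in> S"
    and a: "smooth_on S a" and ker: "\<And>y. y \<in> S \<Longrightarrow> coor_ker (b y) = coor_ker (a y)"
    and b: "smooth_on S b" and contact: "\<And>y. y \<in> S \<Longrightarrow> positive_contact_at S a y"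
  shows "positive_contact_at S b x"
proof -
  have nz: "a y \<noteq> 0" if "y \<in> S" for y
    using contact[OF that] by (auto simp: positive_contact_at_def wedge12_def)
  define g where "g y = a y \<bullet> b y / (a y \<bullet> a y)" for y
  have bg: "b y = g y *\<^sub>R a y" if "y \<in> S" for y
    unfolding g_def using same_kernel_multiple[OF coor_ker_eqD(1)[OF ker[symmetric]]] nz that by blast
  have "a x \<in> {v. b x \<bullet> v > 0}" using coor_ker_eqD(2)[OF ker[OF S(2)]] nz[OF S(2)] by auto
  then have "g x * (a x \<bullet> a x) > 0" by (simp add: bg[OF S(2)])
  from zero_less_mult_pos2[OF this] have gpos: "g x > 0" using nz[OF S(2)] by simp
  have "(\<lambda>y. a y \<bullet> b y) differentiable (at x within S)" "(\<lambda>y. a y \<bullet> a y) differentiable (at x within S)"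
    by (intro smooth_on_differentiable smooth_on_inner a b S)+
  then have "g differentiable (at x within S)"
    unfolding g_def using nz[OF S(2)] by (intro differentiable_divide) auto
  then obtain g' where g': "(g has_derivative g') (at x within S)" by (auto simp: differentiable_def)
  define a' where "a' = frechet_derivative a (at x within S)"
  have "(a has_derivative a') (at x within S)"
    unfolding a'_def by (rule smooth_on_has_derivative[OF a S(2)])
  from has_derivative_scaleR[OF g' this]
  have "(b has_derivative (\<lambda>h. g x *\<^sub>R a' h + g' h *\<^sub>R a x)) (at x within S)"
    by (rule has_derivative_transform_within[OF _ zero_less_one S(2)]) (simp add: bg)
  then have db: "frechet_derivative b (at x within S) = (\<lambda>h. g x *\<^sub>R a' h + g' h *\<^sub>R a x)"
    by (rule thick_frechet_derivative[OF S])
  have "wedge12 ((\<bullet>) (b x)) (ext_deriv S b x) u v w = (g x)\<^sup>2 * wedge12 ((\<bullet>) (a x)) (ext_deriv S a x) u v w" for u v w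
    unfolding wedge12_def ext_deriv_def db a'_def[symmetric] bg[OF S(2)]
    by (simp add: inner_add_left) algebra
  then show ?thesis using contact[OF S(2)] gpos by (simp add: positive_contact_at_def)
qed

text \<open>\<open>Liouville_structure\<close> prescribes the plane but not its coorientation. The
  sign of the factor is recovered by pairing both covectors with the same two-form.\<close>

lemma contact_kernel_pos:
  fixes a b :: "real ^ 3"
  assumes "{v. a \<bullet> v = 0} = {v. b \<bullet> v = 0}"
    and "wedge12 ((\<bullet>) a) \<omega> (axis 1 1) (axis 2 1) (axis 3 1) > 0"
    and "wedge12 ((\<bullet>) b) \<omega> (axis 1 1) (axis 2 1) (axis 3 1) > 0"
  obtains g where "g > 0" "b = g *\<^sub>R a"
proof -
  have "a \<noteq> 0" using assms(2) by (auto simp: wedge12_def)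
  then obtain g where g: "b = g *\<^sub>R a" using same_kernel_multiple[OF assms(1)] by blast
  have "wedge12 ((\<bullet>) b) \<omega> (axis 1 1) (axis 2 1) (axis 3 1) =
      g * wedge12 ((\<bullet>) a) \<omega> (axis 1 1) (axis 2 1) (axis 3 1)"
    unfolding g wedge12_def by (simp add: algebra_simps)
  then have "g > 0" using assms(2,3) by (simp add: zero_less_mult_iff)
  then show ?thesis using g that by blast
qed

section \<open>Charts at the boundary\<close>

lemma half_space4_ray:
  assumes S: "openin (top_of_set half_space4) S" "x \<in> S"
  obtains e where "e > 0" "\<And>s. \<bar>s\<bar> < e \<Longrightarrow> x $ 1 + s * v $ 1 \<le> 0 \<Longrightarrow> x + s *\<^sub>R v \<in> S"
proof -
  obtain U where U: "open U" "S = half_space4 \<inter> U" using S by (auto simp: openin_open)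
  then obtain d where d: "d > 0" "ball x d \<subseteq> U" using S(2) openE by blast
  show ?thesis
  proof
    show "d / (norm v + 1) > 0" using d by (simp add: add_nonneg_pos)
    fix s :: real assume s: "\<bar>s\<bar> < d / (norm v + 1)" "x $ 1 + s * v $ 1 \<le> 0"
    have "\<bar>s\<bar> * norm v \<le> \<bar>s\<bar> * (norm v + 1)" by (simp add: mult_left_mono)
    also have "\<dots> < d" using s(1) by (simp add: pos_less_divide_eq add_nonneg_pos)
    finally have "x + s *\<^sub>R v \<in> ball x d" by (simp add: dist_norm)
    then show "x + s *\<^sub>R v \<in> S" using d U s(2) by (auto simp: half_space4_def)
  qed
qed

lemma thick_half_space4:
  assumes "openin (top_of_set half_space4) S"
  shows "thick S"
  unfolding thick_def
proof (intro ballI allI impI)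
  fix x :: "real ^ 4" and b :: "real ^ 4" and e :: real
  assume x: "x \<in> S" and b: "b \<in> Basis" and e: "e > 0"
  obtain d where d: "d > 0" "\<And>s. \<bar>s\<bar> < d \<Longrightarrow> x $ 1 + s * b $ 1 \<le> 0 \<Longrightarrow> x + s *\<^sub>R b \<in> S"
    using half_space4_ray[OF assms x] by blast
  \<comment> \<open>Basis vectors have nonnegative first coordinate, so a negative step stays in the
    half-space.\<close>
  define s where "s = - min d e / 2"
  have "x $ 1 \<le> 0" using x openin_imp_subset[OF assms] by (auto simp: half_space4_def)
  moreover have "b $ 1 \<ge> 0" using b by (auto simp: Basis_vec_def axis_def)
  moreover have "s < 0" using d e by (simp add: s_def)
  ultimately have "x $ 1 + s * b $ 1 \<le> 0"
    by (simp add: add_nonpos_nonpos mult_nonpos_nonneg)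
  moreover have "\<bar>s\<bar> < d" "\<bar>s\<bar> < e" "0 < \<bar>s\<bar>" using d e by (auto simp: s_def)
  ultimately show "\<exists>d. 0 < \<bar>d\<bar> \<and> \<bar>d\<bar> < e \<and> x + d *\<^sub>R b \<in> S" using d by blast
qed

lemma thick_open:
  assumes "open S"
  shows "thick S"
  unfolding thick_def
proof (intro ballI allI impI)
  fix x b :: 'a and e :: real
  assume x: "x \<in> S" and b: "b \<in> Basis" and e: "e > 0"
  obtain d where d: "d > 0" "ball x d \<subseteq> S" using assms x openE by blast
  have "x + (min d e / 2) *\<^sub>R b \<in> ball x d" using d e b by (simp add: dist_norm)
  then show "\<exists>d. 0 < \<bar>d\<bar> \<and> \<bar>d\<bar> < e \<and> x + d *\<^sub>R b \<in> S"
    using d e by (intro exI[of _ "min d e / 2"]) auto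
qed

lemma line_derivative_within:
  assumes "(f has_derivative f') (at x within S)" "\<And>s. s \<in> I \<Longrightarrow> x + s *\<^sub>R v \<in> S"
  shows "((\<lambda>s. f (x + s *\<^sub>R v)) has_real_derivative f' v) (at 0 within I)"
proof -
  have l: "((\<lambda>s. x + s *\<^sub>R v) has_derivative (\<lambda>r. r *\<^sub>R v)) (at 0 within I)"
    by (auto intro!: derivative_eq_intros)
  have "(f has_derivative f') (at (x + 0 *\<^sub>R v) within (\<lambda>s. x + s *\<^sub>R v) ` I)"
    using assms by (auto intro: has_derivative_subset)
  from diff_chain_within[OF l this]
  have "((\<lambda>s. f (x + s *\<^sub>R v)) has_derivative (\<lambda>r. f' (r *\<^sub>R v))) (at 0 within I)"
    by (simp add: o_def)
  moreover have "(\<lambda>r. f' (r *\<^sub>R v)) = (*) (f' v)"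
    using has_derivative_linear[OF assms(1)] by (auto simp: linear_scale mult.commute)
  ultimately show ?thesis by (simp add: has_field_derivative_def)
qed

text \<open>A line tangent to the boundary stays in \<open>S\<close> on both sides of
  \<open>x\<close>, and \<open>f\<close> vanishes along it.\<close>

lemma half_space4_tangential_derivative:
  fixes f :: "real ^ 4 \<Rightarrow> real"
  assumes S: "openin (top_of_set half_space4) S" "x \<in> S" "x $ 1 = 0"
    and f: "(f has_derivative f') (at x within S)" "\<And>y. y \<in> S \<Longrightarrow> y $ 1 = 0 \<Longrightarrow> f y = 0"
    and v: "v $ 1 = 0"
  shows "f' v = 0"
proof -
  obtain e where e: "e > 0" "\<And>s. \<bar>s\<bar> < e \<Longrightarrow> x $ 1 + s * v $ 1 \<le> 0 \<Longrightarrow> x + s *\<^sub>R v \<in> S"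
    using half_space4_ray[OF S(1,2)] by blast
  have I: "x + s *\<^sub>R v \<in> S" if "s \<in> {-e<..<e}" for s
    using that S(3) v by (intro e(2)) auto
  have "((\<lambda>s. f (x + s *\<^sub>R v)) has_real_derivative f' v) (at 0 within {-e<..<e})"
    by (rule line_derivative_within[OF f(1) I])
  then have "((\<lambda>s. f (x + s *\<^sub>R v)) has_real_derivative f' v) (at 0)"
    using e(1) by (simp add: at_within_open[of 0 "{-e<..<e}"])
  then have "((\<lambda>s. 0) has_real_derivative f' v) (at 0)"
    by (rule has_field_derivative_transform_within_open[where S="{-e<..<e}"])
      (use e(1) I f(2) S(3) v in auto)
  then show ?thesis using DERIV_unique DERIV_const by blast
qed

text \<open>Only the inward half of the axis is available. A negative derivative would make
  \<open>f\<close> exceed its maximum just inside.\<close>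

lemma half_space4_normal_derivative:
  fixes f :: "real ^ 4 \<Rightarrow> real"
  assumes S: "openin (top_of_set half_space4) S" "x \<in> S"
    and f: "(f has_derivative f') (at x within S)" "\<And>y. y \<in> S \<Longrightarrow> f y \<le> f x"
  shows "f' (axis 1 1) \<ge> 0"
proof (rule ccontr)
  assume neg: "\<not> f' (axis 1 1) \<ge> 0"
  obtain e where e: "e > 0" "\<And>s. \<bar>s\<bar> < e \<Longrightarrow> x $ 1 + s * (axis 1 1 :: real ^ 4) $ 1 \<le> 0 \<Longrightarrow> x + s *\<^sub>R axis 1 1 \<in> S"
    using half_space4_ray[OF S] by blast
  have x1: "x $ 1 \<le> 0" using S openin_imp_subset[OF S(1)] by (auto simp: half_space4_def)
  have I: "x + s *\<^sub>R axis 1 1 \<in> S" if "s \<in> {-e<..0}" for s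
    using that x1 by (intro e(2)) auto
  have "((\<lambda>s. f (x + s *\<^sub>R axis 1 1)) has_real_derivative f' (axis 1 1)) (at 0 within {-e<..0})"
    by (rule line_derivative_within[OF f(1) I])
  from has_real_derivative_neg_dec_left[OF this] neg
  obtain d where d: "d > 0" "\<And>h. h > 0 \<Longrightarrow> 0 - h \<in> {-e<..0} \<Longrightarrow> h < d \<Longrightarrow>
      f (x + 0 *\<^sub>R axis 1 1) < f (x + (0 - h) *\<^sub>R axis 1 1)" by auto
  have "f x < f (x + (- (min d e / 2)) *\<^sub>R axis 1 1)" using d(2)[of "min d e / 2"] d(1) e(1) by auto
  moreover have "f (x + (- (min d e / 2)) *\<^sub>R axis 1 1) \<le> f x"
    by (intro f(2) I) (use d(1) e(1) in auto)
  ultimately show False by simp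
qed

section \<open>Transition maps of an oriented four-manifold with boundary\<close>

locale manifold4 =
  fixes V :: "('a, 'i, 4) manifold"
  assumes oriented: "oriented_manifold half_space4 V"
begin

lemma chart_dom_subset: "i \<in> index V \<Longrightarrow> chart_dom V i \<subseteq> topspace (top_of V)"
  and chart_img_open: "i \<in> index V \<Longrightarrow> openin (top_of_set half_space4) (chart_img V i)"
  and chart_dom_open: "i \<in> index V \<Longrightarrow> openin (top_of V) (chart_dom V i)"
  and chart_homeo: "i \<in> index V \<Longrightarrow> homeomorphic_map (subtopology (top_of V) (chart_dom V i))
          (top_of_set (chart_img V i)) (chart V i)"
  and smooth_transition: "i \<in> index V \<Longrightarrow> j \<in> index V \<Longrightarrow> smooth_on (overlap V i j) (transition V i j)"
  and det_transition: "i \<in> index V \<Longrightarrow> j \<in> index V \<Longrightarrow> x \<in> overlap V i j \<Longrightarrow>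
    det (matrix (D_transition V i j x)) > 0"
  using oriented by (auto simp: oriented_manifold_def openin_subset)

lemma topspace_chart_dom: "i \<in> index V \<Longrightarrow> topspace (subtopology (top_of V) (chart_dom V i)) = chart_dom V i"
  using chart_dom_subset by auto

lemma inj_chart: "i \<in> index V \<Longrightarrow> inj_on (chart V i) (chart_dom V i)"
  using homeomorphic_imp_injective_map[OF chart_homeo] topspace_chart_dom by simp

lemma transition_chart:
  "i \<in> index V \<Longrightarrow> p \<in> chart_dom V i \<Longrightarrow> transition V i j (chart V i p) = chart V j p"
  by (simp add: transition_def inj_chart)

lemma overlapE:
  assumes "i \<in> index V" "x \<in> overlap V i j"
  obtains p where "p \<in> chart_dom V i" "p \<in> chart_dom V j" "chart V i p = x" "transition V i j x = chart V j p"
  using assms transition_chart unfolding overlap_def by blast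

lemma overlapI: "p \<in> chart_dom V i \<Longrightarrow> p \<in> chart_dom V j \<Longrightarrow> chart V i p \<in> overlap V i j"
  by (auto simp: overlap_def)

lemma overlap_subset: "overlap V i j \<subseteq> chart_img V i"
  by (auto simp: overlap_def chart_img_def)

lemma overlap_self: "overlap V i i = chart_img V i"
  by (auto simp: overlap_def chart_img_def)

lemma transition_self: "i \<in> index V \<Longrightarrow> x \<in> chart_img V i \<Longrightarrow> transition V i i x = x"
  using transition_chart by (auto simp: chart_img_def)

lemma transition_in_overlap:
  assumes "i \<in> index V" "x \<in> overlap V i j"
  shows "transition V i j x \<in> overlap V j i"
  using assms by (auto elim!: overlapE simp: overlapI)

lemma transition_in_img: "i \<in> index V \<Longrightarrow> x \<in> overlap V i j \<Longrightarrow> transition V i j x \<in> chart_img V j"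
  using transition_in_overlap overlap_subset by blast

lemma transition_trans:
  assumes "i \<in> index V" "j \<in> index V" "x \<in> overlap V i j"
  shows "x \<in> overlap V i k \<longleftrightarrow> transition V i j x \<in> overlap V j k"
    and "transition V j k (transition V i j x) = transition V i k x"
proof -
  obtain p where p: "p \<in> chart_dom V i" "p \<in> chart_dom V j" "chart V i p = x" "transition V i j x = chart V j p"
    using overlapE[OF assms(1,3)] by blast
  have "x \<in> overlap V i k \<longleftrightarrow> p \<in> chart_dom V k"
    using p inj_chart[OF assms(1)] by (auto simp: overlap_def inj_on_def)
  moreover have "chart V j p \<in> overlap V j k \<longleftrightarrow> p \<in> chart_dom V k"
    using p inj_chart[OF assms(2)] by (auto simp: overlap_def inj_on_def)
  ultimately show "x \<in> overlap V i k \<longleftrightarrow> transition V i j x \<in> overlap V j k" using p by simp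
  show "transition V j k (transition V i j x) = transition V i k x"
    using p transition_chart[OF assms(1) p(1), of k] transition_chart[OF assms(2) p(2), of k] by simp
qed

lemma transition_inverse:
  "i \<in> index V \<Longrightarrow> j \<in> index V \<Longrightarrow> x \<in> overlap V i j \<Longrightarrow> transition V j i (transition V i j x) = x"
  using transition_trans(2)[of i j x i] transition_self overlap_subset by fastforce

lemma overlap_open:
  assumes "i \<in> index V" "j \<in> index V"
  shows "openin (top_of_set half_space4) (overlap V i j)"
proof -
  have "openin (top_of V) (chart_dom V i \<inter> chart_dom V j)"
    by (intro openin_Int chart_dom_open assms)
  then have "openin (subtopology (top_of V) (chart_dom V i)) (chart_dom V i \<inter> chart_dom V j)"
    by (intro openin_subtopology_Int2) (auto intro: chart_dom_open assms)
  then have "openin (top_of_set (chart_img V i)) (chart V i ` (chart_dom V i \<inter> chart_dom V j))"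
    using homeomorphic_imp_open_map[OF chart_homeo[OF assms(1)]] by (simp add: open_map_def)
  then show ?thesis unfolding overlap_def[symmetric]
    using openin_trans chart_img_open[OF assms(1)] by blast
qed

lemma thick_overlap: "i \<in> index V \<Longrightarrow> j \<in> index V \<Longrightarrow> thick (overlap V i j)"
  by (intro thick_half_space4 overlap_open)

lemma thick_chart_img: "i \<in> index V \<Longrightarrow> thick (chart_img V i)"
  by (intro thick_half_space4 chart_img_open)

lemma chart_img_nonpos: "i \<in> index V \<Longrightarrow> x \<in> chart_img V i \<Longrightarrow> x $ 1 \<le> 0"
  using openin_imp_subset[OF chart_img_open] by (auto simp: half_space4_def)

lemma transition_has_derivative:
  "i \<in> index V \<Longrightarrow> j \<in> index V \<Longrightarrow> x \<in> overlap V i j \<Longrightarrow>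
    (transition V i j has_derivative D_transition V i j x) (at x within overlap V i j)"
  unfolding D_transition_def by (intro smooth_on_has_derivative smooth_transition)

lemma linear_D_transition:
  "i \<in> index V \<Longrightarrow> j \<in> index V \<Longrightarrow> x \<in> overlap V i j \<Longrightarrow> linear (D_transition V i j x)"
  using transition_has_derivative has_derivative_linear by blast

text \<open>The three derivatives are taken within three different overlaps. All restrict to the
  triple overlap, which is relatively open in the half-space, so derivatives within it are unique
  and the chain rule can be compared there.\<close>

lemma D_transition_trans:
  assumes "i \<in> index V" "j \<in> index V" "k \<in> index V" "x \<in> overlap V i j" "x \<in> overlap V i k"
  shows "D_transition V j k (transition V i j x) (D_transition V i j x v) = D_transition V i k x v"
proof -
  let ?A = "overlap V i j \<inter> overlap V i k"
  have A: "thick ?A" by (intro thick_half_space4 openin_Int overlap_open assms)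
  have "(transition V i j has_derivative D_transition V i j x) (at x within ?A)"
    by (rule has_derivative_subset[OF transition_has_derivative]) (use assms in auto)
  moreover have "(transition V j k has_derivative D_transition V j k (transition V i j x))
      (at (transition V i j x) within transition V i j ` ?A)"
    using assms transition_trans(1)[OF assms(1,2), of _ k]
    by (intro has_derivative_subset[OF transition_has_derivative]) blast+
  ultimately have "(transition V j k \<circ> transition V i j has_derivative
      D_transition V j k (transition V i j x) \<circ> D_transition V i j x) (at x within ?A)"
    by (rule diff_chain_within)
  then have "(transition V i k has_derivative
      D_transition V j k (transition V i j x) \<circ> D_transition V i j x) (at x within ?A)"
    by (rule has_derivative_transform_within[OF _ zero_less_one])
      (use assms transition_trans(2) in auto)
  moreover have "(transition V i k has_derivative D_transition V i k x) (at x within ?A)"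
    by (rule has_derivative_subset[OF transition_has_derivative]) (use assms in auto)
  ultimately show ?thesis
    using thick_unique[OF A] assms by (metis IntI comp_apply)
qed

lemma D_transition_self:
  assumes "i \<in> index V" "x \<in> chart_img V i"
  shows "D_transition V i i x v = v"
proof -
  have "(transition V i i has_derivative (\<lambda>v. v)) (at x within chart_img V i)"
    by (rule has_derivative_transform_within[OF has_derivative_ident zero_less_one])
      (use assms transition_self in auto)
  then show ?thesis
    using thick_unique[OF thick_chart_img] transition_has_derivative[of i i x] assms overlap_self by metis
qed

lemma D_transition_inverse:
  assumes "i \<in> index V" "j \<in> index V" "x \<in> overlap V i j"
  shows "D_transition V j i (transition V i j x) (D_transition V i j x v) = v"
proof -
  have x: "x \<in> chart_img V i" using assms(3) overlap_subset by blast
  then have "x \<in> overlap V i i" by (simp add: overlap_self)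
  from D_transition_trans[OF assms(1,2,1,3) this] D_transition_self[OF assms(1) x] show ?thesis by simp
qed

text \<open>If a boundary point went to an interior point, the first coordinate of the inverse
  transition map would have an interior maximum there. Its differential would vanish, against the
  invertibility of the derivative.\<close>

lemma transition_boundary:
  assumes "i \<in> index V" "j \<in> index V" "x \<in> overlap V i j" "x $ 1 = 0"
  shows "transition V i j x $ 1 = 0"
proof (rule ccontr)
  let ?y = "transition V i j x"
  assume "?y $ 1 \<noteq> 0"
  have y: "?y \<in> overlap V j i" using transition_in_overlap assms by blast
  then have y1: "?y $ 1 < 0"
    using \<open>?y $ 1 \<noteq> 0\<close> chart_img_nonpos[OF assms(2)] overlap_subset by (metis less_eq_real_def subsetD)
  obtain U where U: "open U" "overlap V j i = half_space4 \<inter> U"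
    using overlap_open[OF assms(2,1)] by (auto simp: openin_open)
  let ?W = "U \<inter> {z. z $ 1 < 0}"
  have W: "open ?W" by (intro open_Int U open_halfspace_component_lt_cart)
  have WS: "?W \<subseteq> overlap V j i" unfolding U(2) half_space4_def by auto
  have yW: "?y \<in> ?W" using y y1 U by auto
  have "(transition V j i has_derivative D_transition V j i ?y) (at ?y within ?W)"
    by (rule has_derivative_subset[OF transition_has_derivative]) (use assms y WS in auto)
  then have "(transition V j i has_derivative D_transition V j i ?y) (at ?y)"
    using at_within_open[OF yW W] by simp
  then have "((\<lambda>z. transition V j i z $ 1) has_derivative (\<lambda>v. D_transition V j i ?y v $ 1)) (at ?y)"
    by (rule bounded_linear.has_derivative[OF bounded_linear_vec_nth])
  moreover have "\<forall>z\<in>?W. transition V j i z $ 1 \<le> transition V j i ?y $ 1"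
  proof
    fix z assume "z \<in> ?W"
    then have "transition V j i z \<in> chart_img V i" using WS transition_in_img[OF assms(2)] by blast
    then show "transition V j i z $ 1 \<le> transition V j i ?y $ 1"
      using transition_inverse[OF assms(1-3)] assms(4) chart_img_nonpos[OF assms(1)] by simp
  qed
  ultimately have "(\<lambda>v. D_transition V j i ?y v $ 1) = (\<lambda>v. 0)"
    using differential_zero_maxmin[OF yW W] by blast
  then have "D_transition V j i ?y (D_transition V i j x (axis 1 1)) $ 1 = 0" by meson
  then show False using D_transition_inverse[OF assms(1-3)] by simp
qed

lemma D_transition_tangential:
  assumes "i \<in> index V" "j \<in> index V" "x \<in> overlap V i j" "x $ 1 = 0" "v $ 1 = 0"
  shows "D_transition V i j x v $ 1 = 0"
  by (rule half_space4_tangential_derivative[OF overlap_open[OF assms(1,2)] assms(3,4)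
      bounded_linear.has_derivative[OF bounded_linear_vec_nth transition_has_derivative]])
    (use assms transition_boundary in auto)

text \<open>The first coordinate of the transition map is nonpositive and attains 0 at
  \<open>x\<close>, which gives a nonnegative derivative. If it were 0, the derivative would map
  everything into the boundary hyperplane and could not be surjective.\<close>

lemma D_transition_normal:
  assumes "i \<in> index V" "j \<in> index V" "x \<in> overlap V i j" "x $ 1 = 0"
  shows "D_transition V i j x (axis 1 1) $ 1 > 0"
proof -
  have "D_transition V i j x (axis 1 1) $ 1 \<ge> 0"
    by (rule half_space4_normal_derivative[OF overlap_open[OF assms(1,2)] assms(3)
      bounded_linear.has_derivative[OF bounded_linear_vec_nth transition_has_derivative]])
    (use assms transition_boundary transition_in_img chart_img_nonpos in auto)
  moreover have "D_transition V i j x (axis 1 1) $ 1 \<noteq> 0"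
  proof
    assume 0: "D_transition V i j x (axis 1 1) $ 1 = 0"
    have y: "transition V i j x \<in> overlap V j i" using transition_in_overlap assms by blast
    define v where "v = D_transition V j i (transition V i j x) (axis 1 1)"
    have "axis 1 1 = D_transition V i j x v"
      unfolding v_def using D_transition_inverse[OF assms(2,1) y] transition_inverse[OF assms(1-3)] by metis
    also have "v = v $ 1 *\<^sub>R axis 1 1 + (v - v $ 1 *\<^sub>R axis 1 1)" by simp
    also have "D_transition V i j x \<dots> $ 1 =
        v $ 1 * D_transition V i j x (axis 1 1) $ 1 + D_transition V i j x (v - v $ 1 *\<^sub>R axis 1 1) $ 1"
      unfolding linear_add[OF linear_D_transition[OF assms(1-3)]] linear_scale[OF linear_D_transition[OF assms(1-3)]]
      by simp
    also have "\<dots> = 0" using 0 D_transition_tangential[OF assms] by simp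
    finally show False by simp
  qed
  ultimately show ?thesis by simp
qed

lemma boundary_points_iff:
  assumes "i \<in> index V" "p \<in> chart_dom V i"
  shows "p \<in> boundary_points V \<longleftrightarrow> chart V i p $ 1 = 0"
proof
  assume "p \<in> boundary_points V"
  then obtain j where "j \<in> index V" "p \<in> chart_dom V j" "chart V j p $ 1 = 0"
    by (auto simp: boundary_points_def)
  then show "chart V i p $ 1 = 0"
    using transition_boundary[of j i "chart V j p"] transition_chart[of j p i] assms overlapI by auto
qed (use assms in \<open>auto simp: boundary_points_def\<close>)

section \<open>The induced atlas of the boundary\<close>

lemma index_boundary [simp]: "index (boundary V) = index V"
  by (simp add: boundary_def)

lemma boundary_chart_img:
  assumes "i \<in> index V"
  shows "chart_img (boundary V) i = {y. bd_incl y \<in> chart_img V i}"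
proof -
  have "(bd_incl y \<in> chart_img V i) \<longleftrightarrow> (\<exists>p\<in>chart_dom V i \<inter> boundary_points V. y = bd_proj (chart V i p))" for y
    using boundary_points_iff[OF assms] bd_incl_proj bd_proj_incl bd_incl_nth(1)
    unfolding chart_img_def by (smt (verit) IntE IntI imageE image_eqI)
  then show ?thesis by (auto simp: chart_img_def boundary_def)
qed

lemma boundary_chart_img_open: "i \<in> index V \<Longrightarrow> open (chart_img (boundary V) i)"
proof -
  assume i: "i \<in> index V"
  obtain U where U: "open U" "chart_img V i = half_space4 \<inter> U"
    using chart_img_open[OF i] by (auto simp: openin_open)
  have "chart_img (boundary V) i = bd_incl -` U"
    unfolding boundary_chart_img[OF i] U(2) by (auto simp: half_space4_def)
  then show ?thesis
    using U(1) linear_continuous_on[OF bounded_linear_bd_incl] by (simp add: open_vimage)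
qed

lemma boundary_overlap:
  assumes "i \<in> index V"
  shows "overlap (boundary V) i j = {y. bd_incl y \<in> overlap V i j}"
proof -
  have "(bd_incl y \<in> overlap V i j) \<longleftrightarrow>
      (\<exists>p\<in>chart_dom V i \<inter> chart_dom V j \<inter> boundary_points V. y = bd_proj (chart V i p))" for y
    using boundary_points_iff[OF assms] bd_incl_proj bd_proj_incl bd_incl_nth(1)
    unfolding overlap_def by (smt (verit) IntE IntI imageE image_eqI)
  then show ?thesis by (auto simp: overlap_def boundary_def)
qed

lemma boundary_transition:
  assumes "i \<in> index V" "bd_incl y \<in> overlap V i j"
  shows "transition (boundary V) i j y = bd_proj (transition V i j (bd_incl y))"
proof -
  obtain p where p: "p \<in> chart_dom V i" "p \<in> chart_dom V j" "chart V i p = bd_incl y"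
    "transition V i j (bd_incl y) = chart V j p"
    using overlapE[OF assms] by blast
  have "inj_on (\<lambda>p. bd_proj (chart V i p)) (chart_dom V i \<inter> boundary_points V)"
    using inj_chart[OF assms(1)] boundary_points_iff[OF assms(1)] bd_incl_proj
    unfolding inj_on_def by (metis IntE)
  moreover have "p \<in> chart_dom V i \<inter> boundary_points V"
    using p boundary_points_iff[OF assms(1)] by simp
  ultimately have "inv_into (chart_dom V i \<inter> boundary_points V) (\<lambda>p. bd_proj (chart V i p)) (bd_proj (chart V i p)) = p"
    by (rule inv_into_f_f)
  then show ?thesis using p(3,4)
    by (simp add: transition_def[of "boundary V"]) (simp add: boundary_def)
qed

lemma boundary_overlap_open:
  assumes "i \<in> index V" "j \<in> index V"
  shows "open (overlap (boundary V) i j)"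
proof -
  obtain U where U: "open U" "overlap V i j = half_space4 \<inter> U"
    using overlap_open[OF assms] by (auto simp: openin_open)
  have "overlap (boundary V) i j = bd_incl -` U"
    unfolding boundary_overlap[OF assms(1)] U(2) by (auto simp: half_space4_def)
  then show ?thesis
    using U(1) linear_continuous_on[OF bounded_linear_bd_incl] by (simp add: open_vimage)
qed

lemma boundary_restriction_has_derivative:
  assumes "(f has_derivative f') (at (bd_incl y) within S)"
  shows "((\<lambda>y. bd_proj (f (bd_incl y))) has_derivative (\<lambda>v. bd_proj (f' (bd_incl v)))) (at y within {y. bd_incl y \<in> S})"
proof -
  have "(bd_incl has_derivative bd_incl) (at y within {y. bd_incl y \<in> S})"
    by (rule bounded_linear_imp_has_derivative[OF bounded_linear_bd_incl])
  moreover have "(f has_derivative f') (at (bd_incl y) within bd_incl ` {y. bd_incl y \<in> S})"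
    by (rule has_derivative_subset[OF assms]) auto
  ultimately have "(f \<circ> bd_incl has_derivative f' \<circ> bd_incl) (at y within {y. bd_incl y \<in> S})"
    by (rule diff_chain_within)
  from bounded_linear.has_derivative[OF bounded_linear_bd_proj this] show ?thesis by (simp add: o_def)
qed

lemma boundary_D_transition:
  assumes "i \<in> index V" "j \<in> index V" "bd_incl y \<in> overlap V i j"
  shows "D_transition (boundary V) i j y v = bd_proj (D_transition V i j (bd_incl y) (bd_incl v))"
proof -
  have "((\<lambda>y. bd_proj (transition V i j (bd_incl y))) has_derivative
      (\<lambda>v. bd_proj (D_transition V i j (bd_incl y) (bd_incl v)))) (at y within overlap (boundary V) i j)"
    unfolding boundary_overlap[OF assms(1)]
    by (rule boundary_restriction_has_derivative[OF transition_has_derivative[OF assms]])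
  then have "(transition (boundary V) i j has_derivative
      (\<lambda>v. bd_proj (D_transition V i j (bd_incl y) (bd_incl v)))) (at y within overlap (boundary V) i j)"
    by (rule has_derivative_transform_within[OF _ zero_less_one])
      (use assms boundary_transition boundary_overlap in auto)
  from thick_frechet_derivative[OF thick_open[OF boundary_overlap_open[OF assms(1,2)]] _ this]
  show ?thesis using assms by (simp add: D_transition_def boundary_overlap)
qed

end

section \<open>Forms and transition maps\<close>

lemma one_formD:
  assumes "one_form M a"
  shows "i \<in> index M \<Longrightarrow> smooth_on (chart_img M i) (a i)"
    and "i \<in> index M \<Longrightarrow> j \<in> index M \<Longrightarrow> x \<in> overlap M i j \<Longrightarrow>
      a i x \<bullet> v = a j (transition M i j x) \<bullet> D_transition M i j x v"
  using assms unfolding one_form_def by blast+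

definition scalar_function :: "('a, 'i, 'n::finite) manifold \<Rightarrow> ('i \<Rightarrow> real ^ 'n \<Rightarrow> real) \<Rightarrow> bool" where
  "scalar_function M f \<longleftrightarrow>
     (\<forall>i\<in>index M. smooth_on (chart_img M i) (f i)) \<and>
     (\<forall>i\<in>index M. \<forall>j\<in>index M. \<forall>x\<in>overlap M i j. f i x = f j (transition M i j x))"

lemma smooth_form_pathI:
  assumes "\<And>i. i \<in> index M \<Longrightarrow> smooth_on ({0..1} \<times> chart_img M i) (\<lambda>(t, x). a t i x)"
    and "\<And>t i j x v. t \<in> {0..1} \<Longrightarrow> i \<in> index M \<Longrightarrow> j \<in> index M \<Longrightarrow> x \<in> overlap M i j \<Longrightarrow>
      a t i x \<bullet> v = a t j (transition M i j x) \<bullet> D_transition M i j x v"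
  shows "smooth_form_path M a"
  unfolding smooth_form_path_def one_form_def
  using assms smooth_on_slice[OF assms(1)] by blast

lemma smooth_form_pathD:
  assumes "smooth_form_path M a"
  shows "t \<in> {0..1} \<Longrightarrow> one_form M (a t)"
    and "i \<in> index M \<Longrightarrow> smooth_on ({0..1} \<times> chart_img M i) (\<lambda>(t, x). a t i x)"
  using assms unfolding smooth_form_path_def by blast+

lemma smooth_form_path_sum:
  assumes "\<And>c. c \<in> C \<Longrightarrow> smooth_form_path M (a c)"
  shows "smooth_form_path M (\<lambda>t i x. \<Sum>c\<in>C. a c t i x)"
proof (rule smooth_form_pathI)
  fix i assume i: "i \<in> index M"
  have "smooth_on ({0..1} \<times> chart_img M i) (\<lambda>z. \<Sum>c\<in>C. (case z of (t, x) \<Rightarrow> a c t i x))"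
    by (intro smooth_on_sum smooth_form_pathD(2) assms i)
  then show "smooth_on ({0..1} \<times> chart_img M i) (\<lambda>(t, x). \<Sum>c\<in>C. a c t i x)"
    by (simp add: case_prod_unfold)
next
  fix t i j x v assume "(t::real) \<in> {0..1}" "i \<in> index M" "j \<in> index M" "x \<in> overlap M i j"
  then show "(\<Sum>c\<in>C. a c t i x) \<bullet> v = (\<Sum>c\<in>C. a c t j (transition M i j x)) \<bullet> D_transition M i j x v"
    unfolding inner_sum_left using one_formD(2)[OF smooth_form_pathD(1)[OF assms]]
    by (intro sum.cong) auto
qed

lemma skew_ext_deriv:
  assumes "f differentiable (at x within S)"
  shows "skew (ext_deriv S f x)"
proof -
  have lin: "linear (frechet_derivative f (at x within S))"
    by (rule linear_frechet_derivative[OF assms])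
  show ?thesis
    unfolding skew_def ext_deriv_def
    by (intro conjI allI linearI)
      (simp_all add: linear_add[OF lin] linear_scale[OF lin] inner_add_left inner_add_right right_diff_distrib)
qed

lemma ext_deriv_add_scaleR:
  assumes S: "thick S" "x \<in> S"
    and a: "a differentiable (at x within S)" and b: "b differentiable (at x within S)"
    and \<phi>: "(\<phi> has_derivative \<phi>') (at x within S)"
  shows "ext_deriv S (\<lambda>x. a x + \<phi> x *\<^sub>R b x) x u v =
    ext_deriv S a x u v + (wedge11 \<phi>' ((\<bullet>) (b x)) u v + \<phi> x * ext_deriv S b x u v)"
proof -
  have "((\<lambda>x. a x + \<phi> x *\<^sub>R b x) has_derivative
      (\<lambda>h. frechet_derivative a (at x within S) h +
        (\<phi> x *\<^sub>R frechet_derivative b (at x within S) h + \<phi>' h *\<^sub>R b x))) (at x within S)"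
    using a b \<phi> by (intro has_derivative_add has_derivative_scaleR) (auto simp flip: frechet_derivative_works)
  from thick_frechet_derivative[OF S this] show ?thesis
    by (simp add: ext_deriv_def wedge11_def inner_add_left algebra_simps)
qed

context manifold4
begin

lemma one_form_differentiable:
  "one_form V a \<Longrightarrow> i \<in> index V \<Longrightarrow> x \<in> chart_img V i \<Longrightarrow> a i differentiable (at x within chart_img V i)"
  by (rule smooth_on_differentiable[OF one_formD(1)])

lemma skew_dform:
  "one_form V a \<Longrightarrow> i \<in> index V \<Longrightarrow> x \<in> chart_img V i \<Longrightarrow> skew (dform V a i x)"
  unfolding dform_def by (intro skew_ext_deriv one_form_differentiable)

text \<open>Naturality of the exterior derivative: the second derivatives of the transition map
  cancel by symmetry.\<close>

lemma dform_transition: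
  assumes a: "one_form V a" and ij: "i \<in> index V" "j \<in> index V" and x: "x \<in> overlap V i j"
  shows "dform V a i x u v =
    dform V a j (transition V i j x) (D_transition V i j x u) (D_transition V i j x v)"
proof -
  let ?A = "overlap V i j" and ?T = "transition V i j" and ?D = "D_transition V i j"
  define ai where "ai = frechet_derivative (a i) (at x within chart_img V i)"
  define aj where "aj = frechet_derivative (a j) (at (?T x) within chart_img V j)"
  define H where "H w = frechet_derivative (\<lambda>y. ?D y w) (at x within ?A)" for w
  have A: "thick ?A" by (rule thick_overlap[OF ij])
  have xi: "x \<in> chart_img V i" using x overlap_subset by blast
  have Tx: "?T x \<in> chart_img V j" by (rule transition_in_img[OF ij(1) x])
  \<comment> \<open>The transformation law of \<open>a\<close>, evaluated on a fixed
    \<open>w\<close> and differentiated in direction \<open>u\<close>. The term with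
    \<open>H\<close>, the second derivative of the transition map, is the one that cancels after
    antisymmetrising.\<close>
  have key: "ai u \<bullet> w = aj (?D x u) \<bullet> ?D x w + a j (?T x) \<bullet> H w u" for u w
  proof -
    have "(a i has_derivative ai) (at x within ?A)"
      unfolding ai_def
      by (rule has_derivative_subset[OF smooth_on_has_derivative[OF one_formD(1)[OF a ij(1)] xi] overlap_subset])
    from bounded_linear.has_derivative[OF bounded_linear_inner_left this]
    have 1: "((\<lambda>y. a i y \<bullet> w) has_derivative (\<lambda>u. ai u \<bullet> w)) (at x within ?A)" .
    have "(a j has_derivative aj) (at (?T x) within ?T ` ?A)"
      unfolding aj_def
      by (rule has_derivative_subset[OF smooth_on_has_derivative[OF one_formD(1)[OF a ij(2)] Tx]])
        (use transition_in_img ij in auto)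
    from diff_chain_within[OF transition_has_derivative[OF ij x] this]
    have 2: "((\<lambda>y. a j (?T y)) has_derivative (\<lambda>u. aj (?D x u))) (at x within ?A)"
      by (simp add: o_def)
    have "smooth_on ?A (\<lambda>y. ?D y w)"
      unfolding D_transition_def by (rule smooth_on_frechet_derivative[OF smooth_transition[OF ij] A])
    then have 3: "((\<lambda>y. ?D y w) has_derivative H w) (at x within ?A)"
      unfolding H_def by (rule smooth_on_has_derivative[OF _ x])
    from has_derivative_inner[OF 2 3]
    have "((\<lambda>y. a j (?T y) \<bullet> ?D y w) has_derivative
        (\<lambda>u. a j (?T x) \<bullet> H w u + aj (?D x u) \<bullet> ?D x w)) (at x within ?A)" .
    then have "((\<lambda>y. a i y \<bullet> w) has_derivative
        (\<lambda>u. a j (?T x) \<bullet> H w u + aj (?D x u) \<bullet> ?D x w)) (at x within ?A)"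
      by (rule has_derivative_transform_within[OF _ zero_less_one x])
        (simp add: one_formD(2)[OF a ij])
    from fun_cong[OF thick_unique[OF A x 1 this], of u] show ?thesis by simp
  qed
  have "H w u = H u w" for u w
    using symmetric_second_derivative_within[OF smooth_transition[OF ij] A x]
    unfolding H_def D_transition_def by blast
  then show ?thesis
    unfolding dform_def ext_deriv_def ai_def[symmetric] aj_def[symmetric] key by simp
qed

lemma boundary_restrict_inner: "boundary_restrict a i y \<bullet> v = a i (bd_incl y) \<bullet> bd_incl v"
  by (simp add: boundary_restrict_def bd_proj_inner)

text \<open>At the boundary the transition map and its derivative preserve vanishing of the first
  coordinate, so projecting to three coordinates and including back loses nothing.\<close>

lemma one_form_boundary_restrict:
  assumes a: "one_form V a"
  shows "one_form (boundary V) (boundary_restrict a)"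
proof -
  have "smooth_on (chart_img (boundary V) i) (boundary_restrict a i)" if i: "i \<in> index V" for i
  proof -
    have "smooth_on (chart_img (boundary V) i) (\<lambda>y. a i (bd_incl y))"
      by (rule smooth_on_compose[OF smooth_on_linear[OF bounded_linear_bd_incl] one_formD(1)[OF a i]])
        (auto simp: boundary_chart_img[OF i])
    from smooth_on_compose_linear[OF bounded_linear_bd_proj this]
    show ?thesis by (simp add: boundary_restrict_def[abs_def])
  qed
  moreover have "boundary_restrict a i y \<bullet> v =
      boundary_restrict a j (transition (boundary V) i j y) \<bullet> D_transition (boundary V) i j y v"
    if ij: "i \<in> index V" "j \<in> index V" and y: "y \<in> overlap (boundary V) i j" for i j y v
  proof -
    have x: "bd_incl y \<in> overlap V i j" using y boundary_overlap[OF ij(1)] by auto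
    have "transition V i j (bd_incl y) $ 1 = 0" "D_transition V i j (bd_incl y) (bd_incl v) $ 1 = 0"
      using transition_boundary[OF ij x] D_transition_tangential[OF ij x] by auto
    then show ?thesis
      using one_formD(2)[OF a ij x, of "bd_incl v"]
      by (simp add: boundary_restrict_inner boundary_transition[OF ij(1) x] boundary_D_transition[OF ij x]
          bd_incl_proj)
  qed
  ultimately show ?thesis by (auto simp: one_form_def)
qed

text \<open>The inclusion of the boundary is linear in charts, so restriction and differentiation
  commute.\<close>

lemma ext_deriv_boundary_restrict:
  assumes a: "one_form V a" and i: "i \<in> index V" and y: "y \<in> chart_img (boundary V) i"
  shows "ext_deriv (chart_img (boundary V) i) (boundary_restrict a i) y u v =
    dform V a i (bd_incl y) (bd_incl u) (bd_incl v)"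
proof -
  define a' where "a' = frechet_derivative (a i) (at (bd_incl y) within chart_img V i)"
  have x: "bd_incl y \<in> chart_img V i" using y boundary_chart_img[OF i] by auto
  have "(a i has_derivative a') (at (bd_incl y) within chart_img V i)"
    unfolding a'_def by (rule smooth_on_has_derivative[OF one_formD(1)[OF a i] x])
  from boundary_restriction_has_derivative[OF this]
  have "(boundary_restrict a i has_derivative (\<lambda>v. bd_proj (a' (bd_incl v))))
      (at y within chart_img (boundary V) i)"
    unfolding boundary_chart_img[OF i] boundary_restrict_def .
  from thick_frechet_derivative[OF thick_open[OF boundary_chart_img_open[OF i]] y this]
  show ?thesis by (simp add: ext_deriv_def dform_def a'_def bd_proj_inner)
qed

lemma scalar_function_transition:
  assumes f: "scalar_function V f" and ij: "i \<in> index V" "j \<in> index V" and x: "x \<in> overlap V i j"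
  shows "frechet_derivative (f i) (at x within chart_img V i) v =
    frechet_derivative (f j) (at (transition V i j x) within chart_img V j) (D_transition V i j x v)"
proof -
  let ?A = "overlap V i j" and ?D = "D_transition V i j x"
  let ?fi = "frechet_derivative (f i) (at x within chart_img V i)"
  let ?fj = "frechet_derivative (f j) (at (transition V i j x) within chart_img V j)"
  have sm: "smooth_on (chart_img V i) (f i)" "smooth_on (chart_img V j) (f j)"
    using f ij by (auto simp: scalar_function_def)
  have xi: "x \<in> chart_img V i" using x overlap_subset by blast
  have Tx: "transition V i j x \<in> chart_img V j" by (rule transition_in_img[OF ij(1) x])
  have 1: "(f i has_derivative ?fi) (at x within ?A)"
    by (rule has_derivative_subset[OF smooth_on_has_derivative[OF sm(1) xi] overlap_subset])
  have "(f j has_derivative ?fj) (at (transition V i j x) within transition V i j ` ?A)"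
    by (rule has_derivative_subset[OF smooth_on_has_derivative[OF sm(2) Tx]])
      (use transition_in_img ij in auto)
  from diff_chain_within[OF transition_has_derivative[OF ij x] this]
  have "((\<lambda>y. f j (transition V i j y)) has_derivative (\<lambda>v. ?fj (?D v))) (at x within ?A)"
    by (simp add: o_def)
  then have "(f i has_derivative (\<lambda>v. ?fj (?D v))) (at x within ?A)"
    by (rule has_derivative_transform_within[OF _ zero_less_one x])
      (use f ij in \<open>auto simp: scalar_function_def\<close>)
  from fun_cong[OF thick_unique[OF thick_overlap[OF ij] x 1 this]] show ?thesis .
qed

section \<open>Extension by zero of data supported in one chart\<close>

lemma chart_preimage_closed:
  assumes i: "i \<in> index V" and K: "compact K" "K \<subseteq> chart_img V i"
  shows "closedin (top_of V) {p \<in> chart_dom V i. chart V i p \<in> K}"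
proof -
  let ?P = "{p \<in> chart_dom V i. chart V i p \<in> K}"
  have "chart V i ` ?P = K" using K(2) by (auto simp: chart_img_def)
  moreover have "compactin (top_of_set (chart_img V i)) K"
    using K by (simp add: compactin_subtopology)
  ultimately have "compactin (subtopology (top_of V) (chart_dom V i)) ?P"
    using homeomorphic_map_compactness[OF chart_homeo[OF i], of ?P] topspace_chart_dom[OF i] by auto
  then have "compactin (top_of V) ?P" by (simp add: compactin_subtopology)
  \<comment> \<open>The Hausdorff property enters here: compact subsets of V are closed.\<close>
  then show ?thesis
    using oriented compactin_imp_closedin by (auto simp: oriented_manifold_def)
qed

text \<open>The image of chart \<open>j\<close> is covered by two relatively open pieces: the
  overlap with chart \<open>i\<close>, and the complement \<open>chart_img V j - Z\<close> of the
  part that comes from \<open>K\<close>. On the second piece the function is zero; its openness is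
  \<open>chart_preimage_closed\<close>.\<close>

lemma smooth_on_extend_by_zero:
  assumes ij: "i \<in> index V" "j \<in> index V" and K: "compact K" "K \<subseteq> chart_img V i"
    and G: "smooth_on ({0..1} \<times> overlap V j i) (\<lambda>(t, x). G t x)"
    and zero: "\<And>t x. t \<in> {0..1} \<Longrightarrow> x \<in> overlap V j i \<Longrightarrow> transition V j i x \<notin> K \<Longrightarrow> G t x = 0"
  shows "smooth_on ({0..1::real} \<times> chart_img V j) (\<lambda>(t, x). if x \<in> overlap V j i then G t x else 0)"
proof -
  define Z where "Z = {x \<in> overlap V j i. transition V j i x \<in> K}"
  let ?P = "{p \<in> chart_dom V i. chart V i p \<in> K}"
  have img: "chart V j ` (chart_dom V j - ?P) = chart_img V j - Z"
  proof (intro set_eqI iffI)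
    fix x assume "x \<in> chart V j ` (chart_dom V j - ?P)"
    then obtain p where p: "p \<in> chart_dom V j" "p \<notin> ?P" "x = chart V j p" by auto
    then have "x \<notin> Z"
      using inj_chart[OF ij(2)] transition_chart[OF ij(2) p(1), of i]
      by (auto simp: Z_def overlap_def inj_on_def)
    then show "x \<in> chart_img V j - Z" using p by (auto simp: chart_img_def)
  next
    fix x assume x: "x \<in> chart_img V j - Z"
    then obtain p where p: "p \<in> chart_dom V j" "x = chart V j p" by (auto simp: chart_img_def)
    then have "p \<notin> ?P" using x transition_chart[OF ij(2) p(1), of i] by (auto simp: Z_def overlap_def)
    then show "x \<in> chart V j ` (chart_dom V j - ?P)" using p by auto
  qed
  have "openin (top_of V) (chart_dom V j - ?P)"
    by (intro openin_diff chart_dom_open ij chart_preimage_closed K)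
  then have "openin (subtopology (top_of V) (chart_dom V j)) (chart_dom V j - ?P)"
    using chart_dom_open[OF ij(2)] by (auto simp: openin_open_subtopology)
  then have open2: "openin (top_of_set (chart_img V j)) (chart_img V j - Z)"
    using homeomorphic_imp_open_map[OF chart_homeo[OF ij(2)]] unfolding open_map_def img[symmetric] by blast
  have open1: "openin (top_of_set (chart_img V j)) (overlap V j i)"
    using openin_subset_trans[OF overlap_open[OF ij(2,1)] overlap_subset] openin_imp_subset[OF chart_img_open[OF ij(2)]]
    by blast
  let ?F = "\<lambda>(t::real, x). if x \<in> overlap V j i then G t x else 0"
  have un: "{0..1::real} \<times> chart_img V j = {0..1} \<times> overlap V j i \<union> {0..1} \<times> (chart_img V j - Z)"
    using overlap_subset by (auto simp: Z_def)
  show ?thesis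
    unfolding un
  proof (rule smooth_on_openin_Un)
    show "smooth_on ({0..1} \<times> overlap V j i) ?F" by (rule smooth_on_cong[OF G]) auto
    show "smooth_on ({0..1} \<times> (chart_img V j - Z)) ?F"
    proof (rule smooth_on_cong[OF smooth_on_const[of _ 0]])
      fix z assume "z \<in> {0..1::real} \<times> (chart_img V j - Z)"
      then show "0 = ?F z" using zero[of "fst z" "snd z"] by (auto simp: Z_def split: if_splits) blast
    qed
  qed (use open1 open2 in \<open>auto simp flip: un intro!: openin_Times\<close>)
qed

definition spread_function :: "'i \<Rightarrow> (real ^ 4 \<Rightarrow> real) \<Rightarrow> 'i \<Rightarrow> real ^ 4 \<Rightarrow> real" where
  "spread_function i b j x = (if x \<in> overlap V j i then b (transition V j i x) else 0)"

text \<open>The pullback of the covector \<open>B\<close> along the transition map. The transposed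
  derivative is written out in the basis, so that smoothness reduces to that of
  \<open>D_transition\<close> in fixed directions.\<close>

definition spread_form :: "'i \<Rightarrow> (real ^ 4 \<Rightarrow> real ^ 4) \<Rightarrow> 'i \<Rightarrow> real ^ 4 \<Rightarrow> real ^ 4" where
  "spread_form i B j x = (if x \<in> overlap V j i
     then \<Sum>e\<in>Basis. (B (transition V j i x) \<bullet> D_transition V j i x e) *\<^sub>R e else 0)"

lemma spread_form_inner:
  assumes "i \<in> index V" "j \<in> index V"
  shows "spread_form i B j x \<bullet> v =
    (if x \<in> overlap V j i then B (transition V j i x) \<bullet> D_transition V j i x v else 0)"
proof (cases "x \<in> overlap V j i")
  case True
  have lin: "linear (\<lambda>v. B (transition V j i x) \<bullet> D_transition V j i x v)"
    using linear_D_transition[OF assms(2,1) True]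
    by (auto intro!: linearI simp: linear_add linear_scale inner_add_right)
  have "spread_form i B j x \<bullet> v = (\<Sum>e\<in>Basis. (v \<bullet> e) * (B (transition V j i x) \<bullet> D_transition V j i x e))"
    using True by (simp add: spread_form_def inner_sum_left) (simp add: mult.commute inner_commute)
  also have "\<dots> = B (transition V j i x) \<bullet> D_transition V j i x (\<Sum>e\<in>Basis. (v \<bullet> e) *\<^sub>R e)"
    unfolding linear_sum[OF lin] by (simp add: linear_scale[OF lin])
  finally show ?thesis using True by (simp only: euclidean_representation if_True)
qed (simp add: spread_form_def)

lemma spread_function_scalar:
  assumes i: "i \<in> index V" and K: "compact K" "K \<subseteq> chart_img V i"
    and b: "smooth_on (chart_img V i) b" "\<And>x. x \<in> chart_img V i \<Longrightarrow> x \<notin> K \<Longrightarrow> b x = 0"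
  shows "scalar_function V (spread_function i b)"
proof -
  have "smooth_on (chart_img V j) (spread_function i b j)" if j: "j \<in> index V" for j
  proof -
    have "smooth_on (overlap V j i) (\<lambda>x. b (transition V j i x))"
      by (rule smooth_on_compose[OF smooth_transition[OF j i] b(1)]) (use transition_in_img j in auto)
    then have "smooth_on ({0..1::real} \<times> chart_img V j)
        (\<lambda>(t, x). if x \<in> overlap V j i then b (transition V j i x) else 0)"
      by (intro smooth_on_extend_by_zero[OF i j K] smooth_on_snd)
        (use b transition_in_img j in auto)
    from smooth_on_slice[OF this, of 0] show ?thesis by (simp add: spread_function_def[abs_def])
  qed
  moreover have "spread_function i b j x = spread_function i b k (transition V j k x)"
    if "j \<in> index V" "k \<in> index V" "x \<in> overlap V j k" for j k x
    unfolding spread_function_def using transition_trans[OF that, of i] by simp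
  ultimately show ?thesis by (simp add: scalar_function_def)
qed

text \<open>Smoothness is extension by zero; compatibility between charts is functoriality of
  pullbacks, that is, \<open>D_transition_trans\<close>.\<close>

lemma spread_form_path:
  assumes i: "i \<in> index V" and K: "compact K" "K \<subseteq> chart_img V i"
    and B: "smooth_on ({0..1} \<times> chart_img V i) (\<lambda>(t, x). B t x)"
      "\<And>t x. t \<in> {0..1} \<Longrightarrow> x \<in> chart_img V i \<Longrightarrow> x \<notin> K \<Longrightarrow> B t x = 0"
  shows "smooth_form_path V (\<lambda>t. spread_form i (B t))"
proof (rule smooth_form_pathI)
  fix j assume j: "j \<in> index V"
  let ?A = "{0..1::real} \<times> overlap V j i"
  have T: "smooth_on ?A (\<lambda>(t, x). transition V j i x)"
    by (rule smooth_on_snd[OF smooth_transition[OF j i]])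
  have "smooth_on ?A (\<lambda>z. (fst z, (case z of (t, x) \<Rightarrow> transition V j i x)))"
    by (intro smooth_on_Pair T smooth_on_linear[OF bounded_linear_fst])
  then have "smooth_on ?A (\<lambda>z. (case (fst z, (case z of (t, x) \<Rightarrow> transition V j i x)) of (t, x) \<Rightarrow> B t x))"
    by (rule smooth_on_compose[OF _ B(1)]) (use transition_in_img j in auto)
  then have BT: "smooth_on ?A (\<lambda>(t, x). B t (transition V j i x))" by (simp add: case_prod_unfold)
  have D: "smooth_on ?A (\<lambda>(t, x). D_transition V j i x e)" for e
    unfolding D_transition_def
    by (rule smooth_on_snd[OF smooth_on_frechet_derivative[OF smooth_transition[OF j i] thick_overlap[OF j i]]])
  have "smooth_on ?A (\<lambda>z. \<Sum>e\<in>Basis. ((case z of (t, x) \<Rightarrow> B t (transition V j i x)) \<bullet>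
      (case z of (t, x) \<Rightarrow> D_transition V j i x e)) *\<^sub>R e)"
    by (intro smooth_on_sum smooth_on_scaleR smooth_on_inner BT D smooth_on_const)
  then have "smooth_on ?A (\<lambda>(t, x). \<Sum>e\<in>Basis. (B t (transition V j i x) \<bullet> D_transition V j i x e) *\<^sub>R e)"
    by (simp add: case_prod_unfold)
  from smooth_on_extend_by_zero[OF i j K this]
  show "smooth_on ({0..1} \<times> chart_img V j) (\<lambda>(t, x). spread_form i (B t) j x)"
    unfolding spread_form_def using B(2) transition_in_img j by auto
next
  fix t :: real and j k x v
  assume jk: "j \<in> index V" "k \<in> index V" and x: "x \<in> overlap V j k"
  show "spread_form i (B t) j x \<bullet> v =
      spread_form i (B t) k (transition V j k x) \<bullet> D_transition V j k x v"
    unfolding spread_form_inner[OF i jk(1)] spread_form_inner[OF i jk(2)]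
    using transition_trans[OF jk x] D_transition_trans[OF jk i x] by auto
qed

end

section \<open>Defining function and contact forms\<close>

text \<open>The squared distance is used because it is smooth at the centre too.\<close>

definition bump :: "'a::euclidean_space \<Rightarrow> real \<Rightarrow> 'a \<Rightarrow> real" where
  "bump z e x = flat 0 (e\<^sup>2 - (x - z) \<bullet> (x - z))"

lemma bump_nonneg: "bump z e x \<ge> 0"
  by (simp add: bump_def flat_nonneg)

lemma dist_square_less_iff: "e > 0 \<Longrightarrow> (x - z) \<bullet> (x - z) < e\<^sup>2 \<longleftrightarrow> x \<in> ball z e"
  by (metis dist_commute dist_norm less_imp_le mem_ball norm_ge_zero power2_norm_eq_inner power_less_imp_less_base
      power_strict_mono zero_less_numeral)

lemma bump_pos: "e > 0 \<Longrightarrow> x \<in> ball z e \<Longrightarrow> bump z e x > 0"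
  by (simp add: bump_def flat_pos dist_square_less_iff flip: mem_ball)

lemma bump_eq_0: "e > 0 \<Longrightarrow> x \<notin> ball z e \<Longrightarrow> bump z e x = 0"
  using dist_square_less_iff[of e x z] by (simp add: bump_def flat_eq_0 flip: mem_ball)

lemma smooth_on_bump: "smooth_on S (bump z e)"
proof -
  have id: "smooth_on S (\<lambda>x. x)" by (rule smooth_on_linear[OF bounded_linear_ident])
  have "smooth_on S (\<lambda>x. e\<^sup>2 + (- 1) * ((x + (- z)) \<bullet> (x + (- z))))"
    by (intro smooth_on_add smooth_on_mult smooth_on_inner smooth_on_const id)
  from smooth_on_compose[OF this smooth_on_flat[of UNIV 0]] show ?thesis
    by (simp add: bump_def[abs_def])
qed

lemma scalar_function_sum:
  "(\<And>c. c \<in> C \<Longrightarrow> scalar_function M (f c)) \<Longrightarrow> scalar_function M (\<lambda>i x. \<Sum>c\<in>C. f c i x)"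
  unfolding scalar_function_def by (auto intro!: smooth_on_sum sum.cong)

context manifold4
begin

text \<open>The half-balls of radius \<open>\<epsilon> c / 2\<close>, which carry the bump
  functions, already cover; the larger closed half-balls are compact in the chart and leave room for
  gluing with zero. Balls with centre off the boundary avoid it, so only balls centred on the
  boundary matter there.\<close>

definition ball_cover :: "'a set \<Rightarrow> ('a \<Rightarrow> 'i) \<Rightarrow> ('a \<Rightarrow> real ^ 4) \<Rightarrow> ('a \<Rightarrow> real) \<Rightarrow> bool" where
  "ball_cover C \<iota> z \<epsilon> \<longleftrightarrow> finite C \<and>
     (\<forall>c\<in>C. \<iota> c \<in> index V \<and> \<epsilon> c > 0 \<and>
        cball (z c) (\<epsilon> c) \<inter> half_space4 \<subseteq> chart_img V (\<iota> c) \<and>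
        (z c $ 1 \<noteq> 0 \<longrightarrow> (\<forall>x\<in>cball (z c) (\<epsilon> c). x $ 1 < 0))) \<and>
     (\<forall>j\<in>index V. \<forall>x\<in>chart_img V j.
        \<exists>c\<in>C. x \<in> overlap V j (\<iota> c) \<and> transition V j (\<iota> c) x \<in> ball (z c) (\<epsilon> c / 2))"

lemma ball_coverD:
  assumes "ball_cover C \<iota> z \<epsilon>"
  shows "finite C" "\<And>c. c \<in> C \<Longrightarrow> \<iota> c \<in> index V" "\<And>c. c \<in> C \<Longrightarrow> \<epsilon> c > 0"
    "\<And>c. c \<in> C \<Longrightarrow> cball (z c) (\<epsilon> c) \<inter> half_space4 \<subseteq> chart_img V (\<iota> c)"
    "\<And>c x. c \<in> C \<Longrightarrow> z c $ 1 \<noteq> 0 \<Longrightarrow> x \<in> cball (z c) (\<epsilon> c) \<Longrightarrow> x $ 1 < 0"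
    "\<And>j x. j \<in> index V \<Longrightarrow> x \<in> chart_img V j \<Longrightarrow>
      \<exists>c\<in>C. x \<in> overlap V j (\<iota> c) \<and> transition V j (\<iota> c) x \<in> ball (z c) (\<epsilon> c / 2)"
  using assms unfolding ball_cover_def by blast+

lemma finite_ball_cover:
  assumes "compact_space (top_of V)"
  obtains C \<iota> z \<epsilon> where "ball_cover C \<iota> z \<epsilon>"
proof -
  define P where "P p i e \<longleftrightarrow> i \<in> index V \<and> p \<in> chart_dom V i \<and> e > 0 \<and>
      cball (chart V i p) e \<inter> half_space4 \<subseteq> chart_img V i \<and>
      (chart V i p $ 1 \<noteq> 0 \<longrightarrow> (\<forall>x\<in>cball (chart V i p) e. x $ 1 < 0))" for p i and e :: real
  have "\<exists>i e. P p i e" if p: "p \<in> topspace (top_of V)" for p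
  proof -
    have "topspace (top_of V) = (\<Union>i\<in>index V. chart_dom V i)"
      using oriented by (simp add: oriented_manifold_def)
    then obtain i where i: "i \<in> index V" "p \<in> chart_dom V i" using p by auto
    let ?z = "chart V i p"
    have z: "?z \<in> chart_img V i" using i by (auto simp: chart_img_def)
    obtain U where U: "open U" "chart_img V i = half_space4 \<inter> U"
      using chart_img_open[OF i(1)] by (auto simp: openin_open)
    have "?z \<in> U" using U z by simp
    then obtain d where d: "d > 0" "cball ?z d \<subseteq> U" using open_contains_cball_eq[OF U(1)] by blast
    show ?thesis
    proof (cases "?z $ 1 = 0")
      case True
      then have "P p i d" using i d U by (auto simp: P_def)
      then show ?thesis by blast
    next
      case False
      then have neg: "?z $ 1 < 0" using chart_img_nonpos[OF i(1) z] by simp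
      \<comment> \<open>At most half the distance from the centre to the boundary
        hyperplane.\<close>
      define e where "e = min d (- (?z $ 1) / 2)"
      have "x $ 1 < 0" if "x \<in> cball ?z e" for x
      proof -
        have "\<bar>(x - ?z) $ 1\<bar> \<le> norm (x - ?z)" by (rule component_le_norm_cart)
        also have "\<dots> \<le> e" using that by (simp add: dist_norm norm_minus_commute)
        also have "\<dots> \<le> - (?z $ 1) / 2" by (simp add: e_def)
        finally show ?thesis using neg by simp
      qed
      moreover have "cball ?z e \<subseteq> U" using d(2) by (auto simp: e_def)
      moreover have "e > 0" using d neg by (simp add: e_def)
      ultimately have "P p i e" using i U(2) by (auto simp: P_def)
      then show ?thesis by blast
    qed
  qed
  then obtain \<iota> \<epsilon> where \<iota>: "\<And>p. p \<in> topspace (top_of V) \<Longrightarrow> P p (\<iota> p) (\<epsilon> p)" by metis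
  define z where "z p = chart V (\<iota> p) p" for p
  define W where "W p = {q \<in> chart_dom V (\<iota> p). chart V (\<iota> p) q \<in> ball (z p) (\<epsilon> p / 2)}" for p
  have Wopen: "openin (top_of V) (W p)" if "p \<in> topspace (top_of V)" for p
  proof -
    have i: "\<iota> p \<in> index V" using \<iota>[OF that] by (auto simp: P_def)
    have "continuous_map (subtopology (top_of V) (chart_dom V (\<iota> p))) (top_of_set (chart_img V (\<iota> p))) (chart V (\<iota> p))"
      using homeomorphic_imp_continuous_map[OF chart_homeo[OF i]] .
    then have "continuous_map (subtopology (top_of V) (chart_dom V (\<iota> p))) euclidean (chart V (\<iota> p))"
      by (simp add: continuous_map_in_subtopology)
    from openin_continuous_map_preimage[OF this, of "ball (z p) (\<epsilon> p / 2)"]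
    have "openin (subtopology (top_of V) (chart_dom V (\<iota> p))) (W p)"
      unfolding topspace_chart_dom[OF i] W_def by simp
    then show ?thesis using chart_dom_open[OF i] by (simp add: openin_open_subtopology)
  qed
  moreover have "topspace (top_of V) \<subseteq> \<Union> (W ` topspace (top_of V))"
    using \<iota> by (fastforce simp: W_def P_def z_def)
  ultimately have "\<exists>F. finite F \<and> F \<subseteq> W ` topspace (top_of V) \<and> topspace (top_of V) \<subseteq> \<Union> F"
    using spec[OF assms[unfolded compact_space_alt], of "W ` topspace (top_of V)"] by simp
  then obtain F where F: "finite F" "F \<subseteq> W ` topspace (top_of V)" "topspace (top_of V) \<subseteq> \<Union> F"
    by blast
  then obtain C where C: "finite C" "C \<subseteq> topspace (top_of V)" "F = W ` C"
    using finite_subset_image by metis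
  have "\<exists>c\<in>C. x \<in> overlap V j (\<iota> c) \<and> transition V j (\<iota> c) x \<in> ball (z c) (\<epsilon> c / 2)"
    if j: "j \<in> index V" and x: "x \<in> chart_img V j" for j x
  proof -
    obtain p where p: "p \<in> chart_dom V j" "x = chart V j p" using x by (auto simp: chart_img_def)
    then obtain c where c: "c \<in> C" "p \<in> W c" using F(3) C(3) chart_dom_subset[OF j] by blast
    then have "x \<in> overlap V j (\<iota> c)" using p overlapI by (auto simp: W_def)
    moreover have "transition V j (\<iota> c) x \<in> ball (z c) (\<epsilon> c / 2)"
      using c p transition_chart[OF j] by (auto simp: W_def)
    ultimately show ?thesis using c by blast
  qed
  moreover have "P c (\<iota> c) (\<epsilon> c)" if "c \<in> C" for c using \<iota> C(2) that by blast
  ultimately have "ball_cover C \<iota> z \<epsilon>"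
    using C(1) unfolding ball_cover_def P_def z_def[symmetric] by blast
  then show ?thesis by (rule that)
qed

lemma compact_half_ball: "compact (cball z e \<inter> half_space4)"
proof -
  have "closed half_space4" unfolding half_space4_def by (rule closed_halfspace_component_le_cart)
  then show ?thesis by (rule compact_Int_closed[OF compact_cball])
qed

lemma transition_boundary_iff:
  assumes "i \<in> index V" "j \<in> index V" "x \<in> overlap V i j"
  shows "transition V i j x $ 1 = 0 \<longleftrightarrow> x $ 1 = 0"
  using transition_boundary[OF assms] transition_boundary[OF assms(2,1) transition_in_overlap[OF assms(1,3)]]
    transition_inverse[OF assms] by metis

definition defining_function :: "('i \<Rightarrow> real ^ 4 \<Rightarrow> real) \<Rightarrow> bool" where
  "defining_function r \<longleftrightarrow> scalar_function V r \<and>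
     (\<forall>i\<in>index V. \<forall>x\<in>chart_img V i. r i x \<le> 0 \<and> (r i x = 0 \<longleftrightarrow> x $ 1 = 0) \<and>
        (x $ 1 = 0 \<longrightarrow> (\<exists>\<kappa>>0. \<forall>v. frechet_derivative (r i) (at x within chart_img V i) v = \<kappa> * v $ 1)))"

text \<open>In each chart of the cover the first coordinate is a local defining function. Multiplied
  by bumps and summed, all terms have the same sign, so neither their zeros nor their normal
  derivatives can cancel.\<close>

lemma boundary_defining_function:
  assumes "compact_space (top_of V)"
  obtains r where "defining_function r"
proof -
  obtain C \<iota> z \<epsilon> where "ball_cover C \<iota> z \<epsilon>"
    using finite_ball_cover[OF assms] .
  note C = ball_coverD(1-5)[OF this] and cover = ball_coverD(6)[OF this]
  define b where "b c = bump (z c) (\<epsilon> c / 2)" for c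
  define s where "s c = spread_function (\<iota> c) (\<lambda>x. b c x * x $ 1)" for c
  define r where "r j x = (\<Sum>c\<in>C. s c j x)" for j x
  have s_scalar: "scalar_function V (s c)" if c: "c \<in> C" for c
    unfolding s_def
  proof (rule spread_function_scalar[OF C(2)[OF c] compact_half_ball])
    show "cball (z c) (\<epsilon> c / 2) \<inter> half_space4 \<subseteq> chart_img V (\<iota> c)"
      using C(4)[OF c] C(3)[OF c] by (auto simp: subset_eq)
    show "smooth_on (chart_img V (\<iota> c)) (\<lambda>x. b c x * x $ 1)"
      unfolding b_def by (intro smooth_on_mult smooth_on_bump smooth_on_linear bounded_linear_vec_nth)
    show "b c x * x $ 1 = 0" if "x \<in> chart_img V (\<iota> c)" "x \<notin> cball (z c) (\<epsilon> c / 2) \<inter> half_space4" for x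
    proof -
      have "x \<in> half_space4" using that chart_img_nonpos[OF C(2)[OF c]] by (simp add: half_space4_def)
      then show ?thesis using that bump_eq_0[of "\<epsilon> c / 2" x "z c"] C(3)[OF c] by (auto simp: b_def)
    qed
  qed
  have r_scalar: "scalar_function V r"
    unfolding r_def[abs_def] by (rule scalar_function_sum[OF s_scalar])
  have s_le: "s c j x \<le> 0" if "c \<in> C" "j \<in> index V" for c j x
    using chart_img_nonpos[OF C(2)[OF that(1)]] transition_in_img[OF that(2)] bump_nonneg
    by (auto simp: s_def spread_function_def b_def intro!: mult_nonneg_nonpos)
  \<comment> \<open>Lets the zero set and the normal derivative of \<open>r\<close> be read off from
    one summand whose bump is positive at the point.\<close>
  have r_le: "r j x \<le> s c j x" if "c \<in> C" "j \<in> index V" for c j x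
  proof -
    have "r j x = s c j x + (\<Sum>c\<in>C - {c}. s c j x)" unfolding r_def by (rule sum.remove[OF C(1) that(1)])
    moreover have "(\<Sum>c\<in>C - {c}. s c j x) \<le> 0" using s_le that by (intro sum_nonpos) auto
    ultimately show ?thesis by linarith
  qed
  have s_0: "s c j x = 0" if "c \<in> C" "j \<in> index V" "x $ 1 = 0" for c j x
    using transition_boundary[OF that(2) C(2)[OF that(1)] _ that(3)] by (simp add: s_def spread_function_def)
  have "defining_function r"
    unfolding defining_function_def
  proof (intro conjI ballI impI r_scalar)
    fix i x assume i: "i \<in> index V" and x: "x \<in> chart_img V i"
    obtain c where c: "c \<in> C" "x \<in> overlap V i (\<iota> c)" "transition V i (\<iota> c) x \<in> ball (z c) (\<epsilon> c / 2)"
      using cover[OF i x] by blast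
    let ?y = "transition V i (\<iota> c) x"
    have y: "?y \<in> chart_img V (\<iota> c)" using transition_in_img[OF i c(2)] .
    have bpos: "b c ?y > 0" unfolding b_def using c C(3) by (intro bump_pos) auto
    show "r i x \<le> 0" unfolding r_def using s_le i by (intro sum_nonpos) auto
    show "r i x = 0 \<longleftrightarrow> x $ 1 = 0"
    proof
      assume "r i x = 0"
      then have "s c i x = 0" using r_le[OF c(1) i, of x] s_le[OF c(1) i, of x] by simp
      then have "?y $ 1 = 0" using bpos c(2) by (auto simp: s_def spread_function_def)
      then show "x $ 1 = 0" using transition_boundary_iff[OF i C(2)[OF c(1)] c(2)] by simp
    next
      assume "x $ 1 = 0"
      then show "r i x = 0" using s_0 i by (simp add: r_def)
    qed
    assume x1: "x $ 1 = 0"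
    let ?r' = "frechet_derivative (r i) (at x within chart_img V i)"
    let ?s' = "frechet_derivative (s c i) (at x within chart_img V i)"
    have dr: "(r i has_derivative ?r') (at x within chart_img V i)"
      using r_scalar i by (intro smooth_on_has_derivative x) (auto simp: scalar_function_def)
    have ds: "(s c i has_derivative ?s') (at x within chart_img V i)"
      using s_scalar[OF c(1)] i by (intro smooth_on_has_derivative x) (auto simp: scalar_function_def)
    \<comment> \<open>The difference of \<open>r\<close> and its summand is nonpositive and vanishes
      at \<open>x\<close>, so it has a maximum there.\<close>
    have "?r' (axis 1 1) - ?s' (axis 1 1) \<ge> 0"
      by (rule half_space4_normal_derivative[OF chart_img_open[OF i] x has_derivative_diff[OF dr ds]])
        (use r_le[OF c(1) i] s_0[OF _ i x1] c(1) in \<open>simp add: r_def\<close>)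
    moreover have "?s' (axis 1 1) > 0"
    proof -
      have y1: "?y $ 1 = 0" by (rule transition_boundary[OF i C(2)[OF c(1)] c(2) x1])
      have "b c differentiable (at ?y within chart_img V (\<iota> c))"
        unfolding b_def by (rule smooth_on_differentiable[OF smooth_on_bump y])
      then obtain b' where b': "(b c has_derivative b') (at ?y within chart_img V (\<iota> c))"
        by (auto simp: differentiable_def)
      have "((\<lambda>x. x $ 1) has_derivative (\<lambda>v. v $ 1)) (at ?y within chart_img V (\<iota> c))"
        by (rule bounded_linear_imp_has_derivative[OF bounded_linear_vec_nth])
      \<comment> \<open>The first coordinate vanishes at \<open>?y\<close>, so the derivative of the
        bump drops out of the product rule.\<close>
      from has_derivative_mult[OF b' this]
      have "((\<lambda>x. b c x * x $ 1) has_derivative (\<lambda>v. b c ?y * v $ 1)) (at ?y within chart_img V (\<iota> c))"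
        using y1 by simp
      then have "(s c (\<iota> c) has_derivative (\<lambda>v. b c ?y * v $ 1)) (at ?y within chart_img V (\<iota> c))"
        by (rule has_derivative_transform_within[OF _ zero_less_one y])
          (simp add: s_def spread_function_def overlap_self transition_self C(2)[OF c(1)])
      from thick_frechet_derivative[OF thick_chart_img[OF C(2)[OF c(1)]] y this]
      have "?s' (axis 1 1) = b c ?y * D_transition V i (\<iota> c) x (axis 1 1) $ 1"
        using scalar_function_transition[OF s_scalar[OF c(1)] i C(2)[OF c(1)] c(2)] by simp
      then show ?thesis using bpos D_transition_normal[OF i C(2)[OF c(1)] c(2) x1] by simp
    qed
    ultimately have \<kappa>: "?r' (axis 1 1) > 0" by linarith
    have "?r' v = ?r' (axis 1 1) * v $ 1" for v
    proof -
      have "?r' (v - v $ 1 *\<^sub>R axis 1 1) = 0"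
        by (rule half_space4_tangential_derivative[OF chart_img_open[OF i] x x1 dr])
          (use s_0 i in \<open>auto simp: r_def\<close>)
      then show ?thesis
        using has_derivative_linear[OF dr] by (simp add: linear_diff linear_scale)
    qed
    then show "\<exists>\<kappa>>0. \<forall>v. ?r' v = \<kappa> * v $ 1" using \<kappa> by blast
  qed
  then show ?thesis by (rule that)
qed

text \<open>Positive combinations of covectors with the same cooriented kernel keep that kernel. So
  local defining forms can be glued with bump functions, provided that at each boundary point at
  least one weight is positive.\<close>

lemma contact_path_form:
  assumes "compact_space (top_of V)" and path: "smooth_contact_path (boundary V) \<xi>"
  obtains \<alpha> where "smooth_form_path V \<alpha>"
    "\<And>t i y. t \<in> {0..1} \<Longrightarrow> i \<in> index V \<Longrightarrow> y \<in> chart_img (boundary V) i \<Longrightarrow>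
      coor_ker (boundary_restrict (\<alpha> t) i y) = \<xi> t i y"
proof -
  obtain C \<iota> z \<epsilon> where "ball_cover C \<iota> z \<epsilon>"
    using finite_ball_cover[OF assms(1)] .
  note C = ball_coverD(1-5)[OF this] and cover = ball_coverD(6)[OF this]
  have "\<forall>i\<in>index V. \<exists>a. smooth_on ({0..1} \<times> chart_img (boundary V) i) a \<and>
        (\<forall>t\<in>{0..1}. \<forall>x\<in>chart_img (boundary V) i. a (t, x) \<noteq> 0 \<and> \<xi> t i x = coor_ker (a (t, x)))"
    using path by (auto simp: smooth_contact_path_def)
  then obtain a where a_smooth: "\<And>i. i \<in> index V \<Longrightarrow> smooth_on ({0..1} \<times> chart_img (boundary V) i) (a i)"
    and a_ker: "\<And>i t x. i \<in> index V \<Longrightarrow> t \<in> {0..1} \<Longrightarrow> x \<in> chart_img (boundary V) i \<Longrightarrow> \<xi> t i x = coor_ker (a i (t, x))"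
    by metis
  have compat: "plane_field_compat (boundary V) (\<xi> t)" if "t \<in> {0..1}" for t
    using path that by (auto simp: smooth_contact_path_def coor_contact_structure_def)
  define b where "b c = bump (z c) (\<epsilon> c / 2)" for c
  \<comment> \<open>The local form is extended constantly in the first coordinate and without a
    component in that direction. Restricting to the ball ensures that the projection of
    \<open>x\<close> to the boundary still lies in the chart.\<close>
  define B where "B c t x = (if z c $ 1 = 0 \<and> x \<in> ball (z c) (\<epsilon> c) then
      b c x *\<^sub>R bd_incl (a (\<iota> c) (t, bd_proj x)) else 0)" for c and t :: real and x
  define \<alpha> where "\<alpha> t j x = (\<Sum>c\<in>C. spread_form (\<iota> c) (B c t) j x)" for t j x
  have B_zero: "B c t x = 0"
    if "c \<in> C" "x \<in> chart_img V (\<iota> c)" "x \<notin> cball (z c) (\<epsilon> c / 2) \<inter> half_space4" for c t x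
  proof -
    have "x \<in> half_space4" using that chart_img_nonpos[OF C(2)] by (auto simp: half_space4_def)
    then show ?thesis using that bump_eq_0[of "\<epsilon> c / 2" x "z c"] C(3)[OF that(1)] by (auto simp: B_def b_def)
  qed
  have B_smooth: "smooth_on ({0..1} \<times> chart_img V (\<iota> c)) (\<lambda>(t, x). B c t x)" if c: "c \<in> C" for c
  proof (cases "z c $ 1 = 0")
    case False
    then show ?thesis by (simp add: B_def smooth_on_const case_prod_unfold)
  next
    case True
    let ?S = "chart_img V (\<iota> c)"
    let ?A1 = "?S \<inter> ball (z c) (\<epsilon> c)" and ?A2 = "?S - cball (z c) (\<epsilon> c / 2)"
    have "?S = ?A1 \<union> ?A2" using C(3)[OF c] by auto
    then have un: "{0..1::real} \<times> ?S = {0..1} \<times> ?A1 \<union> {0..1} \<times> ?A2" by blast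
    have proj: "bd_proj x \<in> chart_img (boundary V) (\<iota> c)" if x: "x \<in> ?A1" for x
    proof -
      \<comment> \<open>Projection to the boundary hyperplane does not increase the distance to a
        centre on that hyperplane.\<close>
      have "norm (bd_incl (bd_proj x) - z c) \<le> norm (x - z c)"
      proof (rule norm_le_componentwise_cart)
        fix k :: 4
        show "norm ((bd_incl (bd_proj x) - z c) $ k) \<le> norm ((x - z c) $ k)"
          using True exhaust_4[of k] by auto
      qed
      then have "bd_incl (bd_proj x) \<in> cball (z c) (\<epsilon> c)"
        using x by (simp add: dist_norm norm_minus_commute)
      then show ?thesis
        using C(4)[OF c] by (auto simp: boundary_chart_img[OF C(2)[OF c]] half_space4_def subset_eq)
    qed
    have "smooth_on ({0..1::real} \<times> ?A1) (\<lambda>z. (fst z, bd_proj (snd z)))"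
      by (intro smooth_on_Pair smooth_on_linear bounded_linear_fst
          bounded_linear_compose[OF bounded_linear_bd_proj bounded_linear_snd])
    then have "smooth_on ({0..1::real} \<times> ?A1) (\<lambda>z. a (\<iota> c) (fst z, bd_proj (snd z)))"
      by (rule smooth_on_compose[OF _ a_smooth[OF C(2)[OF c]]]) (use proj in auto)
    from smooth_on_compose_linear[OF bounded_linear_bd_incl this]
    have "smooth_on ({0..1::real} \<times> ?A1) (\<lambda>z. (case z of (t, x) \<Rightarrow> b c x) *\<^sub>R bd_incl (a (\<iota> c) (fst z, bd_proj (snd z))))"
      unfolding b_def by (intro smooth_on_scaleR smooth_on_snd smooth_on_bump)
    then have 1: "smooth_on ({0..1} \<times> ?A1) (\<lambda>(t, x). B c t x)"
      by (rule smooth_on_cong) (use True in \<open>auto simp: B_def\<close>)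
    have 2: "smooth_on ({0..1} \<times> ?A2) (\<lambda>(t, x). B c t x)"
      by (rule smooth_on_cong[OF smooth_on_const[of _ 0]]) (use B_zero[OF c] in auto)
    have o1: "openin (top_of_set ?S) ?A1" by (intro openin_open_Int) auto
    have "?A2 = ?S \<inter> - cball (z c) (\<epsilon> c / 2)" by auto
    then have o2: "openin (top_of_set ?S) ?A2" by (metis openin_open_Int closed_cball open_Compl)
    show ?thesis
      unfolding un
      by (rule smooth_on_openin_Un[OF 1 2]) (use o1 o2 in \<open>auto simp flip: un intro!: openin_Times\<close>)
  qed
  have \<alpha>_path: "smooth_form_path V \<alpha>"
    unfolding \<alpha>_def[abs_def]
  proof (rule smooth_form_path_sum)
    fix c assume c: "c \<in> C"
    have "cball (z c) (\<epsilon> c / 2) \<inter> half_space4 \<subseteq> chart_img V (\<iota> c)"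
      using C(4)[OF c] C(3)[OF c] by (auto simp: subset_eq)
    then show "smooth_form_path V (\<lambda>t. spread_form (\<iota> c) (B c t))"
      by (rule spread_form_path[OF C(2)[OF c] compact_half_ball _ B_smooth[OF c] B_zero[OF c]])
  qed
  show ?thesis
  proof (rule that[OF \<alpha>_path])
    fix t i y assume t: "t \<in> {0..1::real}" and i: "i \<in> index V" and y: "y \<in> chart_img (boundary V) i"
    define x where "x = bd_incl y"
    have x: "x \<in> chart_img V i" "x $ 1 = 0" using y boundary_chart_img[OF i] by (auto simp: x_def)
    define \<beta> where "\<beta> = boundary_restrict (\<alpha> t) i y"
    define tm where "tm c v = spread_form (\<iota> c) (B c t) i x \<bullet> bd_incl v" for c v
    have \<beta>_sum: "\<beta> \<bullet> v = (\<Sum>c\<in>C. tm c v)" for v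
      by (simp add: \<beta>_def boundary_restrict_inner \<alpha>_def inner_sum_left tm_def x_def)
    define w where "w c = (if x \<in> overlap V i (\<iota> c) \<and> z c $ 1 = 0 \<and> transition V i (\<iota> c) x \<in> ball (z c) (\<epsilon> c)
        then b c (transition V i (\<iota> c) x) else 0)" for c
    have w_nonneg: "w c \<ge> 0" for c by (simp add: w_def b_def bump_nonneg)
    \<comment> \<open>Since \<open>\<xi>\<close> is compatible with transition maps, every summand
      has the sign of the local form \<open>a i\<close> up to a nonnegative weight. Where the weight
      is zero, any positive \<open>q\<close> serves.\<close>
    have tm_sign: "(a i (t, y) \<bullet> v = 0 \<longrightarrow> tm c v = 0) \<and>
        (a i (t, y) \<bullet> v > 0 \<longrightarrow> (\<exists>q>0. tm c v = w c * q))" if c: "c \<in> C" for c v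
    proof (cases "x \<in> overlap V i (\<iota> c)")
      case False
      then show ?thesis
        by (auto simp: tm_def spread_form_inner[OF C(2)[OF c] i] w_def intro: exI[of _ 1])
    next
      case True
      let ?k = "\<iota> c" and ?T = "transition V i (\<iota> c) x"
      have k: "?k \<in> index V" by (rule C(2)[OF c])
      have T1: "?T $ 1 = 0" by (rule transition_boundary[OF i k True x(2)])
      let ?q = "a ?k (t, bd_proj ?T) \<bullet> bd_proj (D_transition V i ?k x (bd_incl v))"
      have tm_eq: "tm c v = w c * ?q"
        using True by (simp add: tm_def spread_form_inner[OF k i] w_def B_def bd_incl_inner)
      have yo: "y \<in> overlap (boundary V) i ?k" using True boundary_overlap[OF i] by (simp add: x_def)
      have Ty: "transition (boundary V) i ?k y = bd_proj ?T"
        using boundary_transition[OF i] True by (simp add: x_def)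
      have Dy: "D_transition (boundary V) i ?k y v = bd_proj (D_transition V i ?k x (bd_incl v))"
        using boundary_D_transition[OF i k] True by (simp add: x_def)
      have "?T \<in> chart_img V ?k" by (rule transition_in_img[OF i True])
      then have "bd_proj ?T \<in> chart_img (boundary V) ?k"
        using boundary_chart_img[OF k] T1 bd_incl_proj by auto
      from a_ker[OF k t this] have \<xi>k: "\<xi> t ?k (bd_proj ?T) = coor_ker (a ?k (t, bd_proj ?T))" .
      have "(v \<in> plane (\<xi> t i y) \<longleftrightarrow> D_transition (boundary V) i ?k y v \<in> plane (\<xi> t ?k (transition (boundary V) i ?k y))) \<and>
        (v \<in> pos_side (\<xi> t i y) \<longleftrightarrow> D_transition (boundary V) i ?k y v \<in> pos_side (\<xi> t ?k (transition (boundary V) i ?k y)))"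
        using compat[OF t] i k yo by (simp add: plane_field_compat_def)
      then have "(a i (t, y) \<bullet> v = 0 \<longleftrightarrow> ?q = 0) \<and> (a i (t, y) \<bullet> v > 0 \<longleftrightarrow> ?q > 0)"
        unfolding Ty Dy \<xi>k a_ker[OF i t y] by (simp add: coor_ker_def)
      then show ?thesis using tm_eq by auto
    qed
    obtain c where c: "c \<in> C" "x \<in> overlap V i (\<iota> c)" "transition V i (\<iota> c) x \<in> ball (z c) (\<epsilon> c / 2)"
      using cover[OF i x(1)] by blast
    \<comment> \<open>Transition maps preserve the boundary, so a ball of the cover that contains
      the image of \<open>x\<close> meets the boundary and must be centred on it. Hence the weight
      \<open>w c\<close> is positive.\<close>
    have cball: "transition V i (\<iota> c) x \<in> ball (z c) (\<epsilon> c)" using c(3) C(3)[OF c(1)] by auto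
    then have "z c $ 1 = 0"
      using C(5)[OF c(1), of "transition V i (\<iota> c) x"] transition_boundary[OF i C(2)[OF c(1)] c(2) x(2)] by fastforce
    then have wc: "w c > 0"
      using c cball C(3)[OF c(1)] by (simp add: w_def b_def bump_pos)
    have zero: "\<beta> \<bullet> v = 0" if "a i (t, y) \<bullet> v = 0" for v
      unfolding \<beta>_sum using tm_sign that by (intro sum.neutral) auto
    have pos: "\<beta> \<bullet> v > 0" if "a i (t, y) \<bullet> v > 0" for v
      unfolding \<beta>_sum
    proof (rule sum_pos2[OF C(1) c(1)])
      show "tm c v > 0" using tm_sign[OF c(1), of v] that wc by auto
      show "tm d v \<ge> 0" if "d \<in> C" for d
        using tm_sign[OF that, of v] \<open>a i (t, y) \<bullet> v > 0\<close> w_nonneg[of d] by auto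
    qed
    have neg: "\<beta> \<bullet> v < 0" if "a i (t, y) \<bullet> v < 0" for v
      using pos[of "- v"] that by simp
    have "\<beta> \<bullet> v = 0 \<longleftrightarrow> a i (t, y) \<bullet> v = 0" "\<beta> \<bullet> v > 0 \<longleftrightarrow> a i (t, y) \<bullet> v > 0" for v
      using zero[of v] pos[of v] neg[of v] by linarith+
    then show "coor_ker (boundary_restrict (\<alpha> t) i y) = \<xi> t i y"
      unfolding \<beta>_def[symmetric] a_ker[OF i t y] by (simp add: coor_ker_def)
  qed
qed

end

section \<open>The homotopy\<close>

lemma continuous_on_vol4:
  assumes "\<And>u v. continuous_on X (\<lambda>z. \<omega> z u v)" "\<And>u v. continuous_on X (\<lambda>z. \<eta> z u v)"
  shows "continuous_on X (\<lambda>z. vol4 (\<omega> z) (\<eta> z))"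
  unfolding vol4_def wedge22_def by (intro continuous_intros assms)

section \<open>The interpolating path and its two volume conditions\<close>

locale collar_data = manifold4 V for V :: "('a, 'i, 4) manifold" +
  fixes l :: "real \<Rightarrow> ('i, 4) coeffs" and \<xi> :: "real \<Rightarrow> 'i plane_field"
    and r :: "'i \<Rightarrow> real ^ 4 \<Rightarrow> real" and \<alpha> :: "real \<Rightarrow> ('i, 4) coeffs"
  assumes compact_V: "compact_space (top_of V)"
    and path: "pre_Liouville_path V l \<xi>"
    and L0: "Liouville_structure V (l 0) (\<xi> 0)"
    and L1: "Liouville_structure V (l 1) (\<xi> 1)"
    and r_defining: "defining_function r"
    and \<alpha>_path: "smooth_form_path V \<alpha>"
    and \<alpha>_ker: "\<And>t i y. t \<in> {0..1} \<Longrightarrow> i \<in> index V \<Longrightarrow> y \<in> chart_img (boundary V) i \<Longrightarrow>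
      coor_ker (boundary_restrict (\<alpha> t) i y) = \<xi> t i y"
begin

definition dr :: "'i \<Rightarrow> real ^ 4 \<Rightarrow> real ^ 4 \<Rightarrow> real" where
  "dr i x = frechet_derivative (r i) (at x within chart_img V i)"

definition m :: "real \<Rightarrow> real \<Rightarrow> real \<Rightarrow> ('i, 4) coeffs" where
  "m K N t i x = l t i x + (K * (t * (1 - t)) * exp (N * r i x)) *\<^sub>R \<alpha> t i x"

lemma r_scalar: "scalar_function V r"
  and r_nonpos: "i \<in> index V \<Longrightarrow> x \<in> chart_img V i \<Longrightarrow> r i x \<le> 0"
  and r_eq_0: "i \<in> index V \<Longrightarrow> x \<in> chart_img V i \<Longrightarrow> r i x = 0 \<longleftrightarrow> x $ 1 = 0"
  and dr_normal: "i \<in> index V \<Longrightarrow> x \<in> chart_img V i \<Longrightarrow> x $ 1 = 0 \<Longrightarrow>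
      \<exists>\<kappa>>0. \<forall>v. frechet_derivative (r i) (at x within chart_img V i) v = \<kappa> * v $ 1"
  using r_defining unfolding defining_function_def by blast+

lemma l_path: "smooth_form_path V l"
  using path by (simp add: pre_Liouville_path_def)

lemma pre_L: "t \<in> {0..1} \<Longrightarrow> pre_Liouville V (l t) (\<xi> t)"
  using path by (simp add: pre_Liouville_path_def)

lemmas l_form = smooth_form_pathD(1)[OF l_path]
lemmas \<alpha>_form = smooth_form_pathD(1)[OF \<alpha>_path]

lemma m_path: "smooth_form_path V (m K N)"
proof (rule smooth_form_pathI)
  fix i assume i: "i \<in> index V"
  let ?X = "{0..1::real} \<times> chart_img V i"
  have t: "smooth_on ?X fst" by (rule smooth_on_linear[OF bounded_linear_fst])
  have r: "smooth_on ?X (\<lambda>(t, x). r i x)"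
    using r_scalar i by (intro smooth_on_snd) (auto simp: scalar_function_def)
  have "smooth_on ?X (\<lambda>z. N * (case z of (t, x) \<Rightarrow> r i x))"
    by (intro smooth_on_mult smooth_on_const r)
  from smooth_on_compose[OF this smooth_on_exp[of UNIV]]
  have e: "smooth_on ?X (\<lambda>z. exp (N * (case z of (t, x) \<Rightarrow> r i x)))" by simp
  have "smooth_on ?X (\<lambda>z. (case z of (t, x) \<Rightarrow> l t i x) +
      (K * (fst z * (1 + (- 1) * fst z)) * exp (N * (case z of (t, x) \<Rightarrow> r i x))) *\<^sub>R (case z of (t, x) \<Rightarrow> \<alpha> t i x))"
    by (intro smooth_on_add smooth_on_scaleR smooth_on_mult smooth_on_const t e
        smooth_form_pathD(2)[OF l_path i] smooth_form_pathD(2)[OF \<alpha>_path i])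
  then show "smooth_on ?X (\<lambda>(t, x). m K N t i x)"
    by (simp add: m_def case_prod_unfold)
next
  fix t i j x v assume "(t::real) \<in> {0..1}" "i \<in> index V" "j \<in> index V" "x \<in> overlap V i j"
  moreover from this have "r i x = r j (transition V i j x)"
    using r_scalar by (simp add: scalar_function_def)
  ultimately show "m K N t i x \<bullet> v = m K N t j (transition V i j x) \<bullet> D_transition V i j x v"
    using one_formD(2)[OF l_form] one_formD(2)[OF \<alpha>_form] by (simp add: m_def inner_add_left)
qed

text \<open>Differentiating the exponential reproduces it with the factor \<open>N\<close>, so both
  corrections share the single coefficient \<open>c\<close>.\<close>

lemma dform_m:
  assumes t: "t \<in> {0..1}" and i: "i \<in> index V" and x: "x \<in> chart_img V i"
    and c: "c = K * (t * (1 - t)) * exp (N * r i x)"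
  shows "dform V (m K N t) i x =
    (\<lambda>u v. dform V (l t) i x u v + c * (N * wedge11 (dr i x) ((\<bullet>) (\<alpha> t i x)) u v + dform V (\<alpha> t) i x u v))"
proof (intro ext)
  fix u v
  define \<phi> where "\<phi> x = K * (t * (1 - t)) * exp (N * r i x)" for x
  have "(r i has_derivative dr i x) (at x within chart_img V i)"
    unfolding dr_def using r_scalar i by (intro smooth_on_has_derivative x) (auto simp: scalar_function_def)
  then have \<phi>: "(\<phi> has_derivative (\<lambda>h. c * (N * dr i x h))) (at x within chart_img V i)"
    unfolding \<phi>_def c by (auto intro!: derivative_eq_intros)
  have "m K N t i = (\<lambda>x. l t i x + \<phi> x *\<^sub>R \<alpha> t i x)" by (simp add: m_def \<phi>_def fun_eq_iff)
  then have "dform V (m K N t) i x u v = dform V (l t) i x u v +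
      (wedge11 (\<lambda>h. c * (N * dr i x h)) ((\<bullet>) (\<alpha> t i x)) u v + \<phi> x * dform V (\<alpha> t) i x u v)"
    unfolding dform_def using ext_deriv_add_scaleR[OF thick_chart_img[OF i] x
        one_form_differentiable[OF l_form[OF t] i x] one_form_differentiable[OF \<alpha>_form[OF t] i x] \<phi>]
    by simp
  then show "dform V (m K N t) i x u v =
      dform V (l t) i x u v + c * (N * wedge11 (dr i x) ((\<bullet>) (\<alpha> t i x)) u v + dform V (\<alpha> t) i x u v)"
    by (simp add: wedge11_def \<phi>_def c algebra_simps)
qed

lemma dr_transition:
  "i \<in> index V \<Longrightarrow> j \<in> index V \<Longrightarrow> x \<in> overlap V i j \<Longrightarrow>
    dr i x v = dr j (transition V i j x) (D_transition V i j x v)"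
  unfolding dr_def by (rule scalar_function_transition[OF r_scalar])

lemma linear_dr: "i \<in> index V \<Longrightarrow> x \<in> chart_img V i \<Longrightarrow> linear (dr i x)"
  unfolding dr_def using r_scalar
  by (intro linear_frechet_derivative smooth_on_differentiable) (auto simp: scalar_function_def)

lemma vol4_dform_transition:
  assumes a: "one_form V a" and ij: "i \<in> index V" "j \<in> index V" and x: "x \<in> overlap V i j"
  shows "vol4 (dform V a i x) (dform V a i x) = det (matrix (D_transition V i j x)) *
      vol4 (dform V a j (transition V i j x)) (dform V a j (transition V i j x))"
proof -
  have "dform V a i x = (\<lambda>u v. dform V a j (transition V i j x) (D_transition V i j x u) (D_transition V i j x v))"
    using dform_transition[OF a ij x] by blast
  then show ?thesis
    using vol4_pullback skew_dform[OF a ij(2) transition_in_img[OF ij(1) x]] by simp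
qed

text \<open>With the extra factor \<open>dr\<close> the contact condition scales by the same
  positive determinant as the symplectic one, so it may be checked in any chart.\<close>

lemma vol4_contact_transition:
  assumes a: "one_form V a" and ij: "i \<in> index V" "j \<in> index V" and x: "x \<in> overlap V i j"
  shows "vol4 (wedge11 (dr i x) ((\<bullet>) (a i x))) (dform V a i x) = det (matrix (D_transition V i j x)) *
      vol4 (wedge11 (dr j (transition V i j x)) ((\<bullet>) (a j (transition V i j x)))) (dform V a j (transition V i j x))"
proof -
  let ?y = "transition V i j x"
  have y: "?y \<in> chart_img V j" by (rule transition_in_img[OF ij(1) x])
  have 1: "dform V a i x = (\<lambda>u v. dform V a j ?y (D_transition V i j x u) (D_transition V i j x v))"
    using dform_transition[OF a ij x] by blast
  have 2: "wedge11 (dr i x) ((\<bullet>) (a i x)) =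
      (\<lambda>u v. wedge11 (dr j ?y) ((\<bullet>) (a j ?y)) (D_transition V i j x u) (D_transition V i j x v))"
    unfolding wedge11_def using dr_transition[OF ij x] one_formD(2)[OF a ij x] by auto
  have "linear ((\<bullet>) (a j ?y))" by (rule bounded_linear.linear[OF bounded_linear_inner_right])
  then have "skew (wedge11 (dr j ?y) ((\<bullet>) (a j ?y)))" by (intro skew_wedge11 linear_dr ij y)
  from vol4_pullback[OF this skew_dform[OF a ij(2) y]] show ?thesis unfolding 1 2 .
qed

text \<open>\<kappa> is the normal derivative of \<open>r\<close>; being positive it leaves all
  signs unchanged.\<close>

lemma vol4_at_boundary:
  assumes a: "one_form V a" and i: "i \<in> index V" and y: "y \<in> chart_img (boundary V) i"
  obtains \<kappa> where "\<kappa> > 0"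
    "\<And>b. vol4 (wedge11 (dr i (bd_incl y)) ((\<bullet>) (b i (bd_incl y)))) (dform V a i (bd_incl y)) =
      \<kappa> * wedge12 ((\<bullet>) (boundary_restrict b i y))
        (ext_deriv (chart_img (boundary V) i) (boundary_restrict a i) y) (axis 1 1) (axis 2 1) (axis 3 1)"
proof -
  have x: "bd_incl y \<in> chart_img V i" using y boundary_chart_img[OF i] by simp
  then obtain \<kappa> where \<kappa>: "\<kappa> > 0" "\<And>v. dr i (bd_incl y) v = \<kappa> * v $ 1"
    using dr_normal[OF i x] unfolding dr_def by auto
  show ?thesis
    by (rule that[OF \<kappa>(1)], subst vol4_boundary[OF \<kappa>(2)])
      (simp add: wedge12_def boundary_restrict_inner ext_deriv_boundary_restrict[OF a i y])
qed

text \<open>The first claim comes from the contact structure, whose defining form differs from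
  \<open>\<alpha>\<close> by a positive factor; the second is domination. At the endpoints
  \<open>l t\<close> restricts to a positive multiple of \<open>\<alpha> t\<close>, so the last two
  quantities are multiples of the first two.\<close>

lemma boundary_positivity:
  assumes t: "t \<in> {0..1}" and i: "i \<in> index V" and y: "y \<in> chart_img (boundary V) i"
  shows "positive_contact_at (chart_img (boundary V) i) (boundary_restrict (\<alpha> t) i) y" (is "?contact")
    and "wedge12 ((\<bullet>) (boundary_restrict (\<alpha> t) i y))
      (ext_deriv (chart_img (boundary V) i) (boundary_restrict (l t) i) y) (axis 1 1) (axis 2 1) (axis 3 1) > 0" (is "?dom")
    and "t \<in> {0, 1} \<Longrightarrow> wedge12 ((\<bullet>) (boundary_restrict (l t) i y))
      (ext_deriv (chart_img (boundary V) i) (boundary_restrict (l t) i) y) (axis 1 1) (axis 2 1) (axis 3 1) > 0 \<and>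
      wedge12 ((\<bullet>) (boundary_restrict (l t) i y))
      (ext_deriv (chart_img (boundary V) i) (boundary_restrict (\<alpha> t) i) y) (axis 1 1) (axis 2 1) (axis 3 1) > 0"
proof -
  let ?S = "chart_img (boundary V) i" and ?bet = "boundary_restrict (\<alpha> t) i" and ?lam = "boundary_restrict (l t) i"
  have S: "thick ?S" by (rule thick_open[OF boundary_chart_img_open[OF i]])
  have smooth_bet: "smooth_on ?S ?bet" and smooth_lam: "smooth_on ?S ?lam"
    using one_formD(1)[OF one_form_boundary_restrict] \<alpha>_form[OF t] l_form[OF t] i by auto
  have "coor_contact_structure (boundary V) (\<xi> t)"
    using pre_L[OF t] by (simp add: pre_Liouville_def)
  then obtain a where a: "smooth_on ?S a"
    "\<And>x. x \<in> ?S \<Longrightarrow> \<xi> t i x = coor_ker (a x) \<and> positive_contact_at ?S a x"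
    using i unfolding coor_contact_structure_def by auto
  show contact: ?contact
    by (rule positive_contact_cong_kernel[OF S y a(1) _ smooth_bet]) (use a(2) \<alpha>_ker[OF t i] in auto)
  then have nz: "?bet y \<noteq> 0" by (auto simp: positive_contact_at_def wedge12_def)
  have "?lam differentiable (at y within ?S)" by (rule smooth_on_differentiable[OF smooth_lam y])
  note skew = skew_ext_deriv[OF this]
  have dominates: "dominates V (l t) (\<xi> t)" using pre_L[OF t] by (simp add: pre_Liouville_def)
  show dom: ?dom
  proof (rule wedge12_pos_of_plane_pos[OF skew nz])
    fix n v w
    assume "?bet y \<bullet> n > 0" "?bet y \<bullet> v = 0" "?bet y \<bullet> w = 0" and det: "det (vector [n, v, w] :: real ^ 3 ^ 3) > 0"
    then have "n \<in> pos_side (\<xi> t i y)" "v \<in> plane (\<xi> t i y)" "w \<in> plane (\<xi> t i y)"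
      unfolding \<alpha>_ker[OF t i y, symmetric] by (auto simp: coor_ker_def)
    then show "ext_deriv ?S ?lam y v w > 0"
      using dominates det i y unfolding dominates_def ext_deriv_boundary_restrict[OF l_form[OF t] i y] by blast
  qed
  assume "t \<in> {0, 1}"
  then have L: "Liouville_structure V (l t) (\<xi> t)" using L0 L1 by auto
  then have lam_contact: "wedge12 ((\<bullet>) (?lam y)) (ext_deriv ?S ?lam y) (axis 1 1) (axis 2 1) (axis 3 1) > 0"
    using i y by (simp add: Liouville_structure_def Liouville_form_def positive_contact_form_def positive_contact_at_def)
  have "{v. ?lam y \<bullet> v = 0} = plane (\<xi> t i y)" using L i y by (simp add: Liouville_structure_def)
  also have "\<dots> = {v. ?bet y \<bullet> v = 0}" unfolding \<alpha>_ker[OF t i y, symmetric] by (simp add: coor_ker_def)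
  finally obtain g where g: "g > 0" "?lam y = g *\<^sub>R ?bet y"
    using contact_kernel_pos[OF _ dom lam_contact] by metis
  have "wedge12 ((\<bullet>) (?lam y)) \<omega> u v w = g * wedge12 ((\<bullet>) (?bet y)) \<omega> u v w" for \<omega> u v w
    by (simp add: g(2) wedge12_def algebra_simps)
  then show "wedge12 ((\<bullet>) (?lam y)) (ext_deriv ?S ?lam y) (axis 1 1) (axis 2 1) (axis 3 1) > 0 \<and>
      wedge12 ((\<bullet>) (?lam y)) (ext_deriv ?S ?bet y) (axis 1 1) (axis 2 1) (axis 3 1) > 0"
    using lam_contact g(1) contact by (simp add: positive_contact_at_def)
qed

lemma vol4_boundary_positivity:
  assumes t: "t \<in> {0..1}" and i: "i \<in> index V" and x: "x \<in> chart_img V i" "x $ 1 = 0"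
  shows "vol4 (wedge11 (dr i x) ((\<bullet>) (\<alpha> t i x))) (dform V (\<alpha> t) i x) > 0"
    and "vol4 (wedge11 (dr i x) ((\<bullet>) (\<alpha> t i x))) (dform V (l t) i x) > 0"
    and "t \<in> {0, 1} \<Longrightarrow> vol4 (wedge11 (dr i x) ((\<bullet>) (l t i x))) (dform V (l t) i x) > 0 \<and>
      vol4 (wedge11 (dr i x) ((\<bullet>) (l t i x))) (dform V (\<alpha> t) i x) > 0"
proof -
  define y where "y = bd_proj x"
  have xy: "x = bd_incl y" using bd_incl_proj[OF x(2)] by (simp add: y_def)
  have y: "y \<in> chart_img (boundary V) i" using x xy boundary_chart_img[OF i] by simp
  obtain \<kappa> where \<kappa>: "\<kappa> > 0"
    "\<And>b. vol4 (wedge11 (dr i (bd_incl y)) ((\<bullet>) (b i (bd_incl y)))) (dform V (l t) i (bd_incl y)) =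
      \<kappa> * wedge12 ((\<bullet>) (boundary_restrict b i y))
        (ext_deriv (chart_img (boundary V) i) (boundary_restrict (l t) i) y) (axis 1 1) (axis 2 1) (axis 3 1)"
    using vol4_at_boundary[OF l_form[OF t] i y] by blast
  obtain \<kappa>' where \<kappa>': "\<kappa>' > 0"
    "\<And>b. vol4 (wedge11 (dr i (bd_incl y)) ((\<bullet>) (b i (bd_incl y)))) (dform V (\<alpha> t) i (bd_incl y)) =
      \<kappa>' * wedge12 ((\<bullet>) (boundary_restrict b i y))
        (ext_deriv (chart_img (boundary V) i) (boundary_restrict (\<alpha> t) i) y) (axis 1 1) (axis 2 1) (axis 3 1)"
    using vol4_at_boundary[OF \<alpha>_form[OF t] i y] by blast
  note pos = boundary_positivity[OF t i y]
  show "vol4 (wedge11 (dr i x) ((\<bullet>) (\<alpha> t i x))) (dform V (\<alpha> t) i x) > 0"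
    unfolding xy \<kappa>'(2) using \<kappa>'(1) pos(1) by (simp add: positive_contact_at_def)
  show "vol4 (wedge11 (dr i x) ((\<bullet>) (\<alpha> t i x))) (dform V (l t) i x) > 0"
    unfolding xy \<kappa>(2) using \<kappa>(1) pos(2) by simp
  assume "t \<in> {0, 1}"
  then show "vol4 (wedge11 (dr i x) ((\<bullet>) (l t i x))) (dform V (l t) i x) > 0 \<and>
      vol4 (wedge11 (dr i x) ((\<bullet>) (l t i x))) (dform V (\<alpha> t) i x) > 0"
    unfolding xy \<kappa>(2) \<kappa>'(2) using \<kappa>(1) \<kappa>'(1) pos(3) by simp
qed

lemma continuous_on_form:
  assumes "smooth_form_path V a" "i \<in> index V"
  shows "continuous_on ({0..1} \<times> chart_img V i) (\<lambda>z. a (fst z) i (snd z) \<bullet> v)"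
    and "continuous_on ({0..1} \<times> chart_img V i) (\<lambda>z. dform V (a (fst z)) i (snd z) u v)"
proof -
  note sm = smooth_form_pathD(2)[OF assms]
  show "continuous_on ({0..1} \<times> chart_img V i) (\<lambda>z. a (fst z) i (snd z) \<bullet> v)"
    using smooth_on_continuous_on[OF sm] by (intro continuous_intros) (simp add: case_prod_unfold)
  have "continuous_on ({0..1} \<times> chart_img V i)
      (\<lambda>z. frechet_derivative (a (fst z) i) (at (snd z) within chart_img V i) w)" for w
    using smooth_on_continuous_on[OF smooth_on_partial_derivative[OF sm thick_chart_img[OF assms(2)]]]
    by (simp add: case_prod_unfold)
  then show "continuous_on ({0..1} \<times> chart_img V i) (\<lambda>z. dform V (a (fst z)) i (snd z) u v)"
    unfolding dform_def ext_deriv_def by (intro continuous_intros)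
qed

lemma continuous_on_r:
  assumes "i \<in> index V"
  shows "continuous_on ({0..1::real} \<times> chart_img V i) (\<lambda>z. r i (snd z))"
    and "continuous_on ({0..1::real} \<times> chart_img V i) (\<lambda>z. dr i (snd z) v)"
proof -
  have sm: "smooth_on (chart_img V i) (r i)" using r_scalar assms by (simp add: scalar_function_def)
  show "continuous_on ({0..1::real} \<times> chart_img V i) (\<lambda>z. r i (snd z))"
    using smooth_on_continuous_on[OF smooth_on_snd[OF sm]] by (simp add: case_prod_unfold)
  show "continuous_on ({0..1::real} \<times> chart_img V i) (\<lambda>z. dr i (snd z) v)"
    unfolding dr_def
    using smooth_on_continuous_on[OF smooth_on_snd[OF smooth_on_frechet_derivative[OF sm thick_chart_img[OF assms]]]]
    by (simp add: case_prod_unfold)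
qed

lemma continuous_on_wedge:
  assumes "smooth_form_path V a" "i \<in> index V"
  shows "continuous_on ({0..1} \<times> chart_img V i)
    (\<lambda>z. wedge11 (dr i (snd z)) ((\<bullet>) (a (fst z) i (snd z))) u v)"
  unfolding wedge11_def
  by (intro continuous_intros continuous_on_form(1) continuous_on_r(2) assms)

lemma contact_positive_local:
  assumes i: "i \<in> index V" and Q: "compact Q" "Q \<subseteq> chart_img V i"
  obtains K0 where "\<And>K N t x. K \<ge> K0 \<Longrightarrow> t \<in> {0..1} \<Longrightarrow> x \<in> Q \<Longrightarrow> x $ 1 = 0 \<Longrightarrow>
    vol4 (wedge11 (dr i x) ((\<bullet>) (m K N t i x))) (dform V (m K N t) i x) > 0"
proof -
  define X where "X = {0..1::real} \<times> (Q \<inter> {x. x $ 1 = 0})"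
  have "closed {x :: real ^ 4. x $ 1 = 0}"
    by (intro closed_Collect_eq continuous_intros)
  then have X: "compact X" unfolding X_def by (intro compact_Times compact_Icc compact_Int_closed Q(1))
  have sub: "X \<subseteq> {0..1} \<times> chart_img V i" using Q(2) by (auto simp: X_def)
  note co = continuous_on_subset[OF _ sub]
  define G where "G z = vol4 (wedge11 (dr i (snd z)) ((\<bullet>) (l (fst z) i (snd z)))) (dform V (l (fst z)) i (snd z))" for z
  define E where "E z = vol4 (wedge11 (dr i (snd z)) ((\<bullet>) (\<alpha> (fst z) i (snd z)))) (dform V (l (fst z)) i (snd z)) +
      vol4 (wedge11 (dr i (snd z)) ((\<bullet>) (l (fst z) i (snd z)))) (dform V (\<alpha> (fst z)) i (snd z))" for z
  define D where "D z = vol4 (wedge11 (dr i (snd z)) ((\<bullet>) (\<alpha> (fst z) i (snd z)))) (dform V (\<alpha> (fst z)) i (snd z))" for z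
  \<comment> \<open>It vanishes exactly at the endpoints of the path. There, and only there,
    positivity of \<open>G\<close> and \<open>E\<close> is available.\<close>
  define \<tau> where "\<tau> z = fst z * (1 - fst z)" for z :: "real \<times> (real ^ 4)"
  have cont: "continuous_on X G" "continuous_on X E" "continuous_on X D" "continuous_on X \<tau>"
    unfolding G_def E_def D_def \<tau>_def
    by (intro continuous_on_add continuous_on_vol4 co continuous_on_wedge continuous_on_form(2) l_path \<alpha>_path i
        continuous_intros)+
  have bdry: "fst z \<in> {0..1}" "snd z \<in> chart_img V i" "snd z $ 1 = 0" if "z \<in> X" for z
    using that Q(2) by (auto simp: X_def)
  have pos: "D z > 0" if "z \<in> X" for z
    unfolding D_def by (rule vol4_boundary_positivity(1)[OF bdry(1)[OF that] i bdry(2,3)[OF that]])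
  have \<tau>0: "\<tau> z \<ge> 0" if "z \<in> X" for z using bdry(1)[OF that] by (simp add: \<tau>_def)
  have GE: "G z > 0 \<and> E z > 0" if z: "z \<in> X" "\<tau> z = 0" for z
  proof -
    have "fst z \<in> {0, 1}" using z(2) by (auto simp: \<tau>_def)
    then show ?thesis
      using vol4_boundary_positivity(2,3)[OF bdry(1)[OF z(1)] i bdry(2,3)[OF z(1)]]
      by (simp add: G_def E_def add_pos_pos)
  qed
  obtain K0 where K0: "\<And>K z s. K \<ge> K0 \<Longrightarrow> z \<in> X \<Longrightarrow> s = K * \<tau> z \<Longrightarrow> G z + s * E z + s\<^sup>2 * D z > 0"
    using quadratic_positive_large[OF X cont pos \<tau>0 GE] by blast
  show ?thesis
  proof (rule that[of K0])
    fix K N t x assume K: "K \<ge> K0" and t: "t \<in> {0..1::real}" and x: "x \<in> Q" "x $ 1 = 0"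
    have xi: "x \<in> chart_img V i" using x Q by blast
    let ?s = "K * (t * (1 - t)) * exp (N * r i x)"
    \<comment> \<open>On the boundary \<open>r\<close> is zero and the exponential is 1, which makes
      \<open>K0\<close> independent of \<open>N\<close>.\<close>
    have s: "?s = K * \<tau> (t, x)" using r_eq_0[OF i xi] x(2) by (simp add: \<tau>_def)
    have "(\<bullet>) (m K N t i x) = (\<lambda>v. l t i x \<bullet> v + ?s * (\<alpha> t i x \<bullet> v))"
      by (simp add: m_def inner_add_left fun_eq_iff)
    then have "vol4 (wedge11 (dr i x) ((\<bullet>) (m K N t i x))) (dform V (m K N t) i x) =
        G (t, x) + ?s * E (t, x) + ?s\<^sup>2 * D (t, x)"
      by (simp only: dform_m[OF t i xi refl] vol4_contact_expand vol4_wedge_wedge G_def E_def D_def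
          fst_conv snd_conv mult_zero_right add_0_right)
    also have "\<dots> > 0" using t x by (intro K0[OF K _ s]) (auto simp: X_def)
    finally show "vol4 (wedge11 (dr i x) ((\<bullet>) (m K N t i x))) (dform V (m K N t) i x) > 0" .
  qed
qed

text \<open>An instance of \<open>exp_collar_positive\<close>: \<open>L\<close> is positive by the
  orientation condition, and on the zero set of \<open>r\<close> positivity of \<open>A\<close> and
  \<open>D\<close> is domination and contactness respectively.\<close>

lemma symplectic_positive_local:
  assumes i: "i \<in> index V" and Q: "compact Q" "Q \<subseteq> chart_img V i" and K: "K > 0"
  obtains N0 where "\<And>N t x. N \<ge> N0 \<Longrightarrow> t \<in> {0..1} \<Longrightarrow> x \<in> Q \<Longrightarrow>
    vol4 (dform V (m K N t) i x) (dform V (m K N t) i x) > 0"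
proof -
  define X where "X = {0..1::real} \<times> Q"
  have X: "compact X" unfolding X_def by (intro compact_Times compact_Icc Q(1))
  have sub: "X \<subseteq> {0..1} \<times> chart_img V i" using Q(2) by (auto simp: X_def)
  note co = continuous_on_subset[OF _ sub]
  define L where "L z = vol4 (dform V (l (fst z)) i (snd z)) (dform V (l (fst z)) i (snd z))" for z
  define A where "A z = 2 * vol4 (wedge11 (dr i (snd z)) ((\<bullet>) (\<alpha> (fst z) i (snd z)))) (dform V (l (fst z)) i (snd z))" for z
  define B where "B z = 2 * vol4 (dform V (\<alpha> (fst z)) i (snd z)) (dform V (l (fst z)) i (snd z))" for z
  define D where "D z = 2 * vol4 (wedge11 (dr i (snd z)) ((\<bullet>) (\<alpha> (fst z) i (snd z)))) (dform V (\<alpha> (fst z)) i (snd z))" for z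
  define E where "E z = vol4 (dform V (\<alpha> (fst z)) i (snd z)) (dform V (\<alpha> (fst z)) i (snd z))" for z
  have cont: "continuous_on X L" "continuous_on X A" "continuous_on X B" "continuous_on X D" "continuous_on X E"
    "continuous_on X (\<lambda>z. r i (snd z))"
    unfolding L_def A_def B_def D_def E_def
    by (intro continuous_on_mult continuous_on_const continuous_on_vol4 co continuous_on_wedge
        continuous_on_form(2) continuous_on_r(1) l_path \<alpha>_path i)+
  have dom: "fst z \<in> {0..1}" "snd z \<in> chart_img V i" if "z \<in> X" for z
    using that Q(2) by (auto simp: X_def)
  have Lpos: "L z > 0" if z: "z \<in> X" for z
  proof -
    have "d_induces_orientation V (l (fst z))" using pre_L[OF dom(1)[OF z]] by (simp add: pre_Liouville_def)
    then show ?thesis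
      using i dom(2)[OF z] by (simp add: L_def vol4_def d_induces_orientation_def)
  qed
  have rle: "r i (snd z) \<le> 0" if "z \<in> X" for z using r_nonpos[OF i dom(2)[OF that]] .
  have AD: "A z > 0 \<and> D z > 0" if z: "z \<in> X" "r i (snd z) = 0" for z
  proof -
    have "snd z $ 1 = 0" using r_eq_0[OF i dom(2)[OF z(1)]] z(2) by simp
    from vol4_boundary_positivity(1,2)[OF dom(1)[OF z(1)] i dom(2)[OF z(1)] this]
    show ?thesis by (simp add: A_def D_def)
  qed
  obtain N0 where N0: "\<And>N z s c. N \<ge> N0 \<Longrightarrow> z \<in> X \<Longrightarrow> 0 \<le> s \<Longrightarrow> s \<le> K \<Longrightarrow> c = s * exp (N * r i (snd z)) \<Longrightarrow>
      L z + c * (N * A z + B z) + c\<^sup>2 * (N * D z + E z) > 0"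
    using exp_collar_positive[OF X cont Lpos rle AD K] by blast
  show ?thesis
  proof (rule that[of N0])
    fix N t x assume N: "N \<ge> N0" and t: "t \<in> {0..1::real}" and x: "x \<in> Q"
    have xi: "x \<in> chart_img V i" using x Q by blast
    let ?c = "K * (t * (1 - t)) * exp (N * r i x)"
    have "vol4 (dform V (m K N t) i x) (dform V (m K N t) i x) =
        L (t, x) + ?c * (N * A (t, x) + B (t, x)) + ?c\<^sup>2 * (N * D (t, x) + E (t, x))"
      by (simp only: dform_m[OF t i xi refl] vol4_square_expand L_def A_def B_def D_def E_def fst_conv snd_conv)
    also have "\<dots> > 0"
    proof (rule N0[OF N])
      show "(t, x) \<in> X" using t x by (simp add: X_def)
      show "K * (t * (1 - t)) \<ge> 0" using K t by simp
      \<comment> \<open>Puts the amplitude into the interval from 0 to \<open>K\<close>, over which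
        \<open>exp_collar_positive\<close> is uniform.\<close>
      have "t * (1 - t) \<le> 1" using t by (simp add: mult_le_one)
      then show "K * (t * (1 - t)) \<le> K" using K by (simp add: mult_left_le)
    qed simp
    finally show "vol4 (dform V (m K N t) i x) (dform V (m K N t) i x) > 0" .
  qed
qed

lemma Liouville_homotopy: "Liouville_homotopic V (l 0) (l 1)"
proof -
  obtain C \<iota> z \<epsilon> where "ball_cover C \<iota> z \<epsilon>"
    using finite_ball_cover[OF compact_V] .
  note C = ball_coverD(1-5)[OF this] and cover = ball_coverD(6)[OF this]
  define Q where "Q c = cball (z c) (\<epsilon> c) \<inter> half_space4" for c
  have Q: "compact (Q c)" "Q c \<subseteq> chart_img V (\<iota> c)" if "c \<in> C" for c
    using compact_half_ball C(4)[OF that] by (auto simp: Q_def)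
  have coverQ: "\<exists>c\<in>C. x \<in> overlap V j (\<iota> c) \<and> transition V j (\<iota> c) x \<in> Q c"
    if j: "j \<in> index V" and x: "x \<in> chart_img V j" for j x
  proof -
    obtain c where c: "c \<in> C" "x \<in> overlap V j (\<iota> c)" "transition V j (\<iota> c) x \<in> ball (z c) (\<epsilon> c / 2)"
      using cover[OF j x] by blast
    have "transition V j (\<iota> c) x \<in> half_space4"
      using chart_img_nonpos[OF C(2)[OF c(1)] transition_in_img[OF j c(2)]] by (simp add: half_space4_def)
    then have "transition V j (\<iota> c) x \<in> Q c" using c(3) C(3)[OF c(1)] by (simp add: Q_def)
    then show ?thesis using c by blast
  qed
  have "\<exists>K0. \<forall>K N t x. K \<ge> K0 \<longrightarrow> t \<in> {0..1} \<longrightarrow> x \<in> Q c \<longrightarrow> x $ 1 = 0 \<longrightarrow>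
      vol4 (wedge11 (dr (\<iota> c) x) ((\<bullet>) (m K N t (\<iota> c) x))) (dform V (m K N t) (\<iota> c) x) > 0" if c: "c \<in> C" for c
    by (rule contact_positive_local[OF C(2)[OF c] Q[OF c]]) blast
  then obtain K0 where K0: "\<And>c K N t x. c \<in> C \<Longrightarrow> K \<ge> K0 c \<Longrightarrow> t \<in> {0..1} \<Longrightarrow> x \<in> Q c \<Longrightarrow> x $ 1 = 0 \<Longrightarrow>
      vol4 (wedge11 (dr (\<iota> c) x) ((\<bullet>) (m K N t (\<iota> c) x))) (dform V (m K N t) (\<iota> c) x) > 0"
    by metis
  \<comment> \<open>The inserted 1 makes \<open>K\<close> positive and keeps the maximum meaningful
    when the cover is empty; the same holds for \<open>N\<close> below, which is chosen after
    \<open>K\<close>.\<close>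
  define K where "K = Max (insert 1 (K0 ` C))"
  have K: "K > 0" "\<And>c. c \<in> C \<Longrightarrow> K \<ge> K0 c"
    using C(1) Max_ge[of "insert 1 (K0 ` C)"] by (auto simp: K_def intro: less_le_trans[OF zero_less_one])
  have "\<exists>N0. \<forall>N t x. N \<ge> N0 \<longrightarrow> t \<in> {0..1} \<longrightarrow> x \<in> Q c \<longrightarrow>
      vol4 (dform V (m K N t) (\<iota> c) x) (dform V (m K N t) (\<iota> c) x) > 0" if c: "c \<in> C" for c
    by (rule symplectic_positive_local[OF C(2)[OF c] Q[OF c] K(1)]) blast
  then obtain N0 where N0: "\<And>c N t x. c \<in> C \<Longrightarrow> N \<ge> N0 c \<Longrightarrow> t \<in> {0..1} \<Longrightarrow> x \<in> Q c \<Longrightarrow>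
      vol4 (dform V (m K N t) (\<iota> c) x) (dform V (m K N t) (\<iota> c) x) > 0"
    by metis
  define N where "N = Max (insert 1 (N0 ` C))"
  have N: "\<And>c. c \<in> C \<Longrightarrow> N \<ge> N0 c" using C(1) by (simp add: N_def)
  have form: "one_form V (m K N t)" if "t \<in> {0..1}" for t by (rule smooth_form_pathD(1)[OF m_path that])
  have symp: "vol4 (dform V (m K N t) j x) (dform V (m K N t) j x) > 0"
    if t: "t \<in> {0..1}" and j: "j \<in> index V" and x: "x \<in> chart_img V j" for t j x
  proof -
    obtain c where c: "c \<in> C" "x \<in> overlap V j (\<iota> c)" "transition V j (\<iota> c) x \<in> Q c"
      using coverQ[OF j x] by blast
    \<comment> \<open>The estimate is known on the compact piece in chart \<open>\<iota> c\<close>;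
      the positive Jacobian determinant carries it to chart \<open>j\<close>.\<close>
    show ?thesis
      unfolding vol4_dform_transition[OF form[OF t] j C(2)[OF c(1)] c(2)]
      by (intro mult_pos_pos det_transition[OF j C(2)[OF c(1)] c(2)] N0[OF c(1) N[OF c(1)] t c(3)])
  qed
  have contact: "positive_contact_at (chart_img (boundary V) j) (boundary_restrict (m K N t) j) y"
    if t: "t \<in> {0..1}" and j: "j \<in> index V" and y: "y \<in> chart_img (boundary V) j" for t j y
  proof -
    let ?x = "bd_incl y"
    have x: "?x \<in> chart_img V j" using y boundary_chart_img[OF j] by simp
    obtain c where c: "c \<in> C" "?x \<in> overlap V j (\<iota> c)" "transition V j (\<iota> c) ?x \<in> Q c"
      using coverQ[OF j x] by blast
    have "transition V j (\<iota> c) ?x $ 1 = 0" by (rule transition_boundary[OF j C(2)[OF c(1)] c(2)]) simp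
    from K0[OF c(1) K(2)[OF c(1)] t c(3) this]
    have "vol4 (wedge11 (dr j ?x) ((\<bullet>) (m K N t j ?x))) (dform V (m K N t) j ?x) > 0"
      unfolding vol4_contact_transition[OF form[OF t] j C(2)[OF c(1)] c(2)]
      by (rule mult_pos_pos[OF det_transition[OF j C(2)[OF c(1)] c(2)]])
    \<comment> \<open>Dividing by the positive factor \<kappa> turns the top form on V back into the
      contact condition on the boundary.\<close>
    moreover obtain \<kappa> where "\<kappa> > 0" and \<kappa>: "vol4 (wedge11 (dr j ?x) ((\<bullet>) (m K N t j ?x))) (dform V (m K N t) j ?x) =
        \<kappa> * wedge12 ((\<bullet>) (boundary_restrict (m K N t) j y))
        (ext_deriv (chart_img (boundary V) j) (boundary_restrict (m K N t) j) y) (axis 1 1) (axis 2 1) (axis 3 1)"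
      using vol4_at_boundary[OF form[OF t] j y] by metis
    ultimately show ?thesis by (simp add: positive_contact_at_def zero_less_mult_iff)
  qed
  have "Liouville_form V (m K N t)" if t: "t \<in> {0..1}" for t
    unfolding Liouville_form_def
  proof (intro conjI)
    show "one_form V (m K N t)" by (rule form[OF t])
    show "d_symplectic V (m K N t)"
      unfolding d_symplectic_def
      using skew_nondegenerate[OF skew_dform[OF form[OF t]]] symp[OF t] by (metis less_irrefl)
    show "positive_contact_form (boundary V) (boundary_restrict (m K N t))"
      using one_form_boundary_restrict[OF form[OF t]] contact[OF t] by (simp add: positive_contact_form_def)
  qed
  moreover have "form_eq V (m K N 0) (l 0)" "form_eq V (m K N 1) (l 1)"
    by (simp_all add: form_eq_def m_def)
  ultimately show ?thesis
    unfolding Liouville_homotopic_def using m_path by blast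
qed

end

theorem proposition10:
  fixes V :: "('a, 'i, 4) manifold"
    and l :: "real \<Rightarrow> ('i, 4) coeffs"
    and \<xi> :: "real \<Rightarrow> 'i plane_field"
  assumes "oriented_manifold half_space4 V"
    and "compact_space (top_of V)"
    and "pre_Liouville_path V l \<xi>"
    and "Liouville_structure V (l 0) (\<xi> 0)"
    and "Liouville_structure V (l 1) (\<xi> 1)"
  shows "Liouville_homotopic V (l 0) (l 1)"
proof -
  interpret manifold4 V by unfold_locales (rule assms(1))
  obtain r where r: "defining_function r" using boundary_defining_function[OF assms(2)] .
  have "smooth_contact_path (boundary V) \<xi>" using assms(3) by (simp add: pre_Liouville_path_def)
  then obtain \<alpha> where \<alpha>: "smooth_form_path V \<alpha>"
    "\<And>t i y. t \<in> {0..1} \<Longrightarrow> i \<in> index V \<Longrightarrow> y \<in> chart_img (boundary V) i \<Longrightarrow>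
      coor_ker (boundary_restrict (\<alpha> t) i y) = \<xi> t i y"
    using contact_path_form[OF assms(2)] by blast
  interpret collar_data V l \<xi> r \<alpha>
    by unfold_locales (fact assms r \<alpha>)+
  show ?thesis by (rule Liouville_homotopy)
qed

end
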